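(* For any choice of real numbers $e_1>e_2>e_3$ and positive numbers $\alpha_1,\alpha_2,\alpha_3$, the sequence of measures $\{\mu_n\}$ (the root-counting measures defined in the context) strongly converges to the probability measure $\mu_Q$ supported on the interval $[e_3,e_1]$ with density $\rho_Q$ given by any of the following equivalent expressions, where $\omega$ abbreviates $\omega(e_1-e_2,\,e_3-e_2,\,s-e_2)$: (i) $$\rho_Q(s)=\frac1\pi\sqrt{\frac{1+\sqrt{1-\omega^2}}{(e_1-e_3)|s-e_2|\,\omega}}\;\mathbb K\!\left(i\sqrt{\frac{2\sqrt{1-\omega^2}}{1-\sqrt{1-\omega^2}}}\right).$$ (ii) $$\rho_Q(s)=\frac12\sqrt{\frac{1+\sqrt{1-\omega^2}}{(e_1-e_3)|s-e_2|\,\omega}}\;F\!\left(\tfrac12,\tfrac12,1;-\frac{2\sqrt{1-\omega^2}}{1-\sqrt{1-\omega^2}}\right).$$ (iii) $$\rho_Q(s)=\sqrt{\frac{\omega}{2(e_1-e_3)|s-e_2|(1+\omega)}}\;F\!\left(\tfrac12,\tfrac12,1;\frac{1-\omega}{1+\omega}\right).$$ (iv) $$\rho_Q(s)=\frac{1}{\sqrt{2\left[A(s)+(e_1-e_3)|s-e_2|\right]}}\;F\!\left(\tfrac12,\tfrac12,1;\frac{A(s)-(e_1-e_3)|s-e_2|}{A(s)+(e_1-e_3)|s-e_2|}\right),$$ where $A(s)=(e_1+e_3-2e_2)(s-e_2)+2(e_1-e_2)(e_2-e_3)$; that is, $$\rho_Q(s)=\frac1{2\pi}\int_{e_2}^{e_1}\frac{dx}{\sqrt{(e_1-x)(x-e_2)(x-e_3)(x-s)}}\quad\text{when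 } e_3<s<e_2,$$ $$\rho_Q(s)=\frac1{2\pi}\int_{e_3}^{e_2}\frac{dx}{\sqrt{(e_1-x)(e_2-x)(x-e_3)(s-x)}}\quad\text{when } e_2<s<e_1.$$
   Context: Let $e_1>e_2>e_3$ be real, $\alpha_1,\alpha_2,\alpha_3>0$, and consider the generalized Lamé equation $$S''(z)+\sum_{i=1}^3\frac{\alpha_i}{z-e_i}S'(z)+\frac{V(z)}{\prod_{i=1}^3(z-e_i)}S(z)=0,$$ where $V(z)$ is an undetermined linear polynomial. Stieltjes proved that for any positive integer $n$ there exist exactly $n+1$ polynomials $V_{n,j}(z)$, $1\le j\le n+1$, such that the equation with $V=V_{n,j}$ has a polynomial solution $S(z)$ of degree $n$; moreover the unique root $t_{n,j}$ of $V_{n,j}(z)$ lies in $(e_3,e_1)$, and these $n+1$ roots are pairwise distinct. Order them so that $t_{n,1}<t_{n,2}<\dots<t_{n,n+1}$ and set $$\mu_n=\frac1{n+1}\sum_{j=1}^{n+1}\delta(z-t_{n,j}),$$ where $\delta(z-a)$ is the Dirac measure supported at $a$; this is the root-counting measure of $Sp_n(t)=\prod_{j=1}^{n+1}(t-t_{n,j})$. The subscript $Q$ refers to the cubic polynomial with roots $e_1,e_2,e_3$. The function $\omega$ of three real variables is $$\omega(x_1,x_2,x_3)=\frac{(|x_1|+|x_2|)\,|x_3|}{|x_1||x_2-x_3|+|x_2||x_1-x_3|};$$ it is symmetric in its first two arguments and satisfies $0\le\omega(x_1,x_2,x_3)\le1$ whenever $x_1<0$, $x_2>0$ and $x_1\le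 x_3\le x_2$. The complete elliptic integral of the first kind is $\mathbb K(\zeta)=\int_0^1\frac{dt}{\sqrt{(1-t^2)(1-\zeta^2t^2)}}$. $F(a,b,c;z)={}_2F_1(a,b,c;z)=\frac{\Gamma(c)}{\Gamma(a)\Gamma(b)}\sum_{m\ge0}\frac{\Gamma(a+m)\Gamma(b+m)}{\Gamma(c+m)}\frac{z^m}{m!}$ is the Gauss hypergeometric series, with $\Gamma$ Euler's Gamma-function; for $\Re c>\Re b>0$ it is continued analytically to the plane cut along the real axis from $1$ to $\infty$ by $\frac{\Gamma(c)}{\Gamma(b)\Gamma(c-b)}\int_0^1t^{b-1}(1-t)^{c-b-1}(1-tz)^{-a}\,dt$.
   Formalization: "Strongly converges" is read as weak convergence together with uniform convergence of distribution functions; setwise or total-variation convergence is impossible, since each measure μ_n is finitely supported while μ_Q has a density. *)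

theory Defs
  imports "HOL-Probability.Probability" "HOL-Computational_Algebra.Polynomial"
begin

definition lame_solution ::
  "real \<Rightarrow> real \<Rightarrow> real \<Rightarrow> real \<Rightarrow> real \<Rightarrow> real \<Rightarrow> complex poly \<Rightarrow> complex poly \<Rightarrow> bool" where
  "lame_solution e1 e2 e3 \<alpha>1 \<alpha>2 \<alpha>3 V S \<longleftrightarrow>
     (\<forall>z::complex. z \<notin> {of_real e1, of_real e2, of_real e3} \<longrightarrow>
        poly (pderiv (pderiv S)) z
        + (of_real \<alpha>1 / (z - of_real e1) + of_real \<alpha>2 / (z - of_real e2)
           + of_real \<alpha>3 / (z - of_real e3)) * poly (pderiv S) z
        + poly V z / ((z - of_real e1) * (z - of_real e2) * (z - of_real e3)) * poly S z = 0)"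

definition van_vleck ::
  "real \<Rightarrow> real \<Rightarrow> real \<Rightarrow> real \<Rightarrow> real \<Rightarrow> real \<Rightarrow> nat \<Rightarrow> complex poly set" where
  "van_vleck e1 e2 e3 \<alpha>1 \<alpha>2 \<alpha>3 n =
     {V. degree V = 1 \<and> (\<exists>S. degree S = n \<and> lame_solution e1 e2 e3 \<alpha>1 \<alpha>2 \<alpha>3 V S)}"

text \<open>
  The roots of the Van Vleck polynomials in increasing order, numbered from 1.  For positive
  \<open>n\<close> and the parameters considered, Stieltjes' theorem says that there are exactly \<open>n + 1\<close>
  Van Vleck polynomials and that their roots are real and pairwise distinct, so that
  \<open>1 \<le> j \<le> n + 1\<close> enumerates all the roots; outside this range the value is irrelevant.
\<close>
definition van_vleck_root ::
  "real \<Rightarrow> real \<Rightarrow> real \<Rightarrow> real \<Rightarrow> real \<Rightarrow> real \<Rightarrow> nat \<Rightarrow> nat \<Rightarrow> real" where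
  "van_vleck_root e1 e2 e3 \<alpha>1 \<alpha>2 \<alpha>3 n j =
     sorted_list_of_set
       {t::real. \<exists>V \<in> van_vleck e1 e2 e3 \<alpha>1 \<alpha>2 \<alpha>3 n. poly V (of_real t) = 0} ! (j - 1)"

text \<open>\<open>return borel a\<close> is the Dirac measure at \<open>a\<close>; there is no addition on type \<open>measure\<close>.\<close>
definition root_counting_measure ::
  "real \<Rightarrow> real \<Rightarrow> real \<Rightarrow> real \<Rightarrow> real \<Rightarrow> real \<Rightarrow> nat \<Rightarrow> real measure" where
  "root_counting_measure e1 e2 e3 \<alpha>1 \<alpha>2 \<alpha>3 n =
     measure_of UNIV (sets borel)
       (\<lambda>A. (\<Sum>j=1..n+1. emeasure (return borel (van_vleck_root e1 e2 e3 \<alpha>1 \<alpha>2 \<alpha>3 n j)) A)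
            / of_nat (n + 1))"

lemma sets_root_counting_measure [simp]:
  "sets (root_counting_measure e1 e2 e3 \<alpha>1 \<alpha>2 \<alpha>3 n) = sets borel"
  unfolding root_counting_measure_def
  using sets.sigma_sets_eq[of "borel :: real measure"] by (simp add: sets_measure_of_conv)

lemma space_root_counting_measure [simp]:
  "space (root_counting_measure e1 e2 e3 \<alpha>1 \<alpha>2 \<alpha>3 n) = UNIV"
  unfolding root_counting_measure_def by (simp add: space_measure_of_conv)

lemma emeasure_root_counting_measure:
  assumes "A \<in> sets borel"
  shows "emeasure (root_counting_measure e1 e2 e3 \<alpha>1 \<alpha>2 \<alpha>3 n) A =
     (\<Sum>j=1..n+1. emeasure (return borel (van_vleck_root e1 e2 e3 \<alpha>1 \<alpha>2 \<alpha>3 n j)) A)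
     / of_nat (n + 1)"
proof (rule emeasure_measure_of[OF root_counting_measure_def])
  show "countably_additive (sets (root_counting_measure e1 e2 e3 \<alpha>1 \<alpha>2 \<alpha>3 n))
     (\<lambda>A. (\<Sum>j=1..n+1. emeasure (return borel (van_vleck_root e1 e2 e3 \<alpha>1 \<alpha>2 \<alpha>3 n j)) A)
          / of_nat (n + 1))"
  proof (rule countably_additiveI)
    fix A :: "nat \<Rightarrow> real set"
    assume A: "range A \<subseteq> sets (root_counting_measure e1 e2 e3 \<alpha>1 \<alpha>2 \<alpha>3 n)" "disjoint_family A"
    let ?f = "\<lambda>j. emeasure (return borel (van_vleck_root e1 e2 e3 \<alpha>1 \<alpha>2 \<alpha>3 n j))"
    have "(\<Sum>i. (\<Sum>j=1..n+1. ?f j (A i)) / of_nat (n + 1))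
        = (\<Sum>i. \<Sum>j=1..n+1. ?f j (A i)) / of_nat (n + 1)"
      by (simp only: divide_ennreal_def ennreal_suminf_multc)
    also have "(\<Sum>i. \<Sum>j=1..n+1. ?f j (A i)) = (\<Sum>j=1..n+1. \<Sum>i. ?f j (A i))"
      by (intro suminf_sum) simp
    also have "\<dots> = (\<Sum>j=1..n+1. ?f j (\<Union>i. A i))"
      by (intro sum.cong refl suminf_emeasure) (use A in auto)
    finally show "(\<Sum>i. (\<Sum>j=1..n+1. ?f j (A i)) / of_nat (n + 1))
        = (\<Sum>j=1..n+1. ?f j (\<Union>i. A i)) / of_nat (n + 1)" .
  qed
qed (use assms in \<open>auto simp: positive_def\<close>)

definition omega :: "real \<Rightarrow> real \<Rightarrow> real \<Rightarrow> real" where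
  "omega x1 x2 x3 =
     (\<bar>x1\<bar> + \<bar>x2\<bar>) * \<bar>x3\<bar> / (\<bar>x1\<bar> * \<bar>x2 - x3\<bar> + \<bar>x2\<bar> * \<bar>x1 - x3\<bar>)"

definition elliptic_K :: "complex \<Rightarrow> complex" where
  "elliptic_K \<zeta> =
     integral {0..1::real}
       (\<lambda>t. 1 / csqrt ((1 - (of_real t)\<^sup>2) * (1 - \<zeta>\<^sup>2 * (of_real t)\<^sup>2)))"

text \<open>
  The Gauss series inside the unit disc and, for \<open>Re c > Re b > 0\<close>, its continuation to the
  plane cut along \<open>[1, \<infinity>)\<close> by the Euler integral elsewhere.
\<close>
definition hyp2F1 :: "complex \<Rightarrow> complex \<Rightarrow> complex \<Rightarrow> complex \<Rightarrow> complex" where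
  "hyp2F1 a b c z =
     (if norm z < 1 then
        Gamma c / (Gamma a * Gamma b)
        * (\<Sum>m. Gamma (a + of_nat m) * Gamma (b + of_nat m) / Gamma (c + of_nat m)
                * z ^ m / fact m)
      else
        Gamma c / (Gamma b * Gamma (c - b))
        * integral {0..1::real}
            (\<lambda>t. of_real t powr (b - 1) * (1 - of_real t) powr (c - b - 1)
                 * (1 - of_real t * z) powr (- a)))"

end

theory Submission
  imports Defs "Jordan_Normal_Form.Determinant"
    "HOL-Computational_Algebra.Fundamental_Theorem_Algebra" "HOL-Real_Asymp.Real_Asymp"
begin

text \<open>
  Expanding a polynomial solution in powers of \<open>z - e2\<close> turns the Lame equation into a
  three-term recurrence, so the roots of the Van Vleck polynomials are the eigenvalues of an
  \<open>(n + 1) \<times> (n + 1)\<close> Jacobi matrix, whence they are real and distinct.  Near row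
  \<open>k = x n\<close> this matrix is asymptotically Toeplitz with symbol
  \<open>B(x) + 2 A(x) cos \<theta>\<close>; hence the averaged traces of its powers converge to the moments of
  \<open>B(x) + 2 A(x) cos \<theta>\<close> with \<open>x\<close> and \<open>\<theta>\<close> independent and uniform.  Since the
  entries are bounded, the characteristic functions converge, and Levy's theorem gives weak
  convergence.  The density of the limit law is a mixture of arcsine densities, that is, a complete
  elliptic integral; its various forms are related by Gauss's arithmetic-geometric mean
  transformation.
\<close>

section \<open>Jacobi matrices\<close>

text \<open>Since the solution has degree exactly n, the leading coefficient of V is forced to be
  -n(n - 1 + \<alpha>1 + \<alpha>2 + \<alpha>3). Dividing the recurrence by this number makes the
  root t of V the spectral parameter itself and keeps the matrix entries bounded. The entries are
  then quadratic in k over a quantity of order n^2, so that the \<alpha>'s enter only in lower order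
  and drop out of the limit. For fixed s the radicand of the arcsine density is a quadratic
  polynomial in x^2. Integration over x therefore gives a complete elliptic integral, whose
  parameters contain a square root q; this is the shape of (i) and (ii). One step of the
  arithmetic-geometric mean removes q and leads to (iii), (iv) and the integrals over [e2, e1] and
  [e3, e2]. Strong convergence is read both as weak convergence and as uniform convergence of the
  distribution functions; the latter follows from the former because the limit has no atoms.\<close>

fun jac_poly :: "(nat \<Rightarrow> real) \<Rightarrow> (nat \<Rightarrow> real) \<Rightarrow> nat \<Rightarrow> real poly" where
  "jac_poly b l 0 = 1"
| "jac_poly b l (Suc 0) = [:- b 0, 1:]"
| "jac_poly b l (Suc (Suc k)) =
     [:- b (Suc k), 1:] * jac_poly b l (Suc k) - Polynomial.smult (l (Suc k)) (jac_poly b l k)"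

lemma jac_poly_monic: "degree (jac_poly b l k) = k \<and> lead_coeff (jac_poly b l k) = 1"
proof (induction b l k rule: jac_poly.induct)
  case (3 b l k)
  let ?p = "[:- b (Suc k), 1:] * jac_poly b l (Suc k)"
  have nz: "jac_poly b l (Suc k) \<noteq> 0" using 3 by force
  have d: "degree ?p = Suc (Suc k)"
    using 3 nz by (subst degree_mult_eq) auto
  have "degree (Polynomial.smult (l (Suc k)) (jac_poly b l k)) \<le> k"
    using 3 by (metis degree_smult_le)
  then have lt: "degree (- Polynomial.smult (l (Suc k)) (jac_poly b l k)) < degree ?p"
    using d by simp
  have e: "jac_poly b l (Suc (Suc k)) = ?p + - Polynomial.smult (l (Suc k)) (jac_poly b l k)"
    by simp
  have "lead_coeff ?p = 1" using 3 by (subst lead_coeff_mult) auto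
  then show ?case
    unfolding e using degree_add_eq_left[OF lt] lead_coeff_add_le[OF lt] d by (simp add: lead_coeff_add_le[OF lt] add.commute)
qed auto

lemma map_poly_of_real_jac_poly_rec:
  "map_poly complex_of_real (jac_poly b l (Suc (Suc k))) =
     [:- of_real (b (Suc k)), 1:] * map_poly of_real (jac_poly b l (Suc k))
     - Polynomial.smult (of_real (l (Suc k))) (map_poly of_real (jac_poly b l k))"
  by (rule poly_eqI) (auto simp: coeff_map_poly coeff_pCons split: nat.split)

lemma pderiv_map_poly_of_real:
  "pderiv (map_poly complex_of_real p) = map_poly of_real (pderiv p)"
  by (rule poly_eqI) (simp add: coeff_map_poly coeff_pderiv)

lemma poly_map_poly_of_real:
  "poly (map_poly complex_of_real p) (of_real t) = of_real (poly p t)"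
  by (induction p) (auto simp: map_poly_pCons)

text \<open>The quotient p_(n+1) / p_n of consecutive polynomials maps the upper half-plane into
  itself: each step of the recurrence multiplies the old quantity by a positive l and adds (Im z)^2
  |p_(n+1)|^2. In particular p_(n+1) has no zero off the real axis.\<close>

lemma jac_poly_im_pos:
  fixes z :: complex
  assumes "\<And>k. 1 \<le> k \<Longrightarrow> k \<le> n \<Longrightarrow> l k > 0" and "Im z \<noteq> 0"
  shows "Im z * Im (poly (map_poly of_real (jac_poly b l (Suc n))) z
                    * cnj (poly (map_poly of_real (jac_poly b l n)) z)) > 0"
  using assms(1)
proof (induction n)
  case 0
  then show ?case using assms(2) by (simp add: map_poly_pCons) (metis not_real_square_gt_zero)
next
  case (Suc n)
  define P where "P k = poly (map_poly complex_of_real (jac_poly b l k)) z" for k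
  have rec: "P (Suc (Suc n)) = (z - of_real (b (Suc n))) * P (Suc n) - of_real (l (Suc n)) * P n"
    unfolding P_def
    unfolding map_poly_of_real_jac_poly_rec by (simp add: algebra_simps)
  have IH: "Im z * Im (P (Suc n) * cnj (P n)) > 0"
    unfolding P_def using Suc by auto
  have alg: "i * (i * c + d * x) = i\<^sup>2 * c + d * (i * x)" for i c d x :: real
    by (simp add: algebra_simps power2_eq_square)
  have "Im (P (Suc (Suc n)) * cnj (P (Suc n)))
      = Im z * (cmod (P (Suc n)))\<^sup>2 + l (Suc n) * Im (P (Suc n) * cnj (P n))"
    unfolding rec by (simp add: cmod_power2) (simp add: algebra_simps power2_eq_square)
  then have "Im z * Im (P (Suc (Suc n)) * cnj (P (Suc n)))
      = (Im z)\<^sup>2 * (cmod (P (Suc n)))\<^sup>2 + l (Suc n) * (Im z * Im (P (Suc n) * cnj (P n)))"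
    by (simp only: alg)
  also have "\<dots> > 0"
    using mult_pos_pos[OF Suc.prems[of "Suc n"] IH] by (intro add_nonneg_pos) simp_all
  finally show ?case unfolding P_def .
qed

text \<open>Confluent form of the Christoffel-Darboux argument. At a zero of the polynomial of
  degree n + 1 it gives two facts: the derivative does not vanish, so the zero is simple, and the
  polynomial of degree n does not vanish either.\<close>

lemma jac_poly_wronskian_pos:
  assumes "\<And>k. 1 \<le> k \<Longrightarrow> k \<le> n \<Longrightarrow> l k > 0"
  shows "poly (pderiv (jac_poly b l (Suc n))) t * poly (jac_poly b l n) t
       - poly (pderiv (jac_poly b l n)) t * poly (jac_poly b l (Suc n)) t > 0"
  using assms
proof (induction n)
  case 0
  then show ?case by (simp add: pderiv_pCons)
next
  case (Suc n)
  define p where "p k = poly (jac_poly b l k) t" for k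
  define p' where "p' k = poly (pderiv (jac_poly b l k)) t" for k
  have rec: "p (Suc (Suc n)) = (t - b (Suc n)) * p (Suc n) - l (Suc n) * p n"
    "p' (Suc (Suc n)) = p (Suc n) + (t - b (Suc n)) * p' (Suc n) - l (Suc n) * p' n"
    unfolding p_def p'_def
    by (simp_all add: pderiv_diff pderiv_add pderiv_mult pderiv_smult pderiv_pCons algebra_simps)
  have IH: "p' (Suc n) * p n - p' n * p (Suc n) > 0"
    unfolding p_def p'_def using Suc by auto
  have "p' (Suc (Suc n)) * p (Suc n) - p' (Suc n) * p (Suc (Suc n))
     = (p (Suc n))\<^sup>2 + l (Suc n) * (p' (Suc n) * p n - p' n * p (Suc n))"
    unfolding rec by (simp add: algebra_simps power2_eq_square)
  also have "\<dots> > 0"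
    using IH Suc.prems[of "Suc n"] by (intro add_nonneg_pos mult_pos_pos) auto
  finally show ?case unfolding p_def p'_def .
qed

lemma jac_poly_real_roots:
  fixes z :: complex
  assumes "\<And>k. 1 \<le> k \<Longrightarrow> k \<le> n \<Longrightarrow> l k > 0"
    and "poly (map_poly of_real (jac_poly b l (Suc n))) z = 0"
  shows "z = of_real (Re z)"
  using jac_poly_im_pos[of n l z b] assms by (cases "Im z = 0") (auto simp: complex_eq_iff)

text \<open>The zeros are counted over the complex numbers, where a polynomial with simple zeros has
  as many of them as its degree; all of them are real by \<open>jac_poly_real_roots\<close>.\<close>

lemma card_jac_poly_roots:
  assumes l: "\<And>k. 1 \<le> k \<Longrightarrow> k \<le> n \<Longrightarrow> l k > 0"
  shows "card {t. poly (jac_poly b l (Suc n)) t = 0} = Suc n"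
proof -
  define p where "p = jac_poly b l (Suc n)"
  define q where "q = map_poly complex_of_real p"
  have pq: "poly q (of_real t) = of_real (poly p t)"
    "poly (pderiv q) (of_real t) = of_real (poly (pderiv p) t)" for t
    unfolding q_def by (simp_all add: pderiv_map_poly_of_real poly_map_poly_of_real)
  have real: "z = of_real (Re z)" if "poly q z = 0" for z
    using jac_poly_real_roots[of n l b z] l that unfolding q_def p_def by blast
  have "rsquarefree q"
    unfolding rsquarefree_roots
  proof (intro allI notI)
    fix z assume z: "poly q z = 0 \<and> poly (pderiv q) z = 0"
    then have "z = of_real (Re z)" using real by blast
    then have "poly p (Re z) = 0" "poly (pderiv p) (Re z) = 0"
      using pq[of "Re z"] z by (metis of_real_eq_0_iff)+
    then show False
      using jac_poly_wronskian_pos[of n l b "Re z"] l by (simp add: p_def)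
  qed
  then have dec: "q = Polynomial.smult (lead_coeff q) (\<Prod>z | poly q z = 0. [:- z, 1:])"
    by (simp add: complex_poly_decompose_rsquarefree)
  have "coeff q (Suc n) = 1"
    using jac_poly_monic[of b l "Suc n"] unfolding q_def p_def
    by (metis coeff_map_poly of_real_0 of_real_1)
  then have nz: "q \<noteq> 0" by auto
  have "Suc n = degree q"
    using jac_poly_monic[of b l "Suc n"] degree_map_poly[of complex_of_real p]
    unfolding q_def p_def by (metis of_real_eq_0_iff)
  also have "\<dots> = degree (\<Prod>z | poly q z = 0. [:- z, 1:])"
    by (subst dec) (use nz in simp)
  also have "\<dots> = card {z. poly q z = 0}"
    by (subst degree_prod_eq_sum_degree) auto
  also have "{z. poly q z = 0} = of_real ` {t. poly p t = 0}"
  proof (intro subset_antisym subsetI)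
    fix z assume "z \<in> {z. poly q z = 0}"
    then have z: "z = of_real (Re z)" "poly q z = 0" using real by auto
    then have "poly p (Re z) = 0" using pq(1)[of "Re z"] by simp
    then show "z \<in> of_real ` {t. poly p t = 0}" using z(1) by blast
  qed (use pq(1) in auto)
  also have "card \<dots> = card {t. poly p t = 0}"
    by (intro card_image) (auto simp: inj_on_def)
  finally show ?thesis by (simp add: p_def)
qed

text \<open>Entry (k, i) of the m-th power of the symmetric tridiagonal matrix with diagonal b and
  with sqrt (l k) linking rows k - 1 and k. The matrix is infinite; when l (n + 1) = 0 the rows 0..n
  form a separate block, so no truncation has to be carried along.\<close>

fun jac_pow :: "(nat \<Rightarrow> real) \<Rightarrow> (nat \<Rightarrow> real) \<Rightarrow> nat \<Rightarrow> nat \<Rightarrow> nat \<Rightarrow> real" where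
  "jac_pow b l 0 k i = (if k = i then 1 else 0)"
| "jac_pow b l (Suc m) k i = b k * jac_pow b l m k i + sqrt (l (Suc k)) * jac_pow b l m (Suc k) i
     + (if k = 0 then 0 else sqrt (l k) * jac_pow b l m (k - 1) i)"

text \<open>Each of the rows 0..n has at most three nonzero entries, of absolute value at most B, so
  the maximal row sum of the block is at most 3 B.\<close>

lemma jac_pow_bound:
  assumes "\<And>k. k \<le> n \<Longrightarrow> \<bar>b k\<bar> \<le> B" and "\<And>k. 1 \<le> k \<Longrightarrow> k \<le> n \<Longrightarrow> sqrt (l k) \<le> B"
    and "\<And>k. 1 \<le> k \<Longrightarrow> k \<le> n \<Longrightarrow> l k > 0" and "l (Suc n) = 0" and "k \<le> n"
  shows "\<bar>jac_pow b l m k i\<bar> \<le> (3 * B) ^ m"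
  using \<open>k \<le> n\<close>
proof (induction m arbitrary: k)
  case (Suc m)
  have B: "B \<ge> 0" using assms(1)[of 0] by simp
  have 1: "\<bar>b k * jac_pow b l m k i\<bar> \<le> B * (3 * B) ^ m"
    unfolding abs_mult using Suc assms(1) B by (intro mult_mono) auto
  have 2: "\<bar>sqrt (l (Suc k)) * jac_pow b l m (Suc k) i\<bar> \<le> B * (3 * B) ^ m"
  \<comment> \<open>In the last row the coupling to row n + 1 is zero, so the induction never leaves
    the block.\<close>
  proof (cases "k = n")
    case False
    then show ?thesis unfolding abs_mult using Suc assms(2)[of "Suc k"] assms(3)[of "Suc k"] B
      by (intro mult_mono) (auto simp: less_imp_le)
  qed (use assms B in auto)
  have 3: "\<bar>if k = 0 then 0 else sqrt (l k) * jac_pow b l m (k - 1) i\<bar> \<le> B * (3 * B) ^ m"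
  proof (cases "k = 0")
    case False
    then have "\<bar>sqrt (l k) * jac_pow b l m (k - 1) i\<bar> \<le> B * (3 * B) ^ m"
      unfolding abs_mult using Suc assms(2)[of k] assms(3)[of k] B
      by (intro mult_mono) (auto simp: less_imp_le)
    then show ?thesis using False by simp
  qed (use B in auto)
  have "\<bar>jac_pow b l (Suc m) k i\<bar> \<le> B * (3 * B) ^ m + B * (3 * B) ^ m + B * (3 * B) ^ m"
    unfolding jac_pow.simps using 1 2 3 by linarith
  then show ?case by (simp add: algebra_simps)
qed simp

section \<open>Christoffel-Darboux formula and traces of powers\<close>

lemma jac_poly_rec:
  "poly (jac_poly b l (Suc k)) t = (t - b k) * poly (jac_poly b l k) t
     - (if k = 0 then 0 else l k * poly (jac_poly b l (k - 1)) t)"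
  by (cases k) (auto simp: algebra_simps)

text \<open>For two distinct zeros s, t of the polynomial of degree n + 1 the right-hand side
  vanishes; this is the orthogonality of the corresponding eigenvectors.\<close>

lemma jac_poly_christoffel_darboux:
  assumes "\<And>k. 1 \<le> k \<Longrightarrow> k \<le> n \<Longrightarrow> l k > 0"
  shows "(s - t) * (\<Sum>k\<le>n. poly (jac_poly b l k) s * poly (jac_poly b l k) t / (\<Prod>i=1..k. l i))
     = (poly (jac_poly b l (Suc n)) s * poly (jac_poly b l n) t
        - poly (jac_poly b l n) s * poly (jac_poly b l (Suc n)) t) / (\<Prod>i=1..n. l i)"
  using assms
proof (induction n)
  case (Suc n)
  define p where "p k = poly (jac_poly b l k)" for k
  define L where "L = (\<Prod>i=1..n. l i)"
  have pos: "L > 0" "l (Suc n) > 0" unfolding L_def using Suc.prems by (auto intro!: prod_pos)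
  have rec: "p (Suc (Suc n)) t = (t - b (Suc n)) * p (Suc n) t - l (Suc n) * p n t" for t
    by (simp add: p_def algebra_simps)
  have LS: "(\<Prod>i=1..Suc n. l i) = L * l (Suc n)" by (simp add: L_def)
  have "(s - t) * (\<Sum>k\<le>Suc n. p k s * p k t / (\<Prod>i=1..k. l i))
     = (p (Suc n) s * p n t - p n s * p (Suc n) t) / L + (s - t) * (p (Suc n) s * p (Suc n) t / (L * l (Suc n)))"
    using Suc by (simp add: p_def L_def distrib_left)
  also have "\<dots> = (p (Suc (Suc n)) s * p (Suc n) t - p (Suc n) s * p (Suc (Suc n)) t) / (L * l (Suc n))"
    unfolding rec using pos by (simp add: field_simps)
  finally show ?case unfolding LS p_def .
qed (simp add: algebra_simps)

text \<open>Explicit diagonalisation: at a zero t the numbers p_k(t) / sqrt (l 1 ... l k) form an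
  eigenvector of the symmetric matrix for the eigenvalue t, and the n + 1 zeros furnish a full
  orthogonal system. The trace of a power is then the power sum of the zeros.\<close>

theorem jac_pow_trace:
  assumes l: "\<And>k. 1 \<le> k \<Longrightarrow> k \<le> n \<Longrightarrow> l k > 0" and ln: "l (Suc n) = 0"
  shows "(\<Sum>t | poly (jac_poly b l (Suc n)) t = 0. t ^ m) = (\<Sum>k\<le>n. jac_pow b l m k k)"
proof -
  define T where "T = {t. poly (jac_poly b l (Suc n)) t = 0}"
  have cT: "card T = Suc n" unfolding T_def using card_jac_poly_roots[OF l] .
  then have fT: "finite T" by (metis card.infinite nat.distinct(1))
  define L where "L k = (\<Prod>i=1..k. l i)" for k
  have Lpos: "L k > 0" if "k \<le> n" for k
    unfolding L_def using that l by (auto intro!: prod_pos)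
  define f where "f k t = poly (jac_poly b l k) t / sqrt (L k)" for k t
  define h where "h t = (\<Sum>k\<le>n. (f k t)\<^sup>2)" for t
  have f0: "f 0 t = 1" for t by (simp add: f_def L_def)
  have hpos: "h t > 0" for t
  proof -
    have "(f 0 t)\<^sup>2 \<le> h t" unfolding h_def by (rule member_le_sum) auto
    then show ?thesis using f0 by simp
  qed
  have ortho: "(\<Sum>k\<le>n. f k s * f k t) = 0" if "s \<in> T" "t \<in> T" "s \<noteq> t" for s t
  proof -
    have "(\<Sum>k\<le>n. f k s * f k t) = (\<Sum>k\<le>n. poly (jac_poly b l k) s * poly (jac_poly b l k) t / (\<Prod>i=1..k. l i))"
    proof (rule sum.cong)
      fix k assume "k \<in> {..n}"
      then have sq: "sqrt (L k) * sqrt (L k) = L k" using Lpos[of k] by simp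
      have "f k s * f k t
          = poly (jac_poly b l k) s * poly (jac_poly b l k) t / (sqrt (L k) * sqrt (L k))"
        by (simp only: f_def times_divide_times_eq)
      then show "f k s * f k t
          = poly (jac_poly b l k) s * poly (jac_poly b l k) t / (\<Prod>i=1..k. l i)"
        unfolding sq by (simp only: L_def)
    qed simp
    moreover have "(s - t) * \<dots> = 0"
      using that by (subst jac_poly_christoffel_darboux[OF l]) (auto simp: T_def)
    ultimately show ?thesis using that by simp
  qed
  obtain e where e: "bij_betw e {0..<Suc n} T"
    using ex_bij_betw_nat_finite[OF fT] cT by auto
  define U where "U = mat (Suc n) (Suc n) (\<lambda>(k, j). f k (e j) / sqrt (h (e j)))"
  have U: "U \<in> carrier_mat (Suc n) (Suc n)" "transpose_mat U \<in> carrier_mat (Suc n) (Suc n)"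
    by (auto simp: U_def)
  have "transpose_mat U * U = 1\<^sub>m (Suc n)"
  proof (rule eq_matI)
    fix i j assume "i < dim_row (1\<^sub>m (Suc n) :: real mat)" "j < dim_col (1\<^sub>m (Suc n) :: real mat)"
    then have ij: "i < Suc n" "j < Suc n" by auto
    have eT: "e i \<in> T" "e j \<in> T" using ij e by (auto simp: bij_betw_def)
    have "(transpose_mat U * U) $$ (i, j)
        = (\<Sum>k = 0..<Suc n. f k (e i) / sqrt (h (e i)) * (f k (e j) / sqrt (h (e j))))"
      using ij by (simp add: U_def scalar_prod_def)
    also have "\<dots> = (\<Sum>k\<le>n. f k (e i) * f k (e j)) / (sqrt (h (e i)) * sqrt (h (e j)))"
      by (simp add: sum_divide_distrib atLeast0LessThan lessThan_Suc_atMost del: sum.lessThan_Suc sum.atLeast0_lessThan_Suc)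
    also have "\<dots> = (1\<^sub>m (Suc n) :: real mat) $$ (i, j)"
    proof (cases "i = j")
      case True
      have "(\<Sum>k\<le>n. f k (e j) * f k (e j)) = h (e j)"
        by (simp only: h_def power2_eq_square)
      then show ?thesis using ij hpos[of "e j"] True by simp
    next
      case False
      then have "e i \<noteq> e j" using e ij by (auto simp: bij_betw_def inj_on_def)
      then show ?thesis using ij False ortho[OF eT] by simp
    qed
    finally show "(transpose_mat U * U) $$ (i, j) = (1\<^sub>m (Suc n) :: real mat) $$ (i, j)" .
  qed (auto simp: U_def)
  \<comment> \<open>A one-sided inverse of a square matrix is two-sided. Orthonormality of the
    columns, the eigenvectors, thus passes to the rows, which is the discrete orthogonality of the
    \<open>f k\<close> with weights 1 / h t.\<close>
  then have UU: "U * transpose_mat U = 1\<^sub>m (Suc n)"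
    using mat_mult_left_right_inverse[OF U(2) U(1)] by simp
  have dual: "(\<Sum>t\<in>T. f k t * f i t / h t) = (if k = i then 1 else 0)" if "k \<le> n" "i \<le> n" for k i
  proof -
    have "(\<Sum>t\<in>T. f k t * f i t / h t) = (\<Sum>j=0..<Suc n. f k (e j) * f i (e j) / h (e j))"
      by (rule sum.reindex_bij_betw[OF e, of "\<lambda>t. f k t * f i t / h t", symmetric])
    also have "\<dots> = (\<Sum>j=0..<Suc n. f k (e j) / sqrt (h (e j)) * (f i (e j) / sqrt (h (e j))))"
      using hpos by (intro sum.cong) (auto simp: less_imp_le)
    also have "\<dots> = (U * transpose_mat U) $$ (k, i)"
      using that by (simp add: U_def scalar_prod_def less_Suc_eq_le)
    finally show ?thesis unfolding UU using that by simp
  qed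
  have frec: "t * f k t = b k * f k t + sqrt (l (Suc k)) * f (Suc k) t
      + (if k = 0 then 0 else sqrt (l k) * f (k - 1) t)" if "k \<le> n" "t \<in> T" for k t
  proof -
    have LS: "L (Suc k) = L k * l (Suc k)" for k by (simp add: L_def)
    have A: "sqrt (l (Suc k)) * f (Suc k) t = poly (jac_poly b l (Suc k)) t / sqrt (L k)"
    \<comment> \<open>In the last row both sides are zero for different reasons: l (n + 1) = 0 on
      the left, and on the right t is a zero of the polynomial of degree n + 1. The value f (n + 1)
      t, a quotient by zero, enters only multiplied by 0.\<close>
    proof (cases "k = n")
      case True
      then show ?thesis using ln \<open>t \<in> T\<close> by (simp add: T_def)
    next
      case False
      then have "l (Suc k) > 0" using l that by auto
      then show ?thesis using Lpos[OF that(1)] by (simp add: f_def LS real_sqrt_mult)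
    qed
    have B: "(if k = 0 then 0 else sqrt (l k) * f (k - 1) t)
        = (if k = 0 then 0 else l k * poly (jac_poly b l (k - 1)) t) / sqrt (L k)"
    proof (cases k)
      case (Suc j)
      then have "l k > 0" "L j > 0" using l[of k] Lpos[of j] that by auto
      then show ?thesis using Suc LS[of j] by (simp add: f_def real_sqrt_mult real_div_sqrt field_simps)
    qed simp
    have fk: "f k t = poly (jac_poly b l k) t / sqrt (L k)" by (simp add: f_def)
    show ?thesis unfolding A B unfolding jac_poly_rec[of b l k] fk
      by (simp add: diff_divide_distrib left_diff_distrib)
  qed
  have powf: "(\<Sum>i\<le>n. jac_pow b l m k i * f i t) = t ^ m * f k t" if "k \<le> n" "t \<in> T" for k t m
    using that(1)
  proof (induction m arbitrary: k)
    case 0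
    then show ?case by (simp add: if_distrib[of "\<lambda>x. x * _"] if_distribR cong: if_cong)
  next
    case (Suc m)
    have 2: "sqrt (l (Suc k)) * (\<Sum>i\<le>n. jac_pow b l m (Suc k) i * f i t)
        = sqrt (l (Suc k)) * (t ^ m * f (Suc k) t)"
      using Suc ln by (cases "k = n") auto
    have "(\<Sum>i\<le>n. jac_pow b l (Suc m) k i * f i t)
       = b k * (\<Sum>i\<le>n. jac_pow b l m k i * f i t)
         + sqrt (l (Suc k)) * (\<Sum>i\<le>n. jac_pow b l m (Suc k) i * f i t)
         + (if k = 0 then 0 else sqrt (l k) * (\<Sum>i\<le>n. jac_pow b l m (k - 1) i * f i t))"
      by (simp add: sum_distrib_left sum.distrib[symmetric] algebra_simps)
    also have "\<dots> = b k * (t ^ m * f k t) + sqrt (l (Suc k)) * (t ^ m * f (Suc k) t)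
         + (if k = 0 then 0 else sqrt (l k) * (t ^ m * f (k - 1) t))"
      using Suc 2 by auto
    also have "\<dots> = t ^ m * (t * f k t)"
      unfolding frec[OF Suc.prems that(2)] by (simp add: algebra_simps)
    finally show ?case by simp
  qed
  \<comment> \<open>The Kronecker delta that selects the diagonal is replaced by the sum over T from
    \<open>dual\<close>; after interchanging the sums, \<open>powf\<close> brings out t ^ m.\<close>
  have "(\<Sum>k\<le>n. jac_pow b l m k k) = (\<Sum>k\<le>n. \<Sum>i\<le>n. jac_pow b l m k i * (if k = i then 1 else 0))"
    by (intro sum.cong) (auto simp: if_distrib cong: if_cong)
  also have "\<dots> = (\<Sum>k\<le>n. \<Sum>i\<le>n. jac_pow b l m k i * (\<Sum>t\<in>T. f k t * f i t / h t))"
    using dual by (intro sum.cong) auto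
  also have "\<dots> = (\<Sum>k\<le>n. \<Sum>i\<le>n. \<Sum>t\<in>T. jac_pow b l m k i * f i t * f k t / h t)"
    by (simp add: sum_distrib_left mult_ac)
  also have "\<dots> = (\<Sum>k\<le>n. \<Sum>t\<in>T. \<Sum>i\<le>n. jac_pow b l m k i * f i t * f k t / h t)"
    by (intro sum.cong refl sum.swap)
  also have "\<dots> = (\<Sum>t\<in>T. \<Sum>k\<le>n. \<Sum>i\<le>n. jac_pow b l m k i * f i t * f k t / h t)"
    by (rule sum.swap)
  also have "\<dots> = (\<Sum>t\<in>T. \<Sum>k\<le>n. t ^ m * f k t * f k t / h t)"
    by (intro sum.cong refl) (simp add: sum_divide_distrib[symmetric] sum_distrib_right[symmetric] powf)
  also have "\<dots> = (\<Sum>t\<in>T. t ^ m * h t / h t)"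
    by (intro sum.cong refl) (simp add: h_def sum_divide_distrib[symmetric] sum_distrib_left power2_eq_square mult_ac)
  also have "\<dots> = (\<Sum>t\<in>T. t ^ m)"
    using hpos by (intro sum.cong refl) (metis less_irrefl nonzero_mult_div_cancel_right)
  finally show ?thesis by (simp add: T_def)
qed

section \<open>Complete elliptic integrals\<close>

text \<open>The integrands below are unbounded near an endpoint, where division by zero gives them
  the value 0, while the pulled-back h is continuous. Hence \<open>eq\<close> is asked only in the
  open interval, and nonnegativity of f lets the substitution run through the extended nonnegative
  integral before returning to \<open>has_integral\<close>.\<close>

lemma nonneg_integral_substitution:
  fixes f g g' h :: "real \<Rightarrow> real"
  assumes ab: "a < b" and f: "f \<in> borel_measurable borel" "\<And>x. x \<in> {g a..g b} \<Longrightarrow> f x \<ge> 0"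
    and g: "\<And>x. x \<in> {a..b} \<Longrightarrow> (g has_real_derivative g' x) (at x)"
    and g': "continuous_on {a..b} g'" "\<And>x. x \<in> {a..b} \<Longrightarrow> g' x \<ge> 0"
    and h: "continuous_on {a..b} h" "\<And>x. x \<in> {a..b} \<Longrightarrow> h x \<ge> 0"
    and eq: "\<And>x. x \<in> {a<..<b} \<Longrightarrow> f (g x) * g' x = h x"
  shows nn_integral_substitution_real:
      "(\<integral>\<^sup>+x. ennreal (f x) * indicator {g a..g b} x \<partial>lborel) = ennreal (integral {a..b} h)"
    and has_integral_substitution_real: "(f has_integral integral {a..b} h) {g a..g b}"
proof -
  have mono: "g x \<le> g y" if "x \<in> {a..b}" "y \<in> {a..b}" "x \<le> y" for x y
  proof (rule DERIV_nonneg_imp_nondecreasing[OF \<open>x \<le> y\<close>])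
    fix u assume "x \<le> u" "u \<le> y"
    then have "u \<in> {a..b}" using that by auto
    then show "\<exists>d. (g has_real_derivative d) (at u) \<and> 0 \<le> d" using g g'(2) by blast
  qed
  have "(\<integral>\<^sup>+x. ennreal (f x) * indicator {g a..g b} x \<partial>lborel)
      = (\<integral>\<^sup>+x. ennreal (f (g x)) * ennreal (g' x) * indicator {a..b} x \<partial>lborel)"
    by (rule nn_integral_substitution_aux) (use ab f(1) g g' in auto)
  also have "\<dots> = (\<integral>\<^sup>+x. ennreal (h x) * indicator {a..b} x \<partial>lborel)"
  proof (rule nn_integral_cong_AE)
    show "AE x in lborel. ennreal (f (g x)) * ennreal (g' x) * indicator {a..b} x
        = ennreal (h x) * indicator {a..b} x"
      using AE_lborel_singleton[of a] AE_lborel_singleton[of b]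
    proof eventually_elim
      case (elim x)
      show ?case
      proof (cases "x \<in> {a..b}")
        case True
        then have "ennreal (f (g x)) * ennreal (g' x) = ennreal (f (g x) * g' x)"
          using f(2)[of "g x"] mono[of a x] mono[of x b] g'(2) by (intro ennreal_mult[symmetric]) auto
        then show ?thesis using eq[of x] elim True by auto
      qed auto
    qed
  qed
  also have "\<dots> = ennreal (integral {a..b} h)"
    using h by (intro nn_integral_has_integral_lebesgue') (auto intro: integrable_integral integrable_continuous_real)
  finally show nn: "(\<integral>\<^sup>+x. ennreal (f x) * indicator {g a..g b} x \<partial>lborel) = ennreal (integral {a..b} h)" .
  have "((\<lambda>x. f x * indicator {g a..g b} x) has_integral integral {a..b} h) UNIV"
  proof (rule nn_integral_has_integral)
    show "(\<integral>\<^sup>+x. ennreal (f x * indicator {g a..g b} x) \<partial>lborel) = ennreal (integral {a..b} h)"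
      unfolding nn[symmetric] by (intro nn_integral_cong) (auto simp: indicator_def)
    show "0 \<le> integral {a..b} h"
      using h by (intro integral_nonneg) (auto intro: integrable_continuous_real)
  qed (use f in \<open>auto simp: indicator_def\<close>)
  then have "((\<lambda>x. if x \<in> {g a..g b} then f x else 0) has_integral integral {a..b} h) UNIV"
    by (rule has_integral_eq[rotated]) (auto simp: indicator_def)
  then show "(f has_integral integral {a..b} h) {g a..g b}"
    by (simp only: has_integral_restrict_UNIV)
qed

text \<open>Gauss's integral I(p, q): homogeneous of degree -1, invariant under the
  arithmetic-geometric mean step, and equal to K(k) for p = 1 and q = sqrt (1 - k^2). With two
  parameters an imaginary modulus is just the case q > p, and all arguments stay real.\<close>

definition ell_int :: "real \<Rightarrow> real \<Rightarrow> real" where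
  "ell_int p q = integral {0..pi/2} (\<lambda>\<phi>. 1 / sqrt (p\<^sup>2 * (cos \<phi>)\<^sup>2 + q\<^sup>2 * (sin \<phi>)\<^sup>2))"

lemma ell_int_radicand_pos:
  fixes p q \<phi> :: real
  assumes "p > 0" "q > 0"
  shows "p\<^sup>2 * (cos \<phi>)\<^sup>2 + q\<^sup>2 * (sin \<phi>)\<^sup>2 > 0"
proof (cases "cos \<phi> = 0")
  case True
  then have "(sin \<phi>)\<^sup>2 = 1" using sin_cos_squared_add[of \<phi>] by simp
  then show ?thesis using assms True by simp
qed (use assms in \<open>auto intro!: add_pos_nonneg\<close>)

lemma continuous_on_ell_int:
  assumes "p > 0" "q > 0"
  shows "continuous_on A (\<lambda>\<phi>. c / sqrt (p\<^sup>2 * (cos \<phi>)\<^sup>2 + q\<^sup>2 * (sin \<phi>)\<^sup>2))"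
  using ell_int_radicand_pos[OF assms] by (intro continuous_intros) (metis less_irrefl real_sqrt_eq_zero_cancel_iff)

lemma ell_int_scale:
  assumes "c > 0"
  shows "ell_int (c * p) (c * q) = ell_int p q / c"
proof -
  have "1 / sqrt ((c * p)\<^sup>2 * (cos \<phi>)\<^sup>2 + (c * q)\<^sup>2 * (sin \<phi>)\<^sup>2)
      = 1 / sqrt (p\<^sup>2 * (cos \<phi>)\<^sup>2 + q\<^sup>2 * (sin \<phi>)\<^sup>2) / c" for \<phi>
  proof -
    have "(c * p)\<^sup>2 * (cos \<phi>)\<^sup>2 + (c * q)\<^sup>2 * (sin \<phi>)\<^sup>2 = c\<^sup>2 * (p\<^sup>2 * (cos \<phi>)\<^sup>2 + q\<^sup>2 * (sin \<phi>)\<^sup>2)"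
      by (simp add: algebra_simps)
    then show ?thesis using assms by (simp add: real_sqrt_mult)
  qed
  then have "ell_int (c * p) (c * q)
      = integral {0..pi/2} (\<lambda>\<phi>. 1 / sqrt (p\<^sup>2 * (cos \<phi>)\<^sup>2 + q\<^sup>2 * (sin \<phi>)\<^sup>2) / c)"
    by (simp only: ell_int_def)
  also have "\<dots> = ell_int p q / c"
    unfolding ell_int_def by (rule integral_divide)
  finally show ?thesis .
qed

lemma ell_int_nonneg: "p > 0 \<Longrightarrow> q > 0 \<Longrightarrow> ell_int p q \<ge> 0"
  unfolding ell_int_def using ell_int_radicand_pos[of p q]
  by (intro integral_nonneg integrable_continuous_real continuous_on_ell_int) (auto simp: less_imp_le)

text \<open>Legendre's algebraic form, by t = sin \<phi>. It is the common target through which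
  another substitution can be compared with the trigonometric definition.\<close>

lemma ell_int_algebraic:
  assumes p: "p > 0" and q: "q > 0"
  shows "((\<lambda>t. 1 / sqrt ((1 - t\<^sup>2) * (p\<^sup>2 - (p\<^sup>2 - q\<^sup>2) * t\<^sup>2))) has_integral ell_int p q) {0..1}"
proof -
  let ?f = "\<lambda>t. 1 / sqrt ((1 - t\<^sup>2) * (p\<^sup>2 - (p\<^sup>2 - q\<^sup>2) * t\<^sup>2))"
  have rad: "p\<^sup>2 - (p\<^sup>2 - q\<^sup>2) * t\<^sup>2 \<ge> 0" if "t \<in> {0..1}" for t
  proof -
    have "t\<^sup>2 \<le> 1" using that by (auto simp: power_le_one)
    then have "p\<^sup>2 * (1 - t\<^sup>2) + q\<^sup>2 * t\<^sup>2 \<ge> 0" by simp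
    then show ?thesis by (simp add: algebra_simps)
  qed
  have "(?f has_integral ell_int p q) {sin 0..sin (pi/2)}"
    unfolding ell_int_def
  proof (rule has_integral_substitution_real[where g' = cos])
    fix x assume "x \<in> {sin 0..sin (pi/2)}"
    then show "?f x \<ge> 0" using rad[of x] by (auto intro!: mult_nonneg_nonneg simp: power_le_one)
  next
    fix x assume x: "x \<in> {0<..<pi/2}"
    then have c: "cos x > 0" by (auto intro: cos_gt_zero)
    have "(1 - (sin x)\<^sup>2) * (p\<^sup>2 - (p\<^sup>2 - q\<^sup>2) * (sin x)\<^sup>2) = (cos x)\<^sup>2 * (p\<^sup>2 * (cos x)\<^sup>2 + q\<^sup>2 * (sin x)\<^sup>2)"
      unfolding cos_squared_eq by (simp add: algebra_simps)
    then show "?f (sin x) * cos x = 1 / sqrt (p\<^sup>2 * (cos x)\<^sup>2 + q\<^sup>2 * (sin x)\<^sup>2)"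
      using c by (simp add: real_sqrt_mult)
  next
    fix x show "1 / sqrt (p\<^sup>2 * (cos x)\<^sup>2 + q\<^sup>2 * (sin x)\<^sup>2) \<ge> 0"
      using ell_int_radicand_pos[OF p q, of x] by simp
  qed (auto intro!: derivative_eq_intros continuous_intros cos_ge_zero continuous_on_ell_int p q)
  then show ?thesis by simp
qed

text \<open>Gauss's substitution \<open>sin \<phi> = 2 p sin \<psi> / ((p + q) + (p - q) sin\<^sup>2 \<psi>)\<close>.\<close>
lemma ell_int_gauss:
  assumes p: "p > 0" and q: "q > 0"
  shows "ell_int p q = ell_int ((p + q) / 2) (sqrt (p * q))"
proof -
  let ?f = "\<lambda>t. 1 / sqrt ((1 - t\<^sup>2) * (p\<^sup>2 - (p\<^sup>2 - q\<^sup>2) * t\<^sup>2))"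
  define d where "d x = (p + q) + (p - q) * (sin x)\<^sup>2" for x
  define n where "n x = (p + q) - (p - q) * (sin x)\<^sup>2" for x
  define g where "g x = 2 * p * sin x / d x" for x
  define g' where "g' x = 2 * p * cos x * n x / (d x)\<^sup>2" for x
  define r where "r x = (p + q)\<^sup>2 - (p - q)\<^sup>2 * (sin x)\<^sup>2" for x
  \<comment> \<open>Both are written with positive weights on cos^2 and sin^2, because p - q may
    have either sign.\<close>
  have "d x = (sqrt (p + q))\<^sup>2 * (cos x)\<^sup>2 + (sqrt (2 * p))\<^sup>2 * (sin x)\<^sup>2"
    and "n x = (sqrt (p + q))\<^sup>2 * (cos x)\<^sup>2 + (sqrt (2 * q))\<^sup>2 * (sin x)\<^sup>2" for x
    using p q unfolding d_def n_def cos_squared_eq by (simp_all add: algebra_simps)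
  then have dpos: "d x > 0" and npos: "n x > 0" for x
    using ell_int_radicand_pos[of "sqrt (p + q)" "sqrt (2 * p)" x]
      ell_int_radicand_pos[of "sqrt (p + q)" "sqrt (2 * q)" x] p q by simp_all
  have req: "r x = 4 * (((p + q) / 2)\<^sup>2 * (cos x)\<^sup>2 + (sqrt (p * q))\<^sup>2 * (sin x)\<^sup>2)" for x
    using p q unfolding r_def cos_squared_eq by (simp add: field_simps power2_eq_square)
  have rpos: "r x > 0" for x
    unfolding req using ell_int_radicand_pos[of "(p + q) / 2" "sqrt (p * q)" x] p q by simp
  have g0: "g 0 = 0" "g (pi/2) = 1" using p q by (simp_all add: g_def d_def)
  have rad: "p\<^sup>2 - (p\<^sup>2 - q\<^sup>2) * t\<^sup>2 \<ge> 0" if "t \<in> {0..1}" for t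
  proof -
    have "t\<^sup>2 \<le> 1" using that by (auto simp: power_le_one)
    then have "p\<^sup>2 * (1 - t\<^sup>2) + q\<^sup>2 * t\<^sup>2 \<ge> 0" by simp
    then show ?thesis by (simp add: algebra_simps)
  qed
  have "(?f has_integral ell_int ((p + q) / 2) (sqrt (p * q))) {g 0..g (pi/2)}"
    unfolding ell_int_def
  proof (rule has_integral_substitution_real[where g' = g'])
    fix x assume "x \<in> {g 0..g (pi/2)}"
    then show "?f x \<ge> 0" unfolding g0 using rad[of x] by (auto intro!: mult_nonneg_nonneg simp: power_le_one)
  next
    fix x :: real
    show "(g has_real_derivative g' x) (at x)"
      unfolding g_def[abs_def] using dpos[of x]
      by (auto intro!: derivative_eq_intros simp: d_def) (simp add: g'_def d_def n_def field_simps power2_eq_square)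
  next
    show "continuous_on {0..pi/2} g'"
      unfolding g'_def[abs_def] n_def d_def using dpos
      by (intro continuous_intros) (simp add: d_def less_le)
  next
    fix x assume "x \<in> {0..pi/2}"
    then show "g' x \<ge> 0" using p npos[of x] cos_ge_zero[of x]
      by (simp add: g'_def)
  next
    fix x assume x: "x \<in> {0<..<pi/2}"
    then have c: "cos x > 0" by (auto intro: cos_gt_zero)
    \<comment> \<open>The second factor of the radicand becomes a perfect square, and its root
      cancels n x in g'; the only root that survives is that of r x, the radicand for the two
      means.\<close>
    have 1: "1 - (g x)\<^sup>2 = (cos x)\<^sup>2 * r x / (d x)\<^sup>2"
      using dpos[of x] unfolding g_def r_def cos_squared_eq
      by (simp add: field_simps) (simp add: d_def algebra_simps power2_eq_square power4_eq_xxxx)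
    have 2: "p\<^sup>2 - (p\<^sup>2 - q\<^sup>2) * (g x)\<^sup>2 = p\<^sup>2 * (n x)\<^sup>2 / (d x)\<^sup>2"
      using dpos[of x] unfolding g_def n_def
      by (simp add: field_simps) (simp add: d_def algebra_simps power2_eq_square power4_eq_xxxx)
    have "sqrt ((1 - (g x)\<^sup>2) * (p\<^sup>2 - (p\<^sup>2 - q\<^sup>2) * (g x)\<^sup>2)) = cos x * sqrt (r x) * p * n x / (d x)\<^sup>2"
      unfolding 1 2 using c p npos[of x] dpos[of x]
      by (simp add: real_sqrt_mult real_sqrt_divide power2_eq_square)
    then have "?f (g x) * g' x = 2 / sqrt (r x)"
      using c p npos[of x] dpos[of x] rpos[of x] by (simp add: g'_def)
    also have "\<dots> = 1 / sqrt (((p + q) / 2)\<^sup>2 * (cos x)\<^sup>2 + (sqrt (p * q))\<^sup>2 * (sin x)\<^sup>2)"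
    proof -
      have "2 / sqrt (4 * y) = 1 / sqrt y" for y by (simp add: real_sqrt_mult)
      then show ?thesis unfolding req .
    qed
    finally show "?f (g x) * g' x = \<dots>" .
  next
    fix x show "1 / sqrt (((p + q) / 2)\<^sup>2 * (cos x)\<^sup>2 + (sqrt (p * q))\<^sup>2 * (sin x)\<^sup>2) \<ge> 0"
      using ell_int_radicand_pos[of "(p + q) / 2" "sqrt (p * q)" x] p q by simp
  next
    show "continuous_on {0..pi / 2} (\<lambda>x. 1 / sqrt (((p + q) / 2)\<^sup>2 * (cos x)\<^sup>2 + (sqrt (p * q))\<^sup>2 * (sin x)\<^sup>2))"
      using p q by (intro continuous_on_ell_int) auto
  qed auto
  then show ?thesis using has_integral_unique[OF ell_int_algebraic[OF p q]] unfolding g0 by blast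
qed

section \<open>\<open>elliptic_K\<close> and \<open>hyp2F1\<close> on the real and imaginary axes in
  terms of \<open>ell_int\<close>\<close>

lemma elliptic_K_imaginary:
  assumes "\<kappa> \<ge> 0"
  shows "elliptic_K (\<i> * of_real \<kappa>) = of_real (ell_int 1 (sqrt (1 + \<kappa>\<^sup>2)))"
proof -
  let ?f = "\<lambda>t::real. 1 / sqrt ((1 - t\<^sup>2) * (1\<^sup>2 - (1\<^sup>2 - (sqrt (1 + \<kappa>\<^sup>2))\<^sup>2) * t\<^sup>2))"
  have "((\<lambda>t. complex_of_real (?f t)) has_integral of_real (ell_int 1 (sqrt (1 + \<kappa>\<^sup>2)))) {0..1}"
    by (intro has_integral_of_real ell_int_algebraic) (auto intro: add_pos_nonneg)
  then have "((\<lambda>t. 1 / csqrt ((1 - (of_real t)\<^sup>2) * (1 - (\<i> * of_real \<kappa>)\<^sup>2 * (of_real t)\<^sup>2)))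
       has_integral of_real (ell_int 1 (sqrt (1 + \<kappa>\<^sup>2)))) {0..1}"
  proof (rule has_integral_eq[rotated])
    fix t :: real assume t: "t \<in> {0..1}"
    have k: "(sqrt (1 + \<kappa>\<^sup>2))\<^sup>2 = 1 + \<kappa>\<^sup>2" by simp
    have "(1 - (of_real t)\<^sup>2) * (1 - (\<i> * of_real \<kappa>)\<^sup>2 * (of_real t)\<^sup>2)
       = complex_of_real ((1 - t\<^sup>2) * (1\<^sup>2 - (1\<^sup>2 - (sqrt (1 + \<kappa>\<^sup>2))\<^sup>2) * t\<^sup>2))"
      unfolding k by (simp add: power_mult_distrib)
    moreover have "(1 - t\<^sup>2) * (1\<^sup>2 - (1\<^sup>2 - (sqrt (1 + \<kappa>\<^sup>2))\<^sup>2) * t\<^sup>2) \<ge> 0"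
      unfolding k using t by (intro mult_nonneg_nonneg) (auto simp: power_le_one)
    ultimately show "complex_of_real (?f t)
      = 1 / csqrt ((1 - (of_real t)\<^sup>2) * (1 - (\<i> * of_real \<kappa>)\<^sup>2 * (of_real t)\<^sup>2))"
      by (metis csqrt_of_real_nonneg of_real_1 of_real_divide complex.sel of_real_def Re_complex_of_real Im_complex_of_real)
  qed
  then show ?thesis unfolding elliptic_K_def by (rule integral_unique)
qed

text \<open>The function -cos x (sin x)^(2m+1) vanishes at 0 and at pi/2, and its derivative is (2m
  + 2) (sin x)^(2m+2) - (2m + 1) (sin x)^(2m); this links consecutive even powers.\<close>

lemma wallis:
  "((\<lambda>x::real. (sin x) ^ (2 * m)) has_integral pi / 2 * (pochhammer (1/2) m / fact m)) {0..pi/2}"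
proof (induction m)
  case 0
  have "((\<lambda>x::real. 1::real) has_integral (pi/2 - 0)) {0..pi/2}"
    using has_integral_const_real[of "1::real" 0 "pi/2"] by simp
  then show ?case by simp
next
  case (Suc m)
  have "((\<lambda>x::real. (2 * real m + 2) * (sin x) ^ (2 * Suc m) - (2 * real m + 1) * (sin x) ^ (2 * m)) has_integral
        (- cos (pi/2) * (sin (pi/2)) ^ (2 * m + 1)) - (- cos 0 * (sin 0) ^ (2 * m + 1))) {0..pi/2}"
  proof (rule fundamental_theorem_of_calculus)
    fix x :: real
    have "((\<lambda>x. - cos x * (sin x) ^ (2 * m + 1)) has_real_derivative
        (sin x * (sin x) ^ (2 * m + 1) - cos x * (real (2 * m + 1) * (sin x) ^ (2 * m) * cos x))) (at x)"
      using DERIV_mult[OF DERIV_minus[OF DERIV_cos] DERIV_power_Suc[OF DERIV_sin, of "2 * m"], of x]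
      by (simp add: algebra_simps)
    also have "(sin x * (sin x) ^ (2 * m + 1) - cos x * (real (2 * m + 1) * (sin x) ^ (2 * m) * cos x))
      = (sin x)\<^sup>2 * (sin x) ^ (2 * m) - (2 * real m + 1) * (sin x) ^ (2 * m) * (cos x)\<^sup>2"
      by (simp add: power2_eq_square)
    also have "\<dots> = (2 * real m + 2) * (sin x) ^ (2 * Suc m) - (2 * real m + 1) * (sin x) ^ (2 * m)"
      unfolding cos_squared_eq by (simp add: algebra_simps power2_eq_square)
    finally show "((\<lambda>x. - cos x * (sin x) ^ (2 * m + 1)) has_vector_derivative
        ((2 * real m + 2) * (sin x) ^ (2 * Suc m) - (2 * real m + 1) * (sin x) ^ (2 * m))) (at x within {0..pi/2})"
      by (simp add: has_real_derivative_iff_has_vector_derivative has_vector_derivative_at_within)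
  qed simp
  from has_integral_add[OF this has_integral_mult_right[OF Suc, of "2 * real m + 1"]]
  have "((\<lambda>x::real. (2 * real m + 2) * (sin x) ^ (2 * Suc m)) has_integral
      (2 * real m + 1) * (pi / 2 * (pochhammer (1/2) m / fact m))) {0..pi/2}"
    by simp
  from has_integral_mult_right[OF this, of "1 / (2 * real m + 2)"]
  show ?case
    by (rule has_integral_eq_rhs[OF has_integral_eq[rotated]])
      (auto simp: pochhammer_Suc field_simps)
qed

lemma pochhammer_half_fact: "0 \<le> pochhammer (1/2::real) m / fact m \<and> pochhammer (1/2::real) m / fact m \<le> 1"
proof (induction m)
  case (Suc m)
  have "pochhammer (1/2::real) (Suc m) / fact (Suc m) = pochhammer (1/2) m / fact m * ((1/2 + m) / (1 + m))"
    by (simp add: pochhammer_Suc)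
  moreover have "0 \<le> (1/2 + real m) / (1 + m)" "(1/2 + real m) / (1 + m) \<le> 1" by (auto simp: field_simps)
  ultimately show ?case using Suc by (metis mult_le_one mult_nonneg_nonneg)
qed simp

text \<open>Binomial expansion of (1 - z sin^2 \<phi>)^(-1/2), integrated term by term with the
  geometric series in |z| as majorant. The factor (1/2)_m / m! is squared because it occurs once as
  a binomial coefficient and once in Wallis' integral.\<close>

lemma ell_int_series:
  assumes z: "\<bar>z\<bar> < 1"
  shows "(\<lambda>m. (pochhammer (1/2) m / fact m)\<^sup>2 * z ^ m) sums (2 / pi * ell_int 1 (sqrt (1 - z)))"
proof -
  define c where "c m = pochhammer (1/2::real) m / fact m" for m
  have cnn: "c m \<ge> 0" for m using pochhammer_half_fact[of m] by (simp only: c_def)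
  define F where "F m x = c m * z ^ m * (sin x) ^ (2 * m)" for m and x :: real
  have le: "\<bar>z * (sin x)\<^sup>2\<bar> \<le> \<bar>z\<bar>" for x
    using abs_sin_le_one[of x] by (auto simp: abs_mult mult_left_le power_le_one abs_square_le_1)
  have su: "(\<lambda>m. F m x) sums (1 / sqrt (1\<^sup>2 * (cos x)\<^sup>2 + (sqrt (1 - z))\<^sup>2 * (sin x)\<^sup>2))" for x
  proof -
    let ?u = "z * (sin x)\<^sup>2"
    have u: "\<bar>- ?u\<bar> < 1" using le[of x] z by simp
    have "F m x = ((-1/2) gchoose m) * (- ?u) ^ m" for m
      by (simp add: F_def c_def gbinomial_pochhammer power_mult power_mult_distrib power_minus[of ?u])
    moreover have "(1 + - ?u) powr (-1/2) = 1 / sqrt (1\<^sup>2 * (cos x)\<^sup>2 + (sqrt (1 - z))\<^sup>2 * (sin x)\<^sup>2)"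
    proof -
      have "1 + - ?u = 1\<^sup>2 * (cos x)\<^sup>2 + (sqrt (1 - z))\<^sup>2 * (sin x)\<^sup>2"
        using z unfolding cos_squared_eq by (simp add: algebra_simps)
      moreover have "1 + - ?u > 0" using u by linarith
      moreover have "(1 + - ?u) powr (-1/2) = 1 / sqrt (1 + - ?u)"
        using \<open>1 + - ?u > 0\<close> powr_minus_divide[of "1 + - ?u" "1/2"] powr_half_sqrt[of "1 + - ?u"] by simp
      ultimately show ?thesis by simp
    qed
    ultimately show ?thesis using gen_binomial_real[OF u, of "-1/2"] by simp
  qed
  have "uniform_limit {0..pi/2} (\<lambda>n x. \<Sum>m<n. F m x) (\<lambda>x. \<Sum>m. F m x) sequentially"
  proof (rule Weierstrass_m_test)
    fix m x
    have "\<bar>F m x\<bar> = c m * (\<bar>z\<bar> ^ m * (\<bar>sin x\<bar> ^ (2 * m)))"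
      using cnn[of m] by (simp add: F_def abs_mult power_abs)
    also have "\<dots> \<le> 1 * (\<bar>z\<bar> ^ m * 1)"
      using pochhammer_half_fact[of m] by (intro mult_mono power_le_one) (auto simp: c_def)
    finally show "norm (F m x) \<le> \<bar>z\<bar> ^ m" by simp
  qed (use z in auto)
  then obtain I J where I: "\<And>n. ((\<lambda>x. \<Sum>m<n. F m x) has_integral I n) {0..pi/2}"
    and J: "((\<lambda>x. \<Sum>m. F m x) has_integral J) {0..pi/2}" and IJ: "I \<longlonglongrightarrow> J"
    by (rule uniform_limit_integral) (auto simp: F_def intro!: continuous_intros)
  have "((\<lambda>x. \<Sum>m<n. F m x) has_integral (\<Sum>m<n. c m * z ^ m * (pi / 2 * c m))) {0..pi/2}" for n
    unfolding F_def c_def by (intro has_integral_sum has_integral_mult_right wallis) auto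
  then have "I = (\<lambda>n. \<Sum>m<n. c m * z ^ m * (pi / 2 * c m))"
    using I has_integral_unique by blast
  then have "(\<lambda>m. c m * z ^ m * (pi / 2 * c m)) sums J" using IJ by (simp add: sums_def)
  from sums_mult[OF this, of "2 / pi"]
  have "(\<lambda>m. (c m)\<^sup>2 * z ^ m) sums (2 / pi * J)"
    by (simp add: power2_eq_square mult_ac)
  moreover have "J = ell_int 1 (sqrt (1 - z))"
    unfolding ell_int_def using J sums_unique[OF su] by (metis (no_types, lifting) integral_cong integral_unique)
  ultimately show ?thesis by (simp add: c_def)
qed

text \<open>Both branches of \<open>hyp2F1\<close> occur, since the argument in form (ii) runs
  through (-\<infinity>, 0]. The series is \<open>ell_int_series\<close>; for z \<le> -1 the Euler
  integral becomes the same elliptic integral by t = sin^2 \<phi>.\<close>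

lemma hyp2F1_half_half_one:
  assumes z: "z < 1"
  shows "hyp2F1 (1/2) (1/2) 1 (of_real z) = of_real (2 / pi * ell_int 1 (sqrt (1 - z)))"
proof (cases "\<bar>z\<bar> < 1")
  case True
  have G: "Gamma (1/2 + of_nat m :: complex) = Gamma (1/2) * of_real (pochhammer (1/2) m)" for m
  proof -
    have "pochhammer (1/2 :: complex) m = Gamma (1/2 + of_nat m) / Gamma (1/2)"
      using Gamma_eq_zero_iff[of "1/2::complex"]
      by (intro pochhammer_Gamma) (simp add: Gamma_one_half_complex)
    moreover have "pochhammer (1/2 :: complex) m = of_real (pochhammer (1/2) m)"
      using pochhammer_of_real[of "1/2" m, where ?'a = complex] by simp
    moreover have "Gamma (1/2 :: complex) \<noteq> 0" by (simp add: Gamma_one_half_complex)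
    ultimately show ?thesis by (simp add: field_simps)
  qed
  have "(\<lambda>m. complex_of_real ((pochhammer (1/2) m / fact m)\<^sup>2 * z ^ m)) sums of_real (2 / pi * ell_int 1 (sqrt (1 - z)))"
    by (intro sums_of_real ell_int_series True)
  from sums_mult[OF this, of "Gamma (1/2) * Gamma (1/2)"]
  have "(\<lambda>m. Gamma (1/2 + of_nat m :: complex) * Gamma (1/2 + of_nat m) / Gamma (1 + of_nat m) * of_real z ^ m / fact m)
      sums (Gamma (1/2) * Gamma (1/2) * of_real (2 / pi * ell_int 1 (sqrt (1 - z))))"
    unfolding G by (simp add: Gamma_fact power2_eq_square field_simps)
  then show ?thesis using True
    by (simp add: hyp2F1_def sums_iff Gamma_one_half_complex)
next
  case False
  let ?f = "\<lambda>t. 1 / (sqrt t * sqrt (1 - t) * sqrt (1 - t * z))"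
  have zneg: "z < 0" using False z by linarith
  have "(?f has_integral integral {0..pi/2} (\<lambda>x. 2 / sqrt (1\<^sup>2 * (cos x)\<^sup>2 + (sqrt (1 - z))\<^sup>2 * (sin x)\<^sup>2))) {(sin 0)\<^sup>2..(sin (pi/2))\<^sup>2}"
  proof (rule has_integral_substitution_real[where g = "\<lambda>x. (sin x)\<^sup>2" and g' = "\<lambda>x. 2 * sin x * cos x"])
    fix t :: real assume "t \<in> {(sin 0)\<^sup>2..(sin (pi/2))\<^sup>2}"
    then have "t \<ge> 0" "t \<le> 1" "t * z \<le> 0" using zneg by (auto simp: mult_nonneg_nonpos)
    then show "?f t \<ge> 0" by (intro divide_nonneg_nonneg mult_nonneg_nonneg real_sqrt_ge_zero) auto
  next
    fix x :: real assume x: "x \<in> {0<..<pi/2}"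
    then have c: "cos x > 0" "sin x > 0" by (auto intro: cos_gt_zero sin_gt_zero2)
    have "1 - (sin x)\<^sup>2 = (cos x)\<^sup>2" by (simp add: cos_squared_eq)
    moreover have "1 - (sin x)\<^sup>2 * z = 1\<^sup>2 * (cos x)\<^sup>2 + (sqrt (1 - z))\<^sup>2 * (sin x)\<^sup>2"
      using z unfolding cos_squared_eq by (simp add: algebra_simps)
    ultimately show "?f ((sin x)\<^sup>2) * (2 * sin x * cos x) = 2 / sqrt (1\<^sup>2 * (cos x)\<^sup>2 + (sqrt (1 - z))\<^sup>2 * (sin x)\<^sup>2)"
      using c by simp
  next
    fix x show "2 / sqrt (1\<^sup>2 * (cos x)\<^sup>2 + (sqrt (1 - z))\<^sup>2 * (sin x)\<^sup>2) \<ge> 0"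
      using ell_int_radicand_pos[of 1 "sqrt (1 - z)" x] z by simp
  next
    show "continuous_on {0..pi/2} (\<lambda>x. 2 / sqrt (1\<^sup>2 * (cos x)\<^sup>2 + (sqrt (1 - z))\<^sup>2 * (sin x)\<^sup>2))"
      using z by (intro continuous_on_ell_int) auto
  qed (auto intro!: derivative_eq_intros continuous_intros mult_nonneg_nonneg cos_ge_zero sin_ge_zero)
  moreover have "integral {0..pi/2} (\<lambda>x. 2 / sqrt (1\<^sup>2 * (cos x)\<^sup>2 + (sqrt (1 - z))\<^sup>2 * (sin x)\<^sup>2)) = 2 * ell_int 1 (sqrt (1 - z))"
    unfolding ell_int_def integral_mult_right[symmetric] by simp
  ultimately have "(?f has_integral (2 * ell_int 1 (sqrt (1 - z)))) {0..1}" by simp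
  then have "((\<lambda>t. complex_of_real (?f t)) has_integral of_real (2 * ell_int 1 (sqrt (1 - z)))) {0..1}"
    by (rule has_integral_of_real)
  then have "((\<lambda>t. of_real t powr (1/2 - 1) * (1 - of_real t) powr (1 - 1/2 - 1) * (1 - of_real t * of_real z) powr (- (1/2)))
      has_integral complex_of_real (2 * ell_int 1 (sqrt (1 - z)))) {0..1}"
  proof (rule has_integral_eq[rotated])
    fix t :: real assume t: "t \<in> {0..1}"
    \<comment> \<open>This includes x = 0, where both sides are 0 by convention, so the integrands
      agree on the closed interval.\<close>
    have P: "of_real x powr (- (1/2)) = complex_of_real (1 / sqrt x)" if "x \<ge> 0" for x
    proof -
      have "of_real x powr (of_real (- (1/2))) = complex_of_real (x powr (- (1/2)))"
        using that by (rule powr_of_real)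
      then show ?thesis using that by (simp add: powr_minus_divide powr_half_sqrt)
    qed
    have "1 - t * z \<ge> 0" using t zneg by (simp add: mult_nonneg_nonpos order_trans[of _ 0])
    then show "complex_of_real (?f t) = of_real t powr (1/2 - 1) * (1 - of_real t) powr (1 - 1/2 - 1) * (1 - of_real t * of_real z) powr (- (1/2))"
      using P[of t] P[of "1 - t"] P[of "1 - t * z"] t by simp
  qed
  then have "integral {0..1} (\<lambda>t. of_real t powr (1/2 - 1) * (1 - of_real t) powr (1 - 1/2 - 1) * (1 - of_real t * of_real z) powr (- (1/2)))
      = complex_of_real (2 * ell_int 1 (sqrt (1 - z)))"
    by (rule integral_unique)
  moreover have "Gamma (1/2) * Gamma (1 - 1/2) = complex_of_real pi"
    by (simp add: Gamma_one_half_complex flip: of_real_mult)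
  ultimately show ?thesis using False unfolding hyp2F1_def by simp
qed

text \<open>The Moebius substitution sin^2 \<phi> = (a - c)(x - b) / ((a - b)(x - c)) takes x = b to
  0 and x = a to pi/2; the constant m is the value of (x - b) / (x - c) at x = a.\<close>

lemma ell_int_four_roots:
  assumes "a > b" "b > c" "c > d"
  shows "((\<lambda>x. 1 / sqrt ((a - x) * (x - b) * (x - c) * (x - d))) has_integral
     2 * ell_int (sqrt ((a - c) * (b - d))) (sqrt ((b - c) * (a - d)))) {b..a}"
proof -
  define m where "m = (a - b) / (a - c)"
  have m: "0 < m" "m < 1" using assms by (auto simp: m_def)
  define D where "D x = 1 - m * (sin x)\<^sup>2" for x
  define g where "g x = c + (b - c) / D x" for x
  define g' where "g' x = 2 * m * (b - c) * sin x * cos x / (D x)\<^sup>2" for x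
  define R where "R x = (sqrt ((a - c) * (b - d)))\<^sup>2 * (cos x)\<^sup>2 + (sqrt ((b - c) * (a - d)))\<^sup>2 * (sin x)\<^sup>2" for x
  have Dpos: "D x > 0" for x
  proof -
    have "m * (sin x)\<^sup>2 \<le> m * 1" using m by (intro mult_left_mono) (auto simp: abs_square_le_1)
    then show ?thesis unfolding D_def using m by linarith
  qed
  have pos: "sqrt ((a - c) * (b - d)) > 0" "sqrt ((b - c) * (a - d)) > 0" using assms by auto
  have Rpos: "R x > 0" for x unfolding R_def by (rule ell_int_radicand_pos[OF pos])
  have "(sqrt ((a - c) * (b - d)))\<^sup>2 = (a - c) * (b - d)" "(sqrt ((b - c) * (a - d)))\<^sup>2 = (b - c) * (a - d)"
    using assms by (intro real_sqrt_pow2 mult_nonneg_nonneg; simp)+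
  then have Req: "R x = (a - c) * (b - d) * (cos x)\<^sup>2 + (b - c) * (a - d) * (sin x)\<^sup>2" for x
    by (simp only: R_def)
  have g0: "g 0 = b" "g (pi/2) = a"
  proof -
    show "g 0 = b" by (simp add: g_def D_def)
    have "1 - m = (b - c) / (a - c)" using assms by (simp add: m_def field_simps)
    then show "g (pi/2) = a" using assms by (simp add: g_def D_def)
  qed
  have "((\<lambda>x. 1 / sqrt ((a - x) * (x - b) * (x - c) * (x - d))) has_integral integral {0..pi/2} (\<lambda>x. 2 / sqrt (R x))) {g 0..g (pi/2)}"
  proof (rule has_integral_substitution_real[where g' = g'])
    fix x assume "x \<in> {g 0..g (pi/2)}"
    then show "1 / sqrt ((a - x) * (x - b) * (x - c) * (x - d)) \<ge> 0" unfolding g0 using assms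
      by (auto intro!: mult_nonneg_nonneg)
  next
    fix x :: real
    show "(g has_real_derivative g' x) (at x)"
      unfolding g_def[abs_def] using Dpos[of x]
      by (auto intro!: derivative_eq_intros simp: D_def) (simp add: g'_def D_def field_simps power2_eq_square)
  next
    show "continuous_on {0..pi/2} g'"
      unfolding g'_def[abs_def] D_def using Dpos
      by (intro continuous_intros) (simp add: D_def less_le)
  next
    fix x assume "x \<in> {0..pi/2}"
    then show "g' x \<ge> 0" using m assms cos_ge_zero[of x] sin_ge_zero[of x]
      by (simp add: g'_def)
  next
    show "continuous_on {0..pi/2} (\<lambda>x. 2 / sqrt (R x))"
      unfolding R_def by (rule continuous_on_ell_int[OF pos])
  next
    fix x assume x: "x \<in> {0<..<pi/2}"
    then have cs: "cos x > 0" "sin x > 0" by (auto intro: cos_gt_zero sin_gt_zero2)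
    have ac: "m * (a - c) = a - b" using assms by (simp add: m_def)
    have 1: "a - g x = (a - b) * (cos x)\<^sup>2 / D x"
    proof -
      have "(a - g x) * D x = (a - c) * D x - (b - c)" using Dpos[of x] by (simp add: g_def field_simps)
      also have "\<dots> = (a - b) - (m * (a - c)) * (sin x)\<^sup>2" by (simp add: D_def algebra_simps)
      also have "\<dots> = (a - b) * (cos x)\<^sup>2" unfolding ac cos_squared_eq by (simp add: algebra_simps)
      finally show ?thesis using Dpos[of x] by (simp add: field_simps)
    qed
    have 2: "g x - b = (b - c) * m * (sin x)\<^sup>2 / D x"
    proof -
      have "(g x - b) * D x = (b - c) * (1 - D x)" using Dpos[of x] by (simp add: g_def field_simps)
      then show ?thesis using Dpos[of x] by (simp add: D_def field_simps)
    qed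
    have 3: "g x - c = (b - c) / D x" by (simp add: g_def)
    have 4: "g x - d = R x / (a - c) / D x"
    proof -
      have "(g x - d) * D x * (a - c) = ((c - d) * D x + (b - c)) * (a - c)" using Dpos[of x] by (simp add: g_def field_simps)
      also have "\<dots> = (b - d) * (a - c) - (c - d) * (m * (a - c)) * (sin x)\<^sup>2" by (simp add: D_def algebra_simps)
      also have "\<dots> = R x" unfolding ac Req cos_squared_eq by (simp add: algebra_simps)
      finally show ?thesis using Dpos[of x] assms by (simp add: field_simps)
    qed
    have "(a - g x) * (g x - b) * (g x - c) * (g x - d)
      = (a - b) / (a - c) * m * ((b - c) * sin x * cos x / (D x)\<^sup>2)\<^sup>2 * R x"
      unfolding 1 2 3 4 using Dpos[of x] assms by (simp add: field_simps power2_eq_square)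
    also have "\<dots> = (m * ((b - c) * sin x * cos x / (D x)\<^sup>2))\<^sup>2 * R x"
      unfolding m_def[symmetric] by (simp add: power2_eq_square algebra_simps)
    finally have "sqrt ((a - g x) * (g x - b) * (g x - c) * (g x - d))
      = m * ((b - c) * sin x * cos x / (D x)\<^sup>2) * sqrt (R x)"
      using m cs assms by (simp add: real_sqrt_mult)
    then show "1 / sqrt ((a - g x) * (g x - b) * (g x - c) * (g x - d)) * g' x = 2 / sqrt (R x)"
      using m cs assms Dpos[of x] Rpos[of x] by (simp add: g'_def)
  next
    fix x show "2 / sqrt (R x) \<ge> 0" using Rpos[of x] by simp
  qed auto
  moreover have "integral {0..pi/2} (\<lambda>x. 2 / sqrt (R x)) = 2 * ell_int (sqrt ((a - c) * (b - d))) (sqrt ((b - c) * (a - d)))"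
    unfolding ell_int_def R_def integral_mult_right[symmetric] by simp
  ultimately show ?thesis unfolding g0 by simp
qed

text \<open>Substitution x^2 = q^2 cos^2 \<phi> + p^2 sin^2 \<phi>. The extended nonnegative
  integral is used because this evaluates the inner integral left by Tonelli's theorem.\<close>

lemma ell_int_nn_integral:
  assumes q: "0 < q" and pq: "q < p"
  shows "(\<integral>\<^sup>+x. ennreal (1 / sqrt ((p\<^sup>2 - x\<^sup>2) * (x\<^sup>2 - q\<^sup>2))) * indicator {q..p} x \<partial>lborel) = ennreal (ell_int q p)"
proof -
  define R where "R x = q\<^sup>2 * (cos x)\<^sup>2 + p\<^sup>2 * (sin x)\<^sup>2" for x
  have Rpos: "R x > 0" for x unfolding R_def using q pq by (intro ell_int_radicand_pos) auto
  define g' where "g' x = (p\<^sup>2 - q\<^sup>2) * sin x * cos x / sqrt (R x)" for x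
  have g0: "sqrt (R 0) = q" "sqrt (R (pi/2)) = p" using q pq by (auto simp: R_def)
  have sq: "p\<^sup>2 - q\<^sup>2 > 0" using q pq by (simp add: power_strict_mono)
  have "(\<integral>\<^sup>+x. ennreal (1 / sqrt ((p\<^sup>2 - x\<^sup>2) * (x\<^sup>2 - q\<^sup>2))) * indicator {sqrt (R 0)..sqrt (R (pi/2))} x \<partial>lborel)
      = ennreal (integral {0..pi/2} (\<lambda>x. 1 / sqrt (R x)))"
  proof (rule nn_integral_substitution_real[where g' = g'])
    fix x assume "x \<in> {sqrt (R 0)..sqrt (R (pi/2))}"
    then show "1 / sqrt ((p\<^sup>2 - x\<^sup>2) * (x\<^sup>2 - q\<^sup>2)) \<ge> 0" unfolding g0 using q
      by (auto intro!: mult_nonneg_nonneg power_mono)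
  next
    fix x :: real
    show "((\<lambda>x. sqrt (R x)) has_real_derivative g' x) (at x)"
      unfolding R_def[abs_def] using Rpos[of x]
      by (auto intro!: derivative_eq_intros simp: R_def) (simp add: g'_def R_def field_simps power2_eq_square)
  next
    show "continuous_on {0..pi/2} g'"
      unfolding g'_def[abs_def] R_def using Rpos
      by (intro continuous_intros) (simp add: R_def less_le)
  next
    fix x assume "x \<in> {0..pi/2}"
    then show "g' x \<ge> 0" using sq Rpos[of x] cos_ge_zero[of x] sin_ge_zero[of x]
      by (simp add: g'_def)
  next
    show "continuous_on {0..pi/2} (\<lambda>x. 1 / sqrt (R x))"
      unfolding R_def by (rule continuous_on_ell_int) (use q pq in auto)
  next
    fix x assume x: "x \<in> {0<..<pi/2}"
    then have cs: "cos x > 0" "sin x > 0" by (auto intro: cos_gt_zero sin_gt_zero2)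
    have "p\<^sup>2 - (sqrt (R x))\<^sup>2 = (p\<^sup>2 - q\<^sup>2) * (cos x)\<^sup>2" "(sqrt (R x))\<^sup>2 - q\<^sup>2 = (p\<^sup>2 - q\<^sup>2) * (sin x)\<^sup>2"
      using Rpos[of x] unfolding R_def cos_squared_eq by (simp_all add: algebra_simps)
    then have "(p\<^sup>2 - (sqrt (R x))\<^sup>2) * ((sqrt (R x))\<^sup>2 - q\<^sup>2) = ((p\<^sup>2 - q\<^sup>2) * sin x * cos x)\<^sup>2"
      by (simp add: power2_eq_square)
    moreover have k: "(p\<^sup>2 - q\<^sup>2) * sin x * cos x > 0" using sq cs by simp
    ultimately have "sqrt ((p\<^sup>2 - (sqrt (R x))\<^sup>2) * ((sqrt (R x))\<^sup>2 - q\<^sup>2)) = (p\<^sup>2 - q\<^sup>2) * sin x * cos x"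
      by (simp only: real_sqrt_abs abs_of_pos)
    then show "1 / sqrt ((p\<^sup>2 - (sqrt (R x))\<^sup>2) * ((sqrt (R x))\<^sup>2 - q\<^sup>2)) * g' x = 1 / sqrt (R x)"
      using less_imp_neq[OF k] by (simp only: g'_def) simp
  next
    fix x show "1 / sqrt (R x) \<ge> 0" using Rpos[of x] by simp
  qed auto
  then show ?thesis unfolding g0 by (simp only: ell_int_def R_def)
qed

section \<open>Van Vleck polynomials as eigenvalue problems\<close>

text \<open>For \<alpha> = \<alpha>1 + \<alpha>2 + \<alpha>3 and x = k this is the leading
  coefficient of the image of z^k under the differential part of the equation with denominators
  cleared: k(k - 1) from the second derivative and \<alpha> k from the first.\<close>

definition vv_c :: "real \<Rightarrow> real \<Rightarrow> real" where
  "vv_c \<alpha> x = x * (x - 1 + \<alpha>)"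

text \<open>The linear coefficient, in powers of z - e2, of the quadratic polynomial that multiplies
  S' once denominators are cleared.\<close>

definition vv_lin :: "real \<Rightarrow> real \<Rightarrow> real \<Rightarrow> real \<Rightarrow> real \<Rightarrow> real \<Rightarrow> real" where
  "vv_lin e1 e2 e3 \<alpha>1 \<alpha>2 \<alpha>3 = \<alpha>1 * (e2 - e3) + \<alpha>2 * (2 * e2 - e1 - e3) - \<alpha>3 * (e1 - e2)"

definition vv_diag :: "real \<Rightarrow> real \<Rightarrow> real \<Rightarrow> real \<Rightarrow> real \<Rightarrow> real \<Rightarrow> nat \<Rightarrow> nat \<Rightarrow> real" where
  "vv_diag e1 e2 e3 \<alpha>1 \<alpha>2 \<alpha>3 n k =
     e2 + ((e1 + e3 - 2 * e2) * (k * (real k - 1)) - vv_lin e1 e2 e3 \<alpha>1 \<alpha>2 \<alpha>3 * k)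
          / vv_c (\<alpha>1 + \<alpha>2 + \<alpha>3) n"

text \<open>Product of the two entries linking rows k - 1 and k of the recurrence matrix. Only this
  product enters the characteristic polynomial, and its root is the off-diagonal entry after
  symmetrisation. The first factor vanishes at k = n + 1, which cuts off the finite block.\<close>

definition vv_off :: "real \<Rightarrow> real \<Rightarrow> real \<Rightarrow> real \<Rightarrow> real \<Rightarrow> real \<Rightarrow> nat \<Rightarrow> nat \<Rightarrow> real" where
  "vv_off e1 e2 e3 \<alpha>1 \<alpha>2 \<alpha>3 n k =
     (vv_c (\<alpha>1 + \<alpha>2 + \<alpha>3) n - vv_c (\<alpha>1 + \<alpha>2 + \<alpha>3) (real k - 1)) / vv_c (\<alpha>1 + \<alpha>2 + \<alpha>3) n
     * ((e1 - e2) * (e2 - e3) * (k * (real k - 1 + \<alpha>2)) / vv_c (\<alpha>1 + \<alpha>2 + \<alpha>3) n)"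

text \<open>Away from e1, e2, e3 the denominators may be cleared, and a polynomial vanishing on that
  infinite set is zero.\<close>

lemma lame_solution_iff_poly:
  fixes e1 e2 e3 \<alpha>1 \<alpha>2 \<alpha>3 :: real
  defines "f1 \<equiv> [:- complex_of_real e1, 1:]" and "f2 \<equiv> [:- complex_of_real e2, 1:]"
    and "f3 \<equiv> [:- complex_of_real e3, 1:]"
  shows "lame_solution e1 e2 e3 \<alpha>1 \<alpha>2 \<alpha>3 V S \<longleftrightarrow>
    f1 * f2 * f3 * pderiv (pderiv S)
    + (Polynomial.smult (of_real \<alpha>1) (f2 * f3) + Polynomial.smult (of_real \<alpha>2) (f1 * f3)
       + Polynomial.smult (of_real \<alpha>3) (f1 * f2)) * pderiv S + V * S = 0"
    (is "_ \<longleftrightarrow> ?X = 0")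
proof -
  have eq: "poly (pderiv (pderiv S)) z
        + (of_real \<alpha>1 / (z - of_real e1) + of_real \<alpha>2 / (z - of_real e2)
           + of_real \<alpha>3 / (z - of_real e3)) * poly (pderiv S) z
        + poly V z / ((z - of_real e1) * (z - of_real e2) * (z - of_real e3)) * poly S z = 0
     \<longleftrightarrow> poly ?X z = 0" if "z \<notin> {of_real e1, of_real e2, of_real e3}" for z
  proof -
    define u1 u2 u3 where u: "u1 = z - of_real e1" "u2 = z - of_real e2" "u3 = z - of_real e3"
    have nz: "u1 \<noteq> 0" "u2 \<noteq> 0" "u3 \<noteq> 0" using that u by auto
    have X: "poly ?X z = u1 * u2 * u3 * poly (pderiv (pderiv S)) z
        + (of_real \<alpha>1 * (u2 * u3) + of_real \<alpha>2 * (u1 * u3) + of_real \<alpha>3 * (u1 * u2)) * poly (pderiv S) z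
        + poly V z * poly S z"
    proof -
      have "poly f1 z = u1" "poly f2 z = u2" "poly f3 z = u3" by (simp_all add: u f1_def f2_def f3_def)
      then show ?thesis by (simp only: poly_add poly_mult poly_smult)
    qed
    have "poly (pderiv (pderiv S)) z
        + (of_real \<alpha>1 / u1 + of_real \<alpha>2 / u2 + of_real \<alpha>3 / u3) * poly (pderiv S) z
        + poly V z / (u1 * u2 * u3) * poly S z = poly ?X z / (u1 * u2 * u3)"
      unfolding X using nz by (simp add: field_simps)
    then show ?thesis using nz by (simp add: u[symmetric])
  qed
  show ?thesis
  proof
    assume "lame_solution e1 e2 e3 \<alpha>1 \<alpha>2 \<alpha>3 V S"
    then have "- {of_real e1, of_real e2, of_real e3} \<subseteq> {z. poly ?X z = 0}"
      unfolding lame_solution_def using eq by blast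
    moreover have "infinite (- {complex_of_real e1, of_real e2, of_real e3})"
      using finite_compl infinite_UNIV_char_0 by (metis finite.emptyI finite_insert)
    ultimately have "infinite {z. poly ?X z = 0}" using finite_subset by blast
    then show "?X = 0" using poly_roots_finite by blast
  next
    assume "?X = 0"
    then show "lame_solution e1 e2 e3 \<alpha>1 \<alpha>2 \<alpha>3 V S"
      unfolding lame_solution_def using eq by (metis poly_0)
  qed
qed

lemma pderiv_pcompose_shift: "pderiv (pcompose p [:c, 1:]) = pcompose (pderiv p) [:c, 1:]"
  by (simp add: pderiv_pcompose pderiv_pCons)

lemma coeff_lame_operator:
  fixes q1 q2 p0 p1 p2 v0 v1 :: complex
  shows "coeff ([:0, q1, q2, 1:] * pderiv (pderiv s) + [:p0, p1, p2:] * pderiv s + [:v0, v1:] * s) k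
    = (if k = 0 then 0 else ((of_nat k - 1) * (of_nat k - 2 + p2) + v1) * coeff s (k - 1))
      + (q2 * (of_nat k * (of_nat k - 1)) + p1 * of_nat k + v0) * coeff s k
      + (q1 * of_nat k + p0) * (of_nat k + 1) * coeff s (Suc k)"
proof -
  consider "k = 0" | "k = 1" | j where "k = Suc (Suc j)" by (metis One_nat_def not0_implies_Suc)
  then show ?thesis
    by cases (auto simp: coeff_pCons coeff_pderiv algebra_simps split: nat.split)
qed

text \<open>Expanding \<open>S\<close> in powers of \<open>z - e2\<close>, the middle singularity, makes the off-diagonal
  entries of the resulting tridiagonal matrix have positive products.\<close>
lemma lame_solution_iff_coeffs:
  fixes e1 e2 e3 \<alpha>1 \<alpha>2 \<alpha>3 t :: real and w :: complex and S :: "complex poly"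
  defines "s \<equiv> coeff (pcompose S [:of_real e2, 1:])"
  shows "lame_solution e1 e2 e3 \<alpha>1 \<alpha>2 \<alpha>3 [:- w * of_real t, w:] S \<longleftrightarrow>
    (\<forall>k. (if k = 0 then 0 else (of_real (vv_c (\<alpha>1 + \<alpha>2 + \<alpha>3) (real k - 1)) + w) * s (k - 1))
      + (of_real (vv_lin e1 e2 e3 \<alpha>1 \<alpha>2 \<alpha>3 * k - (e1 + e3 - 2 * e2) * (k * (real k - 1))) - w * of_real (t - e2)) * s k
      - of_real ((e1 - e2) * (e2 - e3) * (real (Suc k) * (real k + \<alpha>2))) * s (Suc k) = 0)"
proof -
  define f1 f2 f3 where f: "f1 = [:- complex_of_real e1, 1:]" "f2 = [:- complex_of_real e2, 1:]" "f3 = [:- complex_of_real e3, 1:]"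
  define V where "V = [:- w * of_real t, w:]"
  define X where "X = f1 * f2 * f3 * pderiv (pderiv S)
    + (Polynomial.smult (of_real \<alpha>1) (f2 * f3) + Polynomial.smult (of_real \<alpha>2) (f1 * f3)
       + Polynomial.smult (of_real \<alpha>3) (f1 * f2)) * pderiv S + V * S"
  define sh where "sh = [:complex_of_real e2, 1:]"
  define s' where "s' = pcompose S sh"
  \<comment> \<open>In u = z - e2 the cubic has no constant term, since e2 is one of its roots: the
    recurrence has three terms instead of four. Its coefficient of u is negative when e2 lies
    between the other two roots, which is the source of the positive products.\<close>
  have X1: "pcompose X sh = [:0, - of_real ((e1 - e2) * (e2 - e3)), - of_real (e1 + e3 - 2 * e2), 1:] * pderiv (pderiv s')
     + [:- of_real (\<alpha>2 * ((e1 - e2) * (e2 - e3))), of_real (vv_lin e1 e2 e3 \<alpha>1 \<alpha>2 \<alpha>3), of_real (\<alpha>1 + \<alpha>2 + \<alpha>3):] * pderiv s'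
     + [:- w * of_real (t - e2), w:] * s'"
  proof -
    have Q: "pcompose (f1 * f2 * f3) sh = [:0, - of_real ((e1 - e2) * (e2 - e3)), - of_real (e1 + e3 - 2 * e2), 1:]"
      unfolding f sh_def by (simp add: pcompose_mult pcompose_pCons algebra_simps)
    have P: "pcompose (Polynomial.smult (of_real \<alpha>1) (f2 * f3) + Polynomial.smult (of_real \<alpha>2) (f1 * f3)
       + Polynomial.smult (of_real \<alpha>3) (f1 * f2)) sh
      = [:- of_real (\<alpha>2 * ((e1 - e2) * (e2 - e3))), of_real (vv_lin e1 e2 e3 \<alpha>1 \<alpha>2 \<alpha>3), of_real (\<alpha>1 + \<alpha>2 + \<alpha>3):]"
      unfolding f sh_def by (simp add: pcompose_mult pcompose_add pcompose_smult pcompose_pCons vv_lin_def algebra_simps)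
    have V: "pcompose V sh = [:- w * of_real (t - e2), w:]"
      unfolding V_def sh_def by (simp add: pcompose_pCons algebra_simps)
    have d: "pderiv s' = pcompose (pderiv S) sh" "pderiv (pderiv s') = pcompose (pderiv (pderiv S)) sh"
      unfolding s'_def sh_def by (simp_all only: pderiv_pcompose_shift)
    show ?thesis unfolding X_def pcompose_add pcompose_mult[of _ "pderiv (pderiv S)"] pcompose_mult[of _ "pderiv S"] pcompose_mult[of V]
      using Q P V d by (simp only: s'_def pcompose_add)
  qed
  have "lame_solution e1 e2 e3 \<alpha>1 \<alpha>2 \<alpha>3 V S \<longleftrightarrow> X = 0"
    unfolding lame_solution_iff_poly X_def f ..
  also have "\<dots> \<longleftrightarrow> pcompose X sh = 0"
    using pcompose_eq_0[of X sh] by (auto simp: sh_def)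
  also have "\<dots> \<longleftrightarrow> (\<forall>k. coeff (pcompose X sh) k = 0)"
    by (simp add: poly_eq_iff)
  finally have 1: "lame_solution e1 e2 e3 \<alpha>1 \<alpha>2 \<alpha>3 V S \<longleftrightarrow> (\<forall>k. coeff (pcompose X sh) k = 0)" .
  have s: "s = coeff s'" by (simp add: s_def s'_def sh_def)
  show ?thesis
    unfolding V_def[symmetric] 1 X1 coeff_lame_operator s
    by (intro iff_allI arg_cong2[where f = "(=)"] refl) (auto simp: vv_c_def algebra_simps)
qed

section \<open>Roots of Van Vleck polynomials as zeros of a Jacobi polynomial of degree n +
  1\<close>

context
  fixes e1 e2 e3 \<alpha>1 \<alpha>2 \<alpha>3 :: real and n :: nat
  assumes e12: "e1 > e2" and e23: "e2 > e3"
    and \<alpha>: "\<alpha>1 > 0" "\<alpha>2 > 0" "\<alpha>3 > 0" and n: "n \<ge> 1"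
begin

lemma vv_c_pos: "vv_c (\<alpha>1 + \<alpha>2 + \<alpha>3) n > 0"
  unfolding vv_c_def using n \<alpha> by (intro mult_pos_pos) auto

lemma vv_c_strict_mono:
  assumes "1 \<le> k" "k \<le> n"
  shows "vv_c (\<alpha>1 + \<alpha>2 + \<alpha>3) (real k - 1) < vv_c (\<alpha>1 + \<alpha>2 + \<alpha>3) n"
proof -
  define x where "x = real k - 1"
  have x: "0 \<le> x" "x \<le> real n - 1" using assms by (auto simp: x_def)
  have "x * (x - 1 + (\<alpha>1 + \<alpha>2 + \<alpha>3)) \<le> x * (real n - 1 + (\<alpha>1 + \<alpha>2 + \<alpha>3))"
    using x by (intro mult_left_mono) auto
  also have "\<dots> < real n * (real n - 1 + (\<alpha>1 + \<alpha>2 + \<alpha>3))"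
    using x n \<alpha> by (intro mult_strict_right_mono) auto
  finally show ?thesis by (simp add: vv_c_def x_def)
qed

lemma vv_off_pos:
  assumes "1 \<le> k" "k \<le> n"
  shows "vv_off e1 e2 e3 \<alpha>1 \<alpha>2 \<alpha>3 n k > 0"
  unfolding vv_off_def using vv_c_pos vv_c_strict_mono[OF assms] assms e12 e23 \<alpha>
  by (intro mult_pos_pos divide_pos_pos) auto

lemma vv_off_Suc: "vv_off e1 e2 e3 \<alpha>1 \<alpha>2 \<alpha>3 n (Suc n) = 0"
  by (simp add: vv_off_def)

text \<open>After division by c the coefficients s k satisfy a recurrence with subdiagonal \<beta>
  and superdiagonal \<gamma>; multiplying s k by \<gamma> 1 ... \<gamma> k turns it into the monic
  recurrence with l = \<beta> \<gamma>. A solution of degree n exists precisely when the term of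
  index n + 1 vanishes.\<close>

lemma van_vleck_roots_eq:
  "{t::real. \<exists>V \<in> van_vleck e1 e2 e3 \<alpha>1 \<alpha>2 \<alpha>3 n. poly V (of_real t) = 0}
   = {t. poly (jac_poly (vv_diag e1 e2 e3 \<alpha>1 \<alpha>2 \<alpha>3 n) (vv_off e1 e2 e3 \<alpha>1 \<alpha>2 \<alpha>3 n) (Suc n)) t = 0}"
proof -
  define c where "c = vv_c (\<alpha>1 + \<alpha>2 + \<alpha>3) n"
  define b where "b = vv_diag e1 e2 e3 \<alpha>1 \<alpha>2 \<alpha>3 n"
  define l where "l = vv_off e1 e2 e3 \<alpha>1 \<alpha>2 \<alpha>3 n"
  define \<beta> where "\<beta> k = (c - vv_c (\<alpha>1 + \<alpha>2 + \<alpha>3) (real k - 1)) / c" for k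
  define \<gamma> where "\<gamma> k = (e1 - e2) * (e2 - e3) * (k * (real k - 1 + \<alpha>2)) / c" for k :: nat
  define G where "G k = (\<Prod>j=1..k. \<gamma> j)" for k
  have c: "c > 0" using vv_c_pos by (simp add: c_def)
  have l: "l k = \<beta> k * \<gamma> k" for k by (simp add: l_def vv_off_def \<beta>_def \<gamma>_def c_def)
  have lpos: "l k > 0" if "1 \<le> k" "k \<le> n" for k using vv_off_pos[OF that] by (simp add: l_def)
  have \<gamma>pos: "\<gamma> k > 0" if "1 \<le> k" for k
    unfolding \<gamma>_def using c e12 e23 \<alpha> that by (intro mult_pos_pos divide_pos_pos) auto
  have Gpos: "G k > 0" for k unfolding G_def using \<gamma>pos by (intro prod_pos) auto
  have GS: "G (Suc k) = G k * \<gamma> (Suc k)" for k by (simp add: G_def)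
  have rec: "lame_solution e1 e2 e3 \<alpha>1 \<alpha>2 \<alpha>3 [:- (- of_real c) * of_real t, - of_real c:] S \<longleftrightarrow>
     (\<forall>k. of_real (\<gamma> (Suc k)) * s (Suc k) = of_real (t - b k) * s k - (if k = 0 then 0 else of_real (\<beta> k) * s (k - 1)))"
    if "s = coeff (pcompose S [:of_real e2, 1:])" for S t s
  proof -
    have "(if k = 0 then 0 else (of_real (vv_c (\<alpha>1 + \<alpha>2 + \<alpha>3) (real k - 1)) + - of_real c) * s (k - 1))
      + (of_real (vv_lin e1 e2 e3 \<alpha>1 \<alpha>2 \<alpha>3 * k - (e1 + e3 - 2 * e2) * (k * (real k - 1))) - - of_real c * of_real (t - e2)) * s k
      - of_real ((e1 - e2) * (e2 - e3) * (real (Suc k) * (real k + \<alpha>2))) * s (Suc k)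
      = of_real c * (of_real (t - b k) * s k - (if k = 0 then 0 else of_real (\<beta> k) * s (k - 1)) - of_real (\<gamma> (Suc k)) * s (Suc k))" for k
    proof -
      have bk: "b k = e2 + ((e1 + e3 - 2 * e2) * (k * (real k - 1)) - vv_lin e1 e2 e3 \<alpha>1 \<alpha>2 \<alpha>3 * k) / c"
        by (simp only: b_def vv_diag_def c_def)
      have cb: "c * (b k - e2) = (e1 + e3 - 2 * e2) * (k * (real k - 1)) - vv_lin e1 e2 e3 \<alpha>1 \<alpha>2 \<alpha>3 * k"
        using c by (simp add: bk)
      have r: "vv_c (\<alpha>1 + \<alpha>2 + \<alpha>3) (real k - 1) - c = - (c * \<beta> k)"
        using c by (simp add: \<beta>_def)
      have r2: "vv_lin e1 e2 e3 \<alpha>1 \<alpha>2 \<alpha>3 * k - (e1 + e3 - 2 * e2) * (k * (real k - 1)) = c * (t - b k) - c * (t - e2)"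
        using cb by (simp only: right_diff_distrib)
      have r3: "(e1 - e2) * (e2 - e3) * (real (Suc k) * (real k + \<alpha>2)) = c * \<gamma> (Suc k)"
        using c by (simp add: \<gamma>_def)
      have r1: "of_real (vv_c (\<alpha>1 + \<alpha>2 + \<alpha>3) (real k - 1)) + - of_real c = - (of_real c * complex_of_real (\<beta> k))"
        by (simp only: r of_real_minus of_real_mult flip: of_real_add diff_conv_add_uminus of_real_diff)
      show ?thesis unfolding r1 r2 r3 by (simp add: algebra_simps)
    qed
    then show ?thesis
      unfolding lame_solution_iff_coeffs that[symmetric] using c by (simp add: eq_commute[of _ "of_real (\<gamma> (Suc _)) * _"])
  qed
  show ?thesis
    unfolding b_def[symmetric] l_def[symmetric]
  proof (intro subset_antisym subsetI; clarsimp simp only: mem_Collect_eq)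
    fix t V assume V: "V \<in> van_vleck e1 e2 e3 \<alpha>1 \<alpha>2 \<alpha>3 n" and t: "poly V (complex_of_real t) = 0"
    then obtain S where S: "degree S = n" "lame_solution e1 e2 e3 \<alpha>1 \<alpha>2 \<alpha>3 V S" and dV: "degree V = 1"
      by (auto simp: van_vleck_def)
    define w where "w = coeff V 1"
    have V0: "V = [:coeff V 0, w:]"
      using dV by (intro poly_eqI) (auto simp: w_def coeff_pCons coeff_eq_0 split: nat.split)
    have "poly V (of_real t) = coeff V 0 + of_real t * w" by (subst V0) simp
    then have "coeff V 0 = - w * of_real t" using t by (simp add: add_eq_0_iff2 mult.commute)
    then have Vw: "V = [:- w * of_real t, w:]" using V0 by simp
    define s where "s = coeff (pcompose S [:of_real e2, 1:])"
    have deg: "degree (pcompose S [:complex_of_real e2, 1:]) = n" using S by (simp add: degree_pcompose)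
    have sn: "s n \<noteq> 0" "\<And>k. k > n \<Longrightarrow> s k = 0"
    proof -
      have "pcompose S [:complex_of_real e2, 1:] \<noteq> 0" using deg n by auto
      then show "s n \<noteq> 0" unfolding s_def using deg leading_coeff_0_iff by metis
      show "\<And>k. k > n \<Longrightarrow> s k = 0" unfolding s_def using deg by (simp add: coeff_eq_0)
    qed
    \<comment> \<open>In the equation of index n + 1 only the term with s n survives; this fixes the
      leading coefficient of V.\<close>
    have "(of_real (vv_c (\<alpha>1 + \<alpha>2 + \<alpha>3) (real (Suc n) - 1)) + w) * s n = 0"
      using S(2)[unfolded Vw lame_solution_iff_coeffs s_def[symmetric], rule_format, of "Suc n"]
        sn(2)[of "Suc n"] sn(2)[of "Suc (Suc n)"] by simp
    then have w: "w = - of_real c" using sn(1) by (simp add: c_def add_eq_0_iff)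
    have r: "of_real (\<gamma> (Suc k)) * s (Suc k) = of_real (t - b k) * s k - (if k = 0 then 0 else of_real (\<beta> k) * s (k - 1))" for k
      using S(2) rec[OF s_def, of t] unfolding Vw w by blast
    have main: "of_real (G k) * s k = s 0 * of_real (poly (jac_poly b l k) t)" for k
    proof (induction k rule: less_induct)
      case (less k)
      show ?case
      proof (cases k)
        case 0
        then show ?thesis by (simp add: G_def)
      next
        case (Suc j)
        have "of_real (G k) * s k = of_real (G j) * (of_real (\<gamma> (Suc j)) * s (Suc j))"
          by (simp add: Suc GS)
        also have "\<dots> = of_real (t - b j) * (of_real (G j) * s j) - (if j = 0 then 0 else of_real (l j) * (of_real (G (j - 1)) * s (j - 1)))"
          unfolding r using GS[of "j - 1"] by (auto simp: l algebra_simps)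
        also have "\<dots> = s 0 * of_real (poly (jac_poly b l k) t)"
          unfolding Suc jac_poly_rec[of b l j] using less.IH[of j] less.IH[of "j - 1"] Suc by (auto simp: algebra_simps)
        finally show ?thesis .
      qed
    qed
    \<comment> \<open>Otherwise every coefficient, in particular s n, would be zero.\<close>
    have "s 0 \<noteq> 0" using main[of n] sn(1) Gpos[of n] by auto
    then show "poly (jac_poly b l (Suc n)) t = 0" using main[of "Suc n"] sn(2)[of "Suc n"] by simp
  next
    fix t assume t: "poly (jac_poly b l (Suc n)) t = 0"
    define s where "s k = (if k \<le> n then complex_of_real (poly (jac_poly b l k) t / G k) else 0)" for k
    define P where "P = Polynomial.Poly (map s [0..<Suc n])"
    have cP: "coeff P = s"
      by (auto simp: P_def fun_eq_iff coeff_Poly_eq nth_default_def s_def simp del: upt_Suc)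
    define S where "S = pcompose P [:- complex_of_real e2, 1:]"
    have "pcompose S [:of_real e2, 1:] = P"
      unfolding S_def pcompose_assoc[symmetric] by (simp add: pcompose_pCons)
    then have cS: "s = coeff (pcompose S [:of_real e2, 1:])" by (simp add: cP)
    \<comment> \<open>Positivity of the Wronskian at a zero of the polynomial of degree n + 1
      ensures that the constructed S has degree n and no less.\<close>
    have "poly (jac_poly b l n) t \<noteq> 0"
      using jac_poly_wronskian_pos[of n l b t] lpos t by auto
    then have "s n \<noteq> 0" using Gpos[of n] by (simp add: s_def)
    then have "degree P = n" using cP s_def by (intro antisym degree_le le_degree) auto
    then have dS: "degree S = n" by (simp add: S_def degree_pcompose)
    have "of_real (\<gamma> (Suc k)) * s (Suc k) = of_real (t - b k) * s k - (if k = 0 then 0 else of_real (\<beta> k) * s (k - 1))" for k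
    proof -
      \<comment> \<open>Rows up to n are the Jacobi recurrence, with the vanishing at t of the
        polynomial of degree n + 1 used in row n; row n + 1 holds because \<beta> (n + 1) = 0;
        beyond it all terms are zero.\<close>
      consider "k \<le> n" | "k = Suc n" | "k > Suc n" by linarith
      then show ?thesis
      proof cases
        case 1
        have "of_real (\<gamma> (Suc k)) * s (Suc k) = complex_of_real (poly (jac_poly b l (Suc k)) t / G k)"
          using 1 t GS[of k] \<gamma>pos[of "Suc k"] by (cases "k = n") (auto simp: s_def)
        also have "poly (jac_poly b l (Suc k)) t / G k
           = (t - b k) * (poly (jac_poly b l k) t / G k) - (if k = 0 then 0 else \<beta> k * (poly (jac_poly b l (k - 1)) t / G (k - 1)))"
          unfolding jac_poly_rec[of b l k] using Gpos[of k] Gpos[of "k - 1"] GS[of "k - 1"] \<gamma>pos[of k]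
          by (cases "k = 0") (auto simp: l field_simps)
        finally show ?thesis using 1 by (auto simp: s_def)
      next
        case 2
        have "\<beta> k = 0" using 2 by (simp add: \<beta>_def c_def)
        then show ?thesis using 2 by (simp add: s_def)
      qed (auto simp: s_def)
    qed
    then have "lame_solution e1 e2 e3 \<alpha>1 \<alpha>2 \<alpha>3 [:- (- of_real c) * of_real t, - of_real c:] S"
      using rec[OF cS] by blast
    then have "[:- (- of_real c) * of_real t, - of_real c:] \<in> van_vleck e1 e2 e3 \<alpha>1 \<alpha>2 \<alpha>3 n"
      unfolding van_vleck_def using dS c by auto
    then show "\<exists>V\<in>van_vleck e1 e2 e3 \<alpha>1 \<alpha>2 \<alpha>3 n. poly V (complex_of_real t) = 0"
      by (rule bexI[rotated]) simp
  qed
qed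

end

section \<open>Trace asymptotics\<close>

definition unif01 :: "real measure" where "unif01 = uniform_measure lborel {0..1}"
text \<open>The cosine is even, so its law on [-pi, 0] is that on the full circle; on this half it
  is increasing, as the change of variables in \<open>nn_integral_arcsine\<close> requires.\<close>

definition unifpi :: "real measure" where "unifpi = uniform_measure lborel {- pi..0}"

lemma sets_unif [simp, measurable_cong]: "sets unif01 = sets borel" "sets unifpi = sets borel"
  and space_unif [simp]: "space unif01 = UNIV" "space unifpi = UNIV"
  by (simp_all add: unif01_def unifpi_def uniform_measure_def)

lemma prob_space_unif: "prob_space unif01" "prob_space unifpi"
  unfolding unif01_def unifpi_def by (auto intro!: prob_space_uniform_measure)

lemma AE_unif01: "AE x in unif01. 0 < x \<and> x < 1"
proof -
  have "AE x in unif01. x \<in> {0..1::real}"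
    unfolding unif01_def by (rule AE_uniform_measureI) auto
  moreover have "AE x in unif01. x \<noteq> c" for c :: real
    unfolding unif01_def by (rule AE_uniform_measureI) (use AE_lborel_singleton[of c] in auto)
  from this[of 0] this[of 1] calculation show ?thesis
    by eventually_elim auto
qed

lemma measure_unif01:
  assumes "0 \<le> u" "u \<le> v" "v \<le> 1"
  shows "measure unif01 {u..<v} = v - u"
proof -
  have "{0..1} \<inter> {u..<v} = {u..<v}" using assms by auto
  then show ?thesis unfolding unif01_def using assms
    by (subst measure_uniform_measure) auto
qed

lemma integral_cos_unifpi: "(\<integral>\<theta>. cos (of_int i * \<theta>) \<partial>unifpi) = (if i = 0 then 1 else 0)"
proof (cases "i = 0")
  case True
  interpret prob_space unifpi by (rule prob_space_unif)
  show ?thesis using True prob_space by simp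
next
  case False
  have "unifpi = density lborel (\<lambda>x. ennreal (indicator {- pi..0} x / pi))"
    unfolding unifpi_def uniform_measure_def
    using divide_ennreal[of 1 pi] by (intro density_cong) (auto simp: indicator_def)
  then have "(\<integral>\<theta>. cos (of_int i * \<theta>) \<partial>unifpi) = (\<integral>\<theta>. indicator {- pi..0} \<theta> / pi * cos (of_int i * \<theta>) \<partial>lborel)"
    by (subst (1) \<open>unifpi = _\<close>, subst integral_real_density) auto
  also have "\<dots> = (\<integral>\<theta>. (cos (of_int i * \<theta>) / pi) * indicator {- pi..0} \<theta> \<partial>lborel)"
    by (simp add: mult_ac)
  also have "\<dots> = sin (of_int i * 0) / (of_int i * pi) - sin (of_int i * - pi) / (of_int i * pi)"
    using False
    by (intro integral_FTC_Icc_real) (auto intro!: derivative_eq_intros continuous_intros)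
  also have "\<dots> = 0"
  proof -
    have "sin (of_int i * pi) = 0" by (metis sin_integer_2pi sin_npi_int mult.commute)
    then show ?thesis by simp
  qed
  finally show ?thesis using False by simp
qed

text \<open>The entries of the powers of the bi-infinite tridiagonal Toeplitz matrix with
  diagonal \<open>b\<close> and off-diagonals \<open>a\<close>.\<close>
definition toeplitz_pow :: "real \<Rightarrow> real \<Rightarrow> nat \<Rightarrow> int \<Rightarrow> real" where
  "toeplitz_pow b a m i = (\<integral>\<theta>. (b + 2 * a * cos \<theta>) ^ m * cos (of_int i * \<theta>) \<partial>unifpi)"

lemma toeplitz_pow_0: "toeplitz_pow b a 0 i = (if i = 0 then 1 else 0)"
  by (simp add: toeplitz_pow_def integral_cos_unifpi)

lemma abs_affine_cos_le: "\<bar>b + 2 * a * cos \<theta>\<bar> \<le> \<bar>b\<bar> + 2 * \<bar>a\<bar>" for a b \<theta> :: real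
proof -
  have "\<bar>2 * a * cos \<theta>\<bar> \<le> 2 * \<bar>a\<bar>"
    by (simp add: abs_mult mult_left_le)
  then show ?thesis by linarith
qed

text \<open>By 2 cos \<theta> cos (i \<theta>) = cos ((i + 1) \<theta>) + cos ((i - 1) \<theta>)
  these integrals obey the recursion of \<open>jac_pow\<close> with constant entries and without a
  boundary.\<close>

lemma toeplitz_pow_Suc:
  "toeplitz_pow b a (Suc m) i
   = b * toeplitz_pow b a m i + a * toeplitz_pow b a m (i + 1) + a * toeplitz_pow b a m (i - 1)"
proof -
  interpret prob_space unifpi by (rule prob_space_unif)
  have int: "integrable unifpi (\<lambda>\<theta>. (b + 2 * a * cos \<theta>) ^ m * cos (of_int i * \<theta>))" for i
  proof (rule integrable_const_bound[where B = "(\<bar>b\<bar> + 2 * \<bar>a\<bar>) ^ m"])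
    show "AE x in unifpi. norm ((b + 2 * a * cos x) ^ m * cos (real_of_int i * x)) \<le> (\<bar>b\<bar> + 2 * \<bar>a\<bar>) ^ m"
    proof (rule AE_I2)
      fix x
      have "norm ((b + 2 * a * cos x) ^ m * cos (real_of_int i * x)) \<le> (\<bar>b\<bar> + 2 * \<bar>a\<bar>) ^ m * 1"
        unfolding real_norm_def abs_mult power_abs
        by (intro mult_mono power_mono abs_affine_cos_le) auto
      then show "norm ((b + 2 * a * cos x) ^ m * cos (real_of_int i * x)) \<le> (\<bar>b\<bar> + 2 * \<bar>a\<bar>) ^ m" by simp
    qed
  qed simp
  have c: "2 * cos \<theta> * cos (of_int i * \<theta>) = cos (of_int (i + 1) * \<theta>) + cos (of_int (i - 1) * \<theta>)" for \<theta> :: real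
    by (simp add: ring_distribs cos_add cos_diff)
  have "(b + 2 * a * cos \<theta>) ^ Suc m * cos (of_int i * \<theta>)
     = b * ((b + 2 * a * cos \<theta>) ^ m * cos (of_int i * \<theta>))
       + a * ((b + 2 * a * cos \<theta>) ^ m * cos (of_int (i + 1) * \<theta>))
       + a * ((b + 2 * a * cos \<theta>) ^ m * cos (of_int (i - 1) * \<theta>))" for \<theta>
  proof -
    have "(b + 2 * a * cos \<theta>) ^ Suc m * cos (of_int i * \<theta>)
      = b * ((b + 2 * a * cos \<theta>) ^ m * cos (of_int i * \<theta>))
       + a * ((b + 2 * a * cos \<theta>) ^ m * (2 * cos \<theta> * cos (of_int i * \<theta>)))"
      by (simp add: algebra_simps)
    then show ?thesis unfolding c by (simp only: distrib_left add.assoc)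
  qed
  then show ?thesis unfolding toeplitz_pow_def using int
    by (simp only: Bochner_Integration.integral_add Bochner_Integration.integrable_add
          integral_mult_right_zero integrable_mult_right)
qed

lemma continuous_toeplitz_pow:
  assumes "continuous_on S b" "continuous_on S a"
  shows "continuous_on S (\<lambda>x. toeplitz_pow (b x) (a x) m i)"
proof (induction m arbitrary: i)
  case 0
  then show ?case by (simp add: toeplitz_pow_0)
next
  case (Suc m)
  then show ?case unfolding toeplitz_pow_Suc by (intro continuous_intros assms)
qed

text \<open>The m-th power involves only rows within distance m of the starting row, so the entries
  there may be replaced by their limits, and the boundary at row 0 disappears as K n grows. All
  fixed offsets i are treated at once because \<open>jac_pow\<close> recurses on its row
  index.\<close>

lemma jac_pow_tendsto:
  assumes K: "filterlim K at_top sequentially"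
    and b: "\<And>i::int. (\<lambda>n. b n (nat (int (K n) + i))) \<longlonglongrightarrow> B"
    and l: "\<And>i::int. (\<lambda>n. sqrt (l n (nat (int (K n) + i)))) \<longlonglongrightarrow> A"
  shows "(\<lambda>n. jac_pow (b n) (l n) m (nat (int (K n) + i)) (K n)) \<longlonglongrightarrow> toeplitz_pow B A m i"
proof (induction m arbitrary: i)
  case 0
  have "eventually (\<lambda>n. K n \<ge> Suc (nat \<bar>i\<bar>)) sequentially"
    using K unfolding filterlim_at_top by blast
  then have "eventually (\<lambda>n. jac_pow (b n) (l n) 0 (nat (int (K n) + i)) (K n) = toeplitz_pow B A 0 i) sequentially"
    by eventually_elim (auto simp: toeplitz_pow_0)
  then show ?case by (rule tendsto_eventually)
next
  case (Suc m)
  let ?J = "\<lambda>n i. jac_pow (b n) (l n) m (nat (int (K n) + i)) (K n)"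
  let ?k = "\<lambda>n i. nat (int (K n) + i)"
  have "eventually (\<lambda>n. K n \<ge> Suc (nat \<bar>i\<bar>)) sequentially"
    using K unfolding filterlim_at_top by blast
  then have "eventually (\<lambda>n. b n (?k n i) * ?J n i + sqrt (l n (?k n (i + 1))) * ?J n (i + 1)
      + sqrt (l n (?k n i)) * ?J n (i - 1) = jac_pow (b n) (l n) (Suc m) (?k n i) (K n)) sequentially"
  proof eventually_elim
    case (elim n)
    have e: "?k n (i + 1) = Suc (?k n i)" "?k n (i - 1) = ?k n i - 1" "(?k n i = 0) = False"
      using elim by auto
    show ?case by (simp only: jac_pow.simps e if_False)
  qed
  moreover have "(\<lambda>n. b n (?k n i) * ?J n i + sqrt (l n (?k n (i + 1))) * ?J n (i + 1)
      + sqrt (l n (?k n i)) * ?J n (i - 1)) \<longlonglongrightarrow> toeplitz_pow B A (Suc m) i"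
    unfolding toeplitz_pow_Suc by (intro tendsto_intros b l Suc)
  ultimately show ?case by (rule Lim_transform_eventually[rotated])
qed

text \<open>The limits of the diagonal and off-diagonal entries in row \<open>k\<close> as \<open>k / n\<close> tends to \<open>x\<close>.\<close>
definition vv_B :: "real \<Rightarrow> real \<Rightarrow> real \<Rightarrow> real \<Rightarrow> real" where
  "vv_B e1 e2 e3 x = e2 + (e1 + e3 - 2 * e2) * x\<^sup>2"

definition vv_A :: "real \<Rightarrow> real \<Rightarrow> real \<Rightarrow> real \<Rightarrow> real" where
  "vv_A e1 e2 e3 x = sqrt ((e1 - e2) * (e2 - e3) * x\<^sup>2 * (1 - x\<^sup>2))"

text \<open>The shifts u, v and \<alpha> - 1 are of lower order than n. This is where \<alpha>1,
  \<alpha>2, \<alpha>3 leave the limit.\<close>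

lemma vv_c_quotient_tendsto:
  assumes \<alpha>: "\<alpha> > 0" and k: "(\<lambda>n. real (k n) / real n) \<longlonglongrightarrow> x"
  shows "(\<lambda>n. (real (k n) + u) * (real (k n) + v) / vv_c \<alpha> (real n)) \<longlonglongrightarrow> x\<^sup>2"
proof -
  have z: "(\<lambda>n. c / real n) \<longlonglongrightarrow> 0" for c by (rule lim_const_over_n)
  have "(\<lambda>n. (real (k n) / real n + u / real n) * (real (k n) / real n + v / real n) / (1 + (\<alpha> - 1) / real n))
     \<longlonglongrightarrow> (x + 0) * (x + 0) / (1 + 0)"
    by (intro tendsto_intros k z) simp
  moreover have "eventually (\<lambda>n. (real (k n) / real n + u / real n) * (real (k n) / real n + v / real n) / (1 + (\<alpha> - 1) / real n)
     = (real (k n) + u) * (real (k n) + v) / vv_c \<alpha> (real n)) sequentially"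
    using eventually_ge_at_top[of 1]
  proof eventually_elim
    case (elim n)
    have "1 + (\<alpha> - 1) / real n = vv_c \<alpha> n / (real n * real n)"
      using elim by (simp add: vv_c_def field_simps)
    then show ?case using elim by (simp add: add_divide_distrib[symmetric])
  qed
  ultimately show ?thesis by (simp add: power2_eq_square Lim_transform_eventually)
qed

lemma vv_diag_tendsto:
  assumes \<alpha>: "\<alpha>1 + \<alpha>2 + \<alpha>3 > 0" and k: "(\<lambda>n. real (k n) / real n) \<longlonglongrightarrow> x"
  shows "(\<lambda>n. vv_diag e1 e2 e3 \<alpha>1 \<alpha>2 \<alpha>3 n (k n)) \<longlonglongrightarrow> vv_B e1 e2 e3 x"
proof -
  let ?q = "\<lambda>u n. (real (k n) + u) * (real (k n) + 0) / vv_c (\<alpha>1 + \<alpha>2 + \<alpha>3) (real n)"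
  let ?l = "vv_lin e1 e2 e3 \<alpha>1 \<alpha>2 \<alpha>3"
  \<comment> \<open>The linear term k / c is written as ((k + 1) k - k k) / c, a difference of two
    quotients with the same limit.\<close>
  have "(\<lambda>n. e2 + ((e1 + e3 - 2 * e2) * ?q (-1) n - ?l * (?q 1 n - ?q 0 n)))
      \<longlonglongrightarrow> e2 + ((e1 + e3 - 2 * e2) * x\<^sup>2 - ?l * (x\<^sup>2 - x\<^sup>2))"
    by (intro tendsto_intros vv_c_quotient_tendsto[OF \<alpha> k])
  then show ?thesis
    unfolding vv_B_def vv_diag_def
    by (simp add: diff_divide_distrib[symmetric] algebra_simps)
qed

lemma vv_off_tendsto:
  assumes \<alpha>: "\<alpha>1 + \<alpha>2 + \<alpha>3 > 0" and k: "(\<lambda>n. real (k n) / real n) \<longlonglongrightarrow> x"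
  shows "(\<lambda>n. sqrt (vv_off e1 e2 e3 \<alpha>1 \<alpha>2 \<alpha>3 n (k n))) \<longlonglongrightarrow> vv_A e1 e2 e3 x"
proof -
  let ?q = "\<lambda>u v n. (real (k n) + u) * (real (k n) + v) / vv_c (\<alpha>1 + \<alpha>2 + \<alpha>3) (real n)"
  have "(\<lambda>n. sqrt ((1 - ?q (-1) (\<alpha>1 + \<alpha>2 + \<alpha>3 - 2) n) * ((e1 - e2) * (e2 - e3) * ?q 0 (\<alpha>2 - 1) n)))
      \<longlonglongrightarrow> sqrt ((1 - x\<^sup>2) * ((e1 - e2) * (e2 - e3) * x\<^sup>2))"
    by (intro tendsto_intros vv_c_quotient_tendsto[OF \<alpha> k])
  then have lim: "(\<lambda>n. sqrt ((1 - ?q (-1) (\<alpha>1 + \<alpha>2 + \<alpha>3 - 2) n) * ((e1 - e2) * (e2 - e3) * ?q 0 (\<alpha>2 - 1) n)))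
      \<longlonglongrightarrow> vv_A e1 e2 e3 x"
    by (simp add: vv_A_def mult_ac)
  have "eventually (\<lambda>n. sqrt ((1 - ?q (-1) (\<alpha>1 + \<alpha>2 + \<alpha>3 - 2) n) * ((e1 - e2) * (e2 - e3) * ?q 0 (\<alpha>2 - 1) n))
      = sqrt (vv_off e1 e2 e3 \<alpha>1 \<alpha>2 \<alpha>3 n (k n))) sequentially"
    using eventually_ge_at_top[of 1]
  proof eventually_elim
    case (elim n)
    define c where "c = vv_c (\<alpha>1 + \<alpha>2 + \<alpha>3) (real n)"
    have "c > 0" unfolding c_def vv_c_def using elim \<alpha> by (intro mult_pos_pos) auto
    have 1: "(real (k n) + (-1)) * (real (k n) + (\<alpha>1 + \<alpha>2 + \<alpha>3 - 2)) = vv_c (\<alpha>1 + \<alpha>2 + \<alpha>3) (real (k n) - 1)"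
      by (simp add: vv_c_def algebra_simps)
    have 2: "(real (k n) + 0) * (real (k n) + (\<alpha>2 - 1)) = real (k n) * (real (k n) - 1 + \<alpha>2)"
      by (simp add: algebra_simps)
    have 3: "1 - d / c = (c - d) / c" for d using \<open>c > 0\<close> by (simp add: diff_divide_distrib)
    show ?case
      unfolding vv_off_def c_def[symmetric] 1 2 3 by (simp only: times_divide_eq_right)
  qed
  then show ?thesis by (rule Lim_transform_eventually[OF lim])
qed

lemma scaled_floor_tendsto:
  assumes x: "0 < x"
  defines "K \<equiv> \<lambda>n. nat \<lfloor>real (Suc n) * x\<rfloor>"
  shows "filterlim K at_top sequentially"
    and "(\<lambda>n. real (nat (int (K n) + i)) / real n) \<longlonglongrightarrow> x"
proof -
  have lb: "real (K n) \<le> real (Suc n) * x" "real (K n) \<ge> real (Suc n) * x - 1" for n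
    using x unfolding K_def by (simp_all add: of_nat_nat)
  have "filterlim (\<lambda>n. real (Suc n) * x - 1) at_top sequentially"
    using x by real_asymp
  then have "filterlim (\<lambda>n. real (K n)) at_top sequentially"
    by (rule filterlim_at_top_mono) (use lb in auto)
  then show K: "filterlim K at_top sequentially"
    by (simp add: filterlim_sequentially_iff_filterlim_real)
  have "eventually (\<lambda>n. K n \<ge> nat \<bar>i\<bar>) sequentially"
    using K by (simp add: filterlim_at_top)
  then have ev: "eventually (\<lambda>n. real (nat (int (K n) + i)) = real (K n) + of_int i) sequentially"
    by eventually_elim auto
  show "(\<lambda>n. real (nat (int (K n) + i)) / real n) \<longlonglongrightarrow> x"
  proof (rule tendsto_sandwich)
    show "eventually (\<lambda>n. (real (Suc n) * x - 1 + of_int i) / real n \<le> real (nat (int (K n) + i)) / real n) sequentially"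
      using ev by eventually_elim (use lb in \<open>auto intro!: divide_right_mono\<close>)
    show "eventually (\<lambda>n. real (nat (int (K n) + i)) / real n \<le> (real (Suc n) * x + of_int i) / real n) sequentially"
      using ev by eventually_elim (use lb in \<open>auto intro!: divide_right_mono\<close>)
    show "(\<lambda>n. (real (Suc n) * x - 1 + of_int i) / real n) \<longlonglongrightarrow> x" by real_asymp
    show "(\<lambda>n. (real (Suc n) * x + of_int i) / real n) \<longlonglongrightarrow> x" by real_asymp
  qed
qed

text \<open>The average is the integral of a step function with n + 1 equal steps. With all n living
  on one probability space, dominated convergence can be applied to the averages.\<close>

lemma average_eq_integral:
  fixes f :: "nat \<Rightarrow> real"
  shows "(\<Sum>k\<le>n. f k) / real (Suc n) = (\<integral>x. f (nat \<lfloor>real (Suc n) * x\<rfloor>) \<partial>unif01)"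
proof -
  interpret prob_space unif01 by (rule prob_space_unif)
  let ?I = "\<lambda>k. {real k / real (Suc n)..<real (Suc k) / real (Suc n)}"
  have "(\<integral>x. f (nat \<lfloor>real (Suc n) * x\<rfloor>) \<partial>unif01) = (\<integral>x. (\<Sum>k\<le>n. f k * indicator (?I k) x) \<partial>unif01)"
  proof (rule integral_cong_AE)
    show "AE x in unif01. f (nat \<lfloor>real (Suc n) * x\<rfloor>) = (\<Sum>k\<le>n. f k * indicator (?I k) x)"
      using AE_unif01
    proof eventually_elim
      case (elim x)
      define j where "j = nat \<lfloor>real (Suc n) * x\<rfloor>"
      have fl: "\<lfloor>real (Suc n) * x\<rfloor> \<ge> 0" using elim by simp
      have "real (Suc n) * x < real (Suc n)" using elim by simp
      then have "j \<le> n" unfolding j_def using fl by linarith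
      have "x \<in> ?I k \<longleftrightarrow> k = j" for k
      proof -
        have "x \<in> ?I k \<longleftrightarrow> real k \<le> real (Suc n) * x \<and> real (Suc n) * x < real k + 1"
          by (simp add: field_simps)
        also have "\<dots> \<longleftrightarrow> \<lfloor>real (Suc n) * x\<rfloor> = int k" by linarith
        also have "\<dots> \<longleftrightarrow> k = j" unfolding j_def using fl by auto
        finally show ?thesis .
      qed
      then have "(\<Sum>k\<le>n. f k * indicator (?I k) x) = (\<Sum>k\<le>n. f k * (if k = j then 1 else 0))"
        by (intro sum.cong) (auto simp: indicator_def)
      also have "\<dots> = f j" using \<open>j \<le> n\<close> by (simp add: if_distrib cong: if_cong)
      finally show ?case unfolding j_def ..
    qed
  qed measurable
  also have "\<dots> = (\<Sum>k\<le>n. f k * measure unif01 (?I k))"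
    by (subst Bochner_Integration.integral_sum) (auto intro!: integrable_real_indicator simp: less_top[symmetric])
  also have "\<dots> = (\<Sum>k\<le>n. f k * (1 / real (Suc n)))"
    by (intro sum.cong refl, subst measure_unif01) (auto simp: field_simps)
  finally show ?thesis by (simp add: sum_divide_distrib)
qed

section \<open>The limit law, its moments and its characteristic function\<close>

definition vv_Y :: "real \<Rightarrow> real \<Rightarrow> real \<Rightarrow> real \<times> real \<Rightarrow> real" where
  "vv_Y e1 e2 e3 = (\<lambda>(x, \<theta>). vv_B e1 e2 e3 x + 2 * vv_A e1 e2 e3 x * cos \<theta>)"

definition limit_law :: "real \<Rightarrow> real \<Rightarrow> real \<Rightarrow> real measure" where
  "limit_law e1 e2 e3 = distr (unif01 \<Otimes>\<^sub>M unifpi) borel (vv_Y e1 e2 e3)"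

text \<open>Everything rests on k(k - 1) + \<alpha> k \<le> \<open>vv_c \<alpha> n\<close>: it
  bounds the quadratic quotient by 1, the linear one by 1 / \<alpha>, and, since \<alpha>2 \<le>
  \<alpha>, the second factor of the off-diagonal product by ab. The four terms of C are read off
  from this.\<close>

lemma vv_entries_bounded:
  fixes e1 e2 e3 \<alpha>1 \<alpha>2 \<alpha>3 :: real
  assumes e: "e1 > e2" "e2 > e3" and \<alpha>: "\<alpha>1 > 0" "\<alpha>2 > 0" "\<alpha>3 > 0"
  obtains C where "\<And>n k. n \<ge> 1 \<Longrightarrow> k \<le> n \<Longrightarrow> \<bar>vv_diag e1 e2 e3 \<alpha>1 \<alpha>2 \<alpha>3 n k\<bar> \<le> C"
    and "\<And>n k. n \<ge> 1 \<Longrightarrow> 1 \<le> k \<Longrightarrow> k \<le> n \<Longrightarrow> sqrt (vv_off e1 e2 e3 \<alpha>1 \<alpha>2 \<alpha>3 n k) \<le> C"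
proof -
  define \<alpha> where "\<alpha> = \<alpha>1 + \<alpha>2 + \<alpha>3"
  define d where "d = e1 + e3 - 2 * e2"
  define ab where "ab = (e1 - e2) * (e2 - e3)"
  define L where "L = vv_lin e1 e2 e3 \<alpha>1 \<alpha>2 \<alpha>3"
  have ab: "ab > 0" using e by (simp add: ab_def)
  have \<alpha>pos: "\<alpha> > 0" "\<alpha>2 \<le> \<alpha>" using \<alpha> by (auto simp: \<alpha>_def)
  have cpos: "vv_c \<alpha> n > 0" if "n \<ge> 1" for n :: nat
    unfolding vv_c_def using that \<alpha>pos by (intro mult_pos_pos) auto
  have k1: "0 \<le> k * (real k - 1)" for k :: nat by (cases k) auto
  have le: "k * (real k - 1) + \<alpha> * k \<le> vv_c \<alpha> n" if "n \<ge> 1" "k \<le> n" for n k :: nat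
  proof -
    have "real k * (real k - 1 + \<alpha>) \<le> real n * (real n - 1 + \<alpha>)"
    proof (cases "k = 0")
      case True
      then show ?thesis using cpos[OF that(1)] by (simp add: vv_c_def)
    qed (use that \<alpha>pos in \<open>auto intro!: mult_mono\<close>)
    then show ?thesis by (simp add: vv_c_def algebra_simps)
  qed
  define C where "C = \<bar>e2\<bar> + \<bar>d\<bar> + \<bar>L\<bar> / \<alpha> + sqrt ab"
  show ?thesis
  proof (rule that[of C])
    fix n k :: nat assume n: "n \<ge> 1" and k: "k \<le> n"
    let ?c = "vv_c \<alpha> n"
    have q1: "0 \<le> k * (real k - 1) / ?c" "k * (real k - 1) / ?c \<le> 1"
      using k1[of k] le[OF n k] cpos[OF n] \<alpha>pos by (auto simp: field_simps intro: order_trans[rotated])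
    have "\<alpha> * k \<le> ?c" using k1[of k] le[OF n k] by linarith
    then have q2: "0 \<le> k / ?c" "k / ?c \<le> 1 / \<alpha>"
      using cpos[OF n] \<alpha>pos by (auto simp: field_simps)
    have "vv_diag e1 e2 e3 \<alpha>1 \<alpha>2 \<alpha>3 n k = e2 + (d * (k * (real k - 1) / ?c) - L * (k / ?c))"
      by (simp add: vv_diag_def d_def L_def \<alpha>_def diff_divide_distrib)
    also have "\<bar>\<dots>\<bar> \<le> \<bar>e2\<bar> + (\<bar>d * (k * (real k - 1) / ?c)\<bar> + \<bar>L * (k / ?c)\<bar>)" by linarith
    also have "\<dots> \<le> \<bar>e2\<bar> + (\<bar>d\<bar> * 1 + \<bar>L\<bar> * (1 / \<alpha>))"
      unfolding abs_mult[of d] abs_mult[of L] using q1 q2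
      by (intro add_mono mult_left_mono order_refl) auto
    also have "\<dots> \<le> C" using ab by (simp add: C_def)
    finally show "\<bar>vv_diag e1 e2 e3 \<alpha>1 \<alpha>2 \<alpha>3 n k\<bar> \<le> C" .
    assume k0: "1 \<le> k"
    have "vv_c \<alpha> (real k - 1) \<ge> 0"
    proof (cases "k = 1")
      case False
      then show ?thesis using k0 \<alpha>pos by (simp add: vv_c_def)
    qed (simp add: vv_c_def)
    then have r1: "(?c - vv_c \<alpha> (real k - 1)) / ?c \<le> 1" using cpos[OF n] by (simp add: field_simps)
    have "\<alpha>2 * k \<le> \<alpha> * k" using \<alpha>pos by (intro mult_right_mono) auto
    then have "k * (real k - 1 + \<alpha>2) \<le> ?c" using le[OF n k] by (simp add: algebra_simps)
    then have "ab * (k * (real k - 1 + \<alpha>2)) \<le> ab * ?c" using ab by (intro mult_left_mono) auto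
    then have r2: "ab * (k * (real k - 1 + \<alpha>2)) / ?c \<le> ab" using cpos[OF n] by (simp add: field_simps)
    have r3: "0 \<le> ab * (k * (real k - 1 + \<alpha>2)) / ?c"
      using ab cpos[OF n] k0 \<alpha> by (intro divide_nonneg_pos mult_nonneg_nonneg) auto
    have "vv_off e1 e2 e3 \<alpha>1 \<alpha>2 \<alpha>3 n k \<le> 1 * ab"
      unfolding vv_off_def \<alpha>_def[symmetric] ab_def[symmetric] using r1 r2 r3 by (intro mult_mono) auto
    then have "sqrt (vv_off e1 e2 e3 \<alpha>1 \<alpha>2 \<alpha>3 n k) \<le> sqrt ab" by simp
    also have "\<dots> \<le> C" using \<alpha>pos by (simp add: C_def)
    finally show "sqrt (vv_off e1 e2 e3 \<alpha>1 \<alpha>2 \<alpha>3 n k) \<le> C" .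
  qed
qed

lemma vv_B_measurable [measurable]: "vv_B e1 e2 e3 \<in> borel_measurable borel"
  and vv_A_measurable [measurable]: "vv_A e1 e2 e3 \<in> borel_measurable borel"
  unfolding vv_B_def[abs_def] vv_A_def[abs_def] by measurable

lemma vv_Y_measurable [measurable]: "vv_Y e1 e2 e3 \<in> borel_measurable (unif01 \<Otimes>\<^sub>M unifpi)"
  unfolding vv_Y_def by measurable

lemma vv_Y_bounded:
  "AE z in unif01 \<Otimes>\<^sub>M unifpi. \<bar>vv_Y e1 e2 e3 z\<bar> \<le> \<bar>e2\<bar> + \<bar>e1 + e3 - 2 * e2\<bar> + 2 * sqrt \<bar>(e1 - e2) * (e2 - e3)\<bar>"
    (is "AE z in _. _ \<le> ?C")
proof -
  interpret X: prob_space unif01 by (rule prob_space_unif)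
  interpret T: prob_space unifpi by (rule prob_space_unif)
  interpret pair_prob_space unif01 unifpi ..
  have bd: "\<bar>vv_Y e1 e2 e3 (x, \<theta>)\<bar> \<le> ?C" if "0 < x \<and> x < 1" for x \<theta>
  proof -
    have x2: "0 \<le> x\<^sup>2" "x\<^sup>2 \<le> 1" using that by (auto simp: power_le_one)
    have "\<bar>vv_B e1 e2 e3 x\<bar> \<le> \<bar>e2\<bar> + \<bar>(e1 + e3 - 2 * e2) * x\<^sup>2\<bar>" unfolding vv_B_def by linarith
    also have "\<dots> \<le> \<bar>e2\<bar> + \<bar>e1 + e3 - 2 * e2\<bar>" using x2 by (simp add: abs_mult mult_left_le)
    finally have B: "\<bar>vv_B e1 e2 e3 x\<bar> \<le> \<bar>e2\<bar> + \<bar>e1 + e3 - 2 * e2\<bar>" .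
    have "\<bar>(e1 - e2) * (e2 - e3) * x\<^sup>2 * (1 - x\<^sup>2)\<bar> = \<bar>(e1 - e2) * (e2 - e3)\<bar> * (x\<^sup>2 * (1 - x\<^sup>2))"
      using x2 by (simp add: abs_mult)
    also have "\<dots> \<le> \<bar>(e1 - e2) * (e2 - e3)\<bar> * (1 * 1)"
      using x2 by (intro mult_left_mono mult_mono) auto
    finally have "\<bar>vv_A e1 e2 e3 x\<bar> \<le> sqrt \<bar>(e1 - e2) * (e2 - e3)\<bar>"
      unfolding vv_A_def sqrt_def real_root_abs[of 2, simplified, symmetric] by simp
    then show ?thesis using B abs_affine_cos_le[of "vv_B e1 e2 e3 x" "vv_A e1 e2 e3 x" \<theta>]
      unfolding vv_Y_def by simp
  qed
  show ?thesis
  proof (rule AE_pair_measure)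
    show "AE x in unif01. AE y in unifpi. \<bar>vv_Y e1 e2 e3 (x, y)\<bar> \<le> ?C"
      using AE_unif01 by eventually_elim (use bd in auto)
  qed measurable
qed

context
  fixes e1 e2 e3 \<alpha>1 \<alpha>2 \<alpha>3 :: real
  assumes e12: "e1 > e2" and e23: "e2 > e3" and \<alpha>: "\<alpha>1 > 0" "\<alpha>2 > 0" "\<alpha>3 > 0"
begin

abbreviation lame_roots where
  "lame_roots n \<equiv> {t. poly (jac_poly (vv_diag e1 e2 e3 \<alpha>1 \<alpha>2 \<alpha>3 n) (vv_off e1 e2 e3 \<alpha>1 \<alpha>2 \<alpha>3 n) (Suc n)) t = 0}"
abbreviation lame_pow where
  "lame_pow n \<equiv> jac_pow (vv_diag e1 e2 e3 \<alpha>1 \<alpha>2 \<alpha>3 n) (vv_off e1 e2 e3 \<alpha>1 \<alpha>2 \<alpha>3 n)"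

lemma sum_roots_power:
  assumes n: "n \<ge> 1"
  shows "(\<Sum>t\<in>lame_roots n. t ^ m) = (\<Sum>k\<le>n. lame_pow n m k k)"
  by (rule jac_pow_trace) (use vv_off_pos[OF e12 e23 \<alpha> n] vv_off_Suc[OF e12 e23 \<alpha> n] in auto)

lemma jac_pow_uniform_bound:
  obtains C where "C \<ge> 0" "\<And>n m k i. n \<ge> 1 \<Longrightarrow> k \<le> n \<Longrightarrow> \<bar>lame_pow n m k i\<bar> \<le> C ^ m"
proof -
  obtain C where C: "\<And>n k. n \<ge> 1 \<Longrightarrow> k \<le> n \<Longrightarrow> \<bar>vv_diag e1 e2 e3 \<alpha>1 \<alpha>2 \<alpha>3 n k\<bar> \<le> C"
    "\<And>n k. n \<ge> 1 \<Longrightarrow> 1 \<le> k \<Longrightarrow> k \<le> n \<Longrightarrow> sqrt (vv_off e1 e2 e3 \<alpha>1 \<alpha>2 \<alpha>3 n k) \<le> C"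
    using vv_entries_bounded[OF e12 e23 \<alpha>] by blast
  have "3 * C \<ge> 0" using C(1)[of 1 0] by simp
  moreover have "\<bar>lame_pow n m k i\<bar> \<le> (3 * C) ^ m" if "n \<ge> 1" "k \<le> n" for n m k i
    by (rule jac_pow_bound[where n = n])
      (use C that vv_off_pos[OF e12 e23 \<alpha> that(1)] vv_off_Suc[OF e12 e23 \<alpha> that(1)] in auto)
  ultimately show ?thesis using that by blast
qed

text \<open>The power sum is a trace, and its average is an integral over x; the diagonal entry in
  the row at position x converges by \<open>jac_pow_tendsto\<close> with offset 0, dominated by C ^
  m.\<close>

lemma root_moments_tendsto:
  "(\<lambda>n. (\<Sum>t\<in>lame_roots n. t ^ m) / real (Suc n))
     \<longlonglongrightarrow> (\<integral>x. toeplitz_pow (vv_B e1 e2 e3 x) (vv_A e1 e2 e3 x) m 0 \<partial>unif01)"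
\<comment> \<open>The shift avoids n = 0, where \<open>vv_c\<close> vanishes: dominated convergence
  asks for the bound at every index, and it is available for n \<ge> 1.\<close>
proof (rule LIMSEQ_imp_Suc)
  interpret prob_space unif01 by (rule prob_space_unif)
  let ?k = "\<lambda>n x. nat \<lfloor>real (Suc n) * x\<rfloor>"
  obtain C where C: "C \<ge> 0" "\<And>n m k i. n \<ge> 1 \<Longrightarrow> k \<le> n \<Longrightarrow> \<bar>lame_pow n m k i\<bar> \<le> C ^ m"
    using jac_pow_uniform_bound by blast
  have "(\<lambda>n. \<integral>x. lame_pow (Suc n) m (?k (Suc n) x) (?k (Suc n) x) \<partial>unif01)
     \<longlonglongrightarrow> (\<integral>x. toeplitz_pow (vv_B e1 e2 e3 x) (vv_A e1 e2 e3 x) m 0 \<partial>unif01)"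
  proof (rule integral_dominated_convergence[where w = "\<lambda>_. C ^ m"])
    have "continuous_on UNIV (\<lambda>x. toeplitz_pow (vv_B e1 e2 e3 x) (vv_A e1 e2 e3 x) m 0)"
      unfolding vv_B_def vv_A_def by (intro continuous_toeplitz_pow continuous_intros)
    then show "(\<lambda>x. toeplitz_pow (vv_B e1 e2 e3 x) (vv_A e1 e2 e3 x) m 0) \<in> borel_measurable unif01"
      using borel_measurable_continuous_onI by (simp cong: measurable_cong_sets)
    show "AE x in unif01. (\<lambda>n. lame_pow (Suc n) m (?k (Suc n) x) (?k (Suc n) x))
        \<longlonglongrightarrow> toeplitz_pow (vv_B e1 e2 e3 x) (vv_A e1 e2 e3 x) m 0"
      using AE_unif01
    proof eventually_elim
      case (elim x)
      have K: "filterlim (\<lambda>n. ?k n x) at_top sequentially"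
        "(\<lambda>n. real (nat (int (?k n x) + i)) / real n) \<longlonglongrightarrow> x" for i
        using scaled_floor_tendsto[of x] elim by auto
      have \<alpha>pos: "\<alpha>1 + \<alpha>2 + \<alpha>3 > 0" using \<alpha> by simp
      have "(\<lambda>n. lame_pow n m (nat (int (?k n x) + 0)) (?k n x)) \<longlonglongrightarrow> toeplitz_pow (vv_B e1 e2 e3 x) (vv_A e1 e2 e3 x) m 0"
        by (intro jac_pow_tendsto vv_diag_tendsto[OF \<alpha>pos] vv_off_tendsto[OF \<alpha>pos] K)
      then have "(\<lambda>n. lame_pow n m (?k n x) (?k n x)) \<longlonglongrightarrow> toeplitz_pow (vv_B e1 e2 e3 x) (vv_A e1 e2 e3 x) m 0"
        by (simp only: add_0_right nat_int)
      then show ?case by (rule LIMSEQ_Suc)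
    qed
    show "AE x in unif01. norm (lame_pow (Suc n) m (?k (Suc n) x) (?k (Suc n) x)) \<le> C ^ m" for n
      using AE_unif01
    proof eventually_elim
      case (elim x)
      have "real (Suc (Suc n)) * x < real (Suc (Suc n))" using elim by simp
      then have "?k (Suc n) x \<le> Suc n" using elim by linarith
      then show ?case using C(2) by simp
    qed
  qed auto
  moreover have "(\<Sum>t\<in>lame_roots (Suc n). t ^ m) / real (Suc (Suc n)) = (\<integral>x. lame_pow (Suc n) m (?k (Suc n) x) (?k (Suc n) x) \<partial>unif01)" for n
  proof -
    have "Suc n \<ge> 1" by simp
    from sum_roots_power[OF this, of m] average_eq_integral[of "\<lambda>k. lame_pow (Suc n) m k k" "Suc n"]
    show ?thesis by (simp only:)
  qed
  ultimately show "(\<lambda>n. (\<Sum>t\<in>lame_roots (Suc n). t ^ m) / real (Suc (Suc n)))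
     \<longlonglongrightarrow> (\<integral>x. toeplitz_pow (vv_B e1 e2 e3 x) (vv_A e1 e2 e3 x) m 0 \<partial>unif01)" by simp
qed

lemma limit_moment:
  "(\<integral>x. toeplitz_pow (vv_B e1 e2 e3 x) (vv_A e1 e2 e3 x) m 0 \<partial>unif01)
     = (\<integral>z. vv_Y e1 e2 e3 z ^ m \<partial>(unif01 \<Otimes>\<^sub>M unifpi))"
proof -
  interpret X: prob_space unif01 by (rule prob_space_unif)
  interpret T: prob_space unifpi by (rule prob_space_unif)
  interpret pair_prob_space unif01 unifpi ..
  obtain C where C: "AE z in unif01 \<Otimes>\<^sub>M unifpi. \<bar>vv_Y e1 e2 e3 z\<bar> \<le> C" using vv_Y_bounded by blast
  have "integrable (unif01 \<Otimes>\<^sub>M unifpi) (\<lambda>z. vv_Y e1 e2 e3 z ^ m)"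
  proof (rule integrable_const_bound[where B = "C ^ m"])
    show "AE z in unif01 \<Otimes>\<^sub>M unifpi. norm (vv_Y e1 e2 e3 z ^ m) \<le> C ^ m"
      using C by eventually_elim (auto simp: power_abs intro!: power_mono)
  qed measurable
  then have "integrable (unif01 \<Otimes>\<^sub>M unifpi) (\<lambda>(x, \<theta>). vv_Y e1 e2 e3 (x, \<theta>) ^ m)"
    by (simp add: case_prod_unfold)
  from integral_fst[OF this] show ?thesis
    by (simp add: toeplitz_pow_def vv_Y_def case_prod_unfold)
qed

text \<open>The law is boundedly supported, so the exponential series may be integrated termwise;
  its coefficients are the limits of the moments of the roots.\<close>

lemma char_limit_law:
  "char (limit_law e1 e2 e3) t = (\<Sum>m. (\<i> * of_real t) ^ m / fact m
      * of_real (\<integral>x. toeplitz_pow (vv_B e1 e2 e3 x) (vv_A e1 e2 e3 x) m 0 \<partial>unif01))"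
proof -
  interpret X: prob_space unif01 by (rule prob_space_unif)
  interpret T: prob_space unifpi by (rule prob_space_unif)
  interpret P: pair_prob_space unif01 unifpi ..
  let ?P = "unif01 \<Otimes>\<^sub>M unifpi"
  let ?Y = "vv_Y e1 e2 e3"
  obtain C where C: "AE z in ?P. \<bar>?Y z\<bar> \<le> C" using vv_Y_bounded by blast
  define f where "f m z = (\<i> * of_real t) ^ m / fact m * complex_of_real (?Y z ^ m)" for m z
  have nf: "AE z in ?P. norm (f m z) \<le> (\<bar>t\<bar> * C) ^ m / fact m" for m
    using C
  proof eventually_elim
    case (elim z)
    have "norm (f m z) = \<bar>t\<bar> ^ m / fact m * \<bar>?Y z\<bar> ^ m"
      by (simp add: f_def norm_mult norm_divide norm_power power_abs)
    also have "\<dots> \<le> \<bar>t\<bar> ^ m / fact m * C ^ m"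
      using elim by (intro mult_left_mono power_mono) auto
    finally show ?case by (simp add: power_mult_distrib)
  qed
  have meas [measurable]: "f m \<in> borel_measurable ?P" for m unfolding f_def by measurable
  have int: "integrable ?P (f m)" for m
    by (rule P.integrable_const_bound[OF nf]) measurable
  have ex: "(\<lambda>m. f m z) sums exp (\<i> * of_real t * of_real (?Y z))" for z
    using exp_converges[of "\<i> * of_real t * of_real (?Y z)"]
    by (simp add: f_def power_mult_distrib scaleR_conv_of_real field_simps)
  have sm: "summable (\<lambda>m. x ^ m / fact m)" for x :: real
    using summable_exp[of x] by (simp add: field_simps)
  have "char (limit_law e1 e2 e3) t = (\<integral>z. exp (\<i> * of_real t * of_real (?Y z)) \<partial>?P)"
    unfolding char_def limit_law_def by (subst integral_distr) (auto simp: mult_ac)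
  also have "\<dots> = (\<integral>z. (\<Sum>m. f m z) \<partial>?P)"
    using ex by (simp add: sums_iff)
  also have "\<dots> = (\<Sum>m. \<integral>z. f m z \<partial>?P)"
  proof (rule integral_suminf[OF int])
    have "AE z in ?P. \<forall>m. norm (f m z) \<le> (\<bar>t\<bar> * C) ^ m / fact m"
      using nf by (simp add: AE_all_countable)
    then show "AE z in ?P. summable (\<lambda>m. norm (f m z))"
      by eventually_elim (rule summable_comparison_test'[OF sm, of 0 _ "\<bar>t\<bar> * C"], auto)
    show "summable (\<lambda>m. \<integral>z. norm (f m z) \<partial>?P)"
    proof (rule summable_comparison_test'[OF sm[of "\<bar>t\<bar> * C"], of 0])
      fix m
      have "(\<integral>z. norm (f m z) \<partial>?P) \<le> (\<integral>z. (\<bar>t\<bar> * C) ^ m / fact m \<partial>?P)"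
        using nf by (intro integral_mono_AE integrable_norm int) auto
      then show "norm (\<integral>z. norm (f m z) \<partial>?P) \<le> (\<bar>t\<bar> * C) ^ m / fact m"
        by (simp add: P.prob_space)
    qed
  qed
  also have "(\<lambda>m. \<integral>z. f m z \<partial>?P) = (\<lambda>m. (\<i> * of_real t) ^ m / fact m
      * of_real (\<integral>x. toeplitz_pow (vv_B e1 e2 e3 x) (vv_A e1 e2 e3 x) m 0 \<partial>unif01))"
    unfolding f_def limit_moment by (simp only: integral_mult_right_zero integral_complex_of_real)
  finally show ?thesis .
qed

text \<open>The moments are at most C ^ m uniformly in n, so (|t| C)^m / m! is a summable majorant
  and Tannery's theorem allows the limit to be taken in each term.\<close>

lemma root_char_tendsto:
  "(\<lambda>n. (\<Sum>s\<in>lame_roots n. exp (\<i> * of_real (t * s))) / of_nat (Suc n)) \<longlonglongrightarrow> char (limit_law e1 e2 e3) t"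
proof -
  obtain C where C: "C \<ge> 0" "\<And>n m k i. n \<ge> 1 \<Longrightarrow> k \<le> n \<Longrightarrow> \<bar>lame_pow n m k i\<bar> \<le> C ^ m"
    using jac_pow_uniform_bound by blast
  define mom where "mom n m = (\<Sum>s\<in>lame_roots n. s ^ m) / real (Suc n)" for n m
  have bound: "\<bar>mom n m\<bar> \<le> C ^ m" if "n \<ge> 1" for n m
  proof -
    have "\<bar>\<Sum>k\<le>n. lame_pow n m k k\<bar> \<le> (\<Sum>k\<le>n. C ^ m)"
      by (rule order_trans[OF sum_abs sum_mono]) (use C(2)[OF that] in simp)
    then show ?thesis unfolding mom_def sum_roots_power[OF that] by (simp add: field_simps)
  qed
  define a where "a m n = (\<i> * of_real t) ^ m / fact m * complex_of_real (mom n m)" for m n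
  have "(\<lambda>n. \<Sum>m. a m n) \<longlonglongrightarrow> (\<Sum>m. (\<i> * of_real t) ^ m / fact m
      * of_real (\<integral>x. toeplitz_pow (vv_B e1 e2 e3 x) (vv_A e1 e2 e3 x) m 0 \<partial>unif01))"
  proof (rule tannerys_theorem[where M = "\<lambda>m. (\<bar>t\<bar> * C) ^ m / fact m", THEN conjunct2, THEN conjunct2])
    show "(\<lambda>n. a m n) \<longlonglongrightarrow> (\<i> * of_real t) ^ m / fact m
      * of_real (\<integral>x. toeplitz_pow (vv_B e1 e2 e3 x) (vv_A e1 e2 e3 x) m 0 \<partial>unif01)" for m
      unfolding a_def mom_def by (intro tendsto_intros root_moments_tendsto)
    have "norm (a m n) \<le> (\<bar>t\<bar> * C) ^ m / fact m" if "n \<ge> 1" for m n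
    proof -
      have "norm (a m n) = \<bar>t\<bar> ^ m / fact m * \<bar>mom n m\<bar>"
        by (simp add: a_def norm_mult norm_divide norm_power power_abs)
      also have "\<dots> \<le> \<bar>t\<bar> ^ m / fact m * C ^ m"
        using bound[OF that] by (intro mult_left_mono) auto
      finally show ?thesis by (simp add: power_mult_distrib)
    qed
    moreover have "eventually (\<lambda>(m, n). n \<ge> 1) (sequentially \<times>\<^sub>F sequentially)"
      unfolding eventually_prod_sequentially by auto
    ultimately show "eventually (\<lambda>(m, n). norm (a m n) \<le> (\<bar>t\<bar> * C) ^ m / fact m) (sequentially \<times>\<^sub>F sequentially)"
      by (auto elim!: eventually_mono)
    show "summable (\<lambda>m. (\<bar>t\<bar> * C) ^ m / fact m)"
      using summable_exp[of "\<bar>t\<bar> * C"] by (simp add: field_simps)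
  qed simp
  moreover have "(\<lambda>m. a m n) sums ((\<Sum>s\<in>lame_roots n. exp (\<i> * of_real (t * s))) / of_nat (Suc n))" for n
  proof -
    have "(\<lambda>m. (\<i> * of_real (t * s)) ^ m / fact m) sums exp (\<i> * of_real (t * s))" for s
      using exp_converges[of "\<i> * of_real (t * s)"] by (simp add: scaleR_conv_of_real field_simps)
    then have "(\<lambda>m. (\<Sum>s\<in>lame_roots n. (\<i> * of_real (t * s)) ^ m / fact m) / of_nat (Suc n))
        sums ((\<Sum>s\<in>lame_roots n. exp (\<i> * of_real (t * s))) / of_nat (Suc n))"
      by (intro sums_divide sums_sum)
    moreover have "(\<Sum>s\<in>lame_roots n. (\<i> * of_real (t * s)) ^ m / fact m) / of_nat (Suc n) = a m n" for m
    proof -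
      have "(\<i> * of_real (t * s)) ^ m / fact m = (\<i> * of_real t) ^ m / fact m * complex_of_real (s ^ m)" for s
        by (simp add: power_mult_distrib)
      then show ?thesis
        by (simp only: a_def mom_def of_real_divide of_real_sum of_real_of_nat_eq sum_distrib_left times_divide_eq_right)
    qed
    ultimately show ?thesis by simp
  qed
  ultimately show ?thesis unfolding char_limit_law by (simp add: sums_iff)
qed

end

section \<open>The density of the limit law\<close>

definition dens_D :: "real \<Rightarrow> real \<Rightarrow> real \<Rightarrow> real \<Rightarrow> real" where
  "dens_D e1 e2 e3 s = (e1 - e3) * \<bar>s - e2\<bar>"

definition dens_A :: "real \<Rightarrow> real \<Rightarrow> real \<Rightarrow> real \<Rightarrow> real" where
  "dens_A e1 e2 e3 s = (e1 + e3 - 2 * e2) * (s - e2) + 2 * (e1 - e2) * (e2 - e3)"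

text \<open>With w = e1 - e3, the numbers (A - q) / w^2 and (A + q) / w^2 are the zeros in v = x^2
  of the radicand 2 A v - (s - e2)^2 - w^2 v^2.\<close>

definition dens_q :: "real \<Rightarrow> real \<Rightarrow> real \<Rightarrow> real \<Rightarrow> real" where
  "dens_q e1 e2 e3 s = sqrt ((dens_A e1 e2 e3 s)\<^sup>2 - (dens_D e1 e2 e3 s)\<^sup>2)"

text \<open>These are the parameters that integration over x produces. The endpoints e1, e3 are
  included so that the formulas hold there too; at e2, where D = 0 and the integral diverges
  logarithmically, the value is set to 0.\<close>

definition lame_density :: "real \<Rightarrow> real \<Rightarrow> real \<Rightarrow> real \<Rightarrow> real" where
  "lame_density e1 e2 e3 s = (if s \<in> {e3..e1} - {e2} then
     ell_int (sqrt (dens_A e1 e2 e3 s - dens_q e1 e2 e3 s))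
             (sqrt (dens_A e1 e2 e3 s + dens_q e1 e2 e3 s)) / pi else 0)"

text \<open>The first factorisation decides the sign of A - D, and with it the support; half of the
  second is a product of root differences in the integral over [e3, e2].\<close>

lemma dens_AD_right:
  assumes "s \<ge> e2"
  shows "dens_A e1 e2 e3 s - dens_D e1 e2 e3 s = 2 * (e2 - e3) * (e1 - s)"
    and "dens_A e1 e2 e3 s + dens_D e1 e2 e3 s = 2 * (e1 - e2) * (s - e3)"
  using assms by (simp_all add: dens_A_def dens_D_def algebra_simps)

lemma dens_AD_left:
  assumes "s \<le> e2"
  shows "dens_A e1 e2 e3 s - dens_D e1 e2 e3 s = 2 * (e1 - e2) * (s - e3)"
    and "dens_A e1 e2 e3 s + dens_D e1 e2 e3 s = 2 * (e2 - e3) * (e1 - s)"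
proof -
  have "\<bar>s - e2\<bar> = e2 - s" using assms by simp
  then show "dens_A e1 e2 e3 s - dens_D e1 e2 e3 s = 2 * (e1 - e2) * (s - e3)"
    and "dens_A e1 e2 e3 s + dens_D e1 e2 e3 s = 2 * (e2 - e3) * (e1 - s)"
    unfolding dens_A_def dens_D_def by (simp_all only:) (simp_all add: algebra_simps)
qed

text \<open>For fixed a and b this is the arcsine law on [b - 2a, b + 2a]: the derivative -2 a sin
  \<theta> equals the root of the radicand and cancels it except at the two ends.\<close>

lemma nn_integral_arcsine:
  fixes f :: "real \<Rightarrow> ennreal"
  assumes f [measurable]: "f \<in> borel_measurable borel" and a: "a > 0"
  shows "(\<integral>\<^sup>+\<theta>. f (b + 2 * a * cos \<theta>) \<partial>unifpi)
    = (\<integral>\<^sup>+s. f s * (ennreal (1 / (pi * sqrt ((2 * a)\<^sup>2 - (s - b)\<^sup>2))) * indicator {b - 2 * a..b + 2 * a} s) \<partial>lborel)"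
proof -
  let ?k = "\<lambda>s. ennreal (1 / (pi * sqrt ((2 * a)\<^sup>2 - (s - b)\<^sup>2)))"
  let ?g = "\<lambda>\<theta>. b + 2 * a * cos \<theta>"
  have g: "?g (- pi) = b - 2 * a" "?g 0 = b + 2 * a" by simp_all
  have "(\<integral>\<^sup>+s. f s * (?k s * indicator {b - 2 * a..b + 2 * a} s) \<partial>lborel)
      = (\<integral>\<^sup>+s. (f s * ?k s) * indicator {?g (- pi)..?g 0} s \<partial>lborel)"
    unfolding g by (simp only: mult.assoc)
  also have "\<dots> = (\<integral>\<^sup>+\<theta>. (f (?g \<theta>) * ?k (?g \<theta>)) * ennreal (- 2 * a * sin \<theta>) * indicator {- pi..0} \<theta> \<partial>lborel)"
  proof (rule nn_integral_substitution_aux)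
    fix \<theta> assume "\<theta> \<in> {- pi..0}"
    then have "sin (- \<theta>) \<ge> 0" by (intro sin_ge_zero) auto
    then show "0 \<le> - 2 * a * sin \<theta>" using a by (simp add: mult_nonneg_nonpos)
  qed (auto intro!: derivative_eq_intros continuous_intros)
  also have "\<dots> = (\<integral>\<^sup>+\<theta>. f (?g \<theta>) * indicator {- pi..0} \<theta> * ennreal (1 / pi) \<partial>lborel)"
  proof (rule nn_integral_cong_AE)
    show "AE \<theta> in lborel. (f (?g \<theta>) * ?k (?g \<theta>)) * ennreal (- 2 * a * sin \<theta>) * indicator {- pi..0} \<theta>
        = f (?g \<theta>) * indicator {- pi..0} \<theta> * ennreal (1 / pi)"
      using AE_lborel_singleton[of "- pi"] AE_lborel_singleton[of 0]
    proof eventually_elim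
      case (elim \<theta>)
      show ?case
      proof (cases "\<theta> \<in> {- pi..0}")
        case True
        then have "sin (- \<theta>) > 0" using elim by (intro sin_gt_zero) auto
        then have s: "- 2 * a * sin \<theta> > 0" using a by (simp add: mult_pos_neg)
        have "(2 * a)\<^sup>2 - (?g \<theta> - b)\<^sup>2 = (- 2 * a * sin \<theta>)\<^sup>2"
          by (simp add: power_mult_distrib sin_squared_eq algebra_simps)
        then have "1 / (pi * sqrt ((2 * a)\<^sup>2 - (?g \<theta> - b)\<^sup>2)) = 1 / (pi * (- 2 * a * sin \<theta>))"
          using s by (simp only: real_sqrt_abs abs_of_pos)
        moreover have "ennreal (1 / (pi * y)) * ennreal y = ennreal (1 / pi)" if "y > 0" for y
          using that by (subst ennreal_mult[symmetric]) auto
        ultimately have "?k (?g \<theta>) * ennreal (- 2 * a * sin \<theta>) = ennreal (1 / pi)"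
          using s by (simp only:)
        then show ?thesis using True by (simp add: mult.assoc)
      qed simp
    qed
  qed
  also have "\<dots> = (\<integral>\<^sup>+\<theta>. f (?g \<theta>) * indicator {- pi..0} \<theta> \<partial>lborel) * ennreal (1 / pi)"
    by (rule nn_integral_multc) measurable
  also have "\<dots> = (\<integral>\<^sup>+\<theta>. f (?g \<theta>) \<partial>unifpi)"
  proof -
    have "ennreal (1 / pi) = inverse (ennreal pi)"
      by (simp add: inverse_ennreal inverse_eq_divide)
    then show ?thesis
      unfolding unifpi_def by (subst nn_integral_uniform_measure) (auto simp: divide_ennreal_def)
  qed
  finally show ?thesis ..
qed

context
  fixes e1 e2 e3 :: real
  assumes e12: "e1 > e2" and e23: "e2 > e3"
begin

lemma dens_D_pos: "s \<noteq> e2 \<Longrightarrow> dens_D e1 e2 e3 s > 0"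
  using e12 e23 by (simp add: dens_D_def)

lemma dens_A_ge_D:
  assumes "s \<in> {e3..e1}"
  shows "dens_D e1 e2 e3 s \<le> dens_A e1 e2 e3 s"
proof (cases "s \<ge> e2")
  case True
  have "2 * (e2 - e3) * (e1 - s) \<ge> 0" using assms e23 by (intro mult_nonneg_nonneg) auto
  then show ?thesis using dens_AD_right(1)[OF True, of e1 e3] by linarith
next
  case False
  have "2 * (e1 - e2) * (s - e3) \<ge> 0" using assms e12 by (intro mult_nonneg_nonneg) auto
  then show ?thesis using dens_AD_left(1)[of s e2 e1 e3] False by linarith
qed

lemma dens_A_gt_D_iff: "dens_D e1 e2 e3 s < dens_A e1 e2 e3 s \<longleftrightarrow> e3 < s \<and> s < e1"
proof (cases "s \<ge> e2")
  case True
  have "dens_D e1 e2 e3 s < dens_A e1 e2 e3 s \<longleftrightarrow> 2 * (e2 - e3) * (e1 - s) > 0"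
    using dens_AD_right(1)[OF True, of e1 e3] by linarith
  then show ?thesis using e23 True by (simp add: zero_less_mult_iff)
next
  case False
  have "dens_D e1 e2 e3 s < dens_A e1 e2 e3 s \<longleftrightarrow> 2 * (e1 - e2) * (s - e3) > 0"
    using dens_AD_left(1)[of s e2 e1 e3] False by linarith
  then show ?thesis using e12 False by (auto simp add: zero_less_mult_iff)
qed

lemma dens_q_props:
  assumes "s \<in> {e3..e1} - {e2}"
  shows "0 \<le> dens_q e1 e2 e3 s" "dens_q e1 e2 e3 s < dens_A e1 e2 e3 s"
    and "(dens_A e1 e2 e3 s - dens_q e1 e2 e3 s) * (dens_A e1 e2 e3 s + dens_q e1 e2 e3 s) = (dens_D e1 e2 e3 s)\<^sup>2"
proof -
  have DA: "0 < dens_D e1 e2 e3 s" "dens_D e1 e2 e3 s \<le> dens_A e1 e2 e3 s"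
    using assms dens_D_pos dens_A_ge_D by auto
  have sq: "(dens_q e1 e2 e3 s)\<^sup>2 = (dens_A e1 e2 e3 s)\<^sup>2 - (dens_D e1 e2 e3 s)\<^sup>2"
    unfolding dens_q_def using DA by (intro real_sqrt_pow2) (auto intro: power_mono)
  show "0 \<le> dens_q e1 e2 e3 s" unfolding dens_q_def using DA by (auto intro: power_mono)
  have "(dens_q e1 e2 e3 s)\<^sup>2 < (dens_A e1 e2 e3 s)\<^sup>2" unfolding sq using DA by simp
  then show "dens_q e1 e2 e3 s < dens_A e1 e2 e3 s" by (rule power2_less_imp_less) (use DA in auto)
  show "(dens_A e1 e2 e3 s - dens_q e1 e2 e3 s) * (dens_A e1 e2 e3 s + dens_q e1 e2 e3 s) = (dens_D e1 e2 e3 s)\<^sup>2"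
    using sq by (simp add: algebra_simps power2_eq_square)
qed

lemma lame_density_nonneg: "lame_density e1 e2 e3 s \<ge> 0"
  unfolding lame_density_def using dens_q_props[of s]
  by (auto intro!: divide_nonneg_nonneg ell_int_nonneg)

text \<open>The conditional density at s given x, that is, the arcsine density extended by
  zero.\<close>

definition lame_kernel :: "real \<Rightarrow> real \<Rightarrow> ennreal" where
  "lame_kernel x s = (if vv_B e1 e2 e3 x - 2 * vv_A e1 e2 e3 x \<le> s \<and> s \<le> vv_B e1 e2 e3 x + 2 * vv_A e1 e2 e3 x
     then ennreal (1 / (pi * sqrt ((2 * vv_A e1 e2 e3 x)\<^sup>2 - (s - vv_B e1 e2 e3 x)\<^sup>2))) else 0)"

text \<open>The coefficient of x^4 collapses through (e1 + e3 - 2 e2)^2 + 4 (e1 - e2)(e2 - e3) = (e1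
  - e3)^2. The sign of the radicand also decides whether s lies in the range of the arcsine
  law.\<close>

lemma lame_kernel_eq:
  fixes x s :: real
  assumes x: "0 < x" "x < 1"
  defines "N \<equiv> 2 * dens_A e1 e2 e3 s * x\<^sup>2 - (s - e2)\<^sup>2 - (e1 - e3)\<^sup>2 * (x\<^sup>2)\<^sup>2"
  shows "lame_kernel x s = (if N \<ge> 0 then ennreal (1 / (pi * sqrt N)) else 0)"
proof -
  have x2: "0 < x\<^sup>2" "x\<^sup>2 < 1" using x by (auto simp: power_less_one_iff)
  have rad: "(e1 - e2) * (e2 - e3) * x\<^sup>2 * (1 - x\<^sup>2) > 0" using x2 e12 e23 by simp
  then have "(vv_A e1 e2 e3 x)\<^sup>2 = (e1 - e2) * (e2 - e3) * x\<^sup>2 * (1 - x\<^sup>2)"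
    unfolding vv_A_def by (intro real_sqrt_pow2) simp
  then have N: "(2 * vv_A e1 e2 e3 x)\<^sup>2 - (s - vv_B e1 e2 e3 x)\<^sup>2 = N"
    unfolding N_def vv_B_def dens_A_def by (simp add: power_mult_distrib) (simp add: algebra_simps power2_eq_square power4_eq_xxxx)
  have "vv_A e1 e2 e3 x \<ge> 0" using rad by (simp add: vv_A_def)
  then have "(vv_B e1 e2 e3 x - 2 * vv_A e1 e2 e3 x \<le> s \<and> s \<le> vv_B e1 e2 e3 x + 2 * vv_A e1 e2 e3 x)
      \<longleftrightarrow> \<bar>s - vv_B e1 e2 e3 x\<bar> \<le> \<bar>2 * vv_A e1 e2 e3 x\<bar>" by auto
  also have "\<dots> \<longleftrightarrow> N \<ge> 0" unfolding abs_le_square_iff N[symmetric] by simp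
  finally show ?thesis unfolding lame_kernel_def N by simp
qed

lemma nn_integral_unif01: "(\<integral>\<^sup>+x. f x \<partial>unif01) = (\<integral>\<^sup>+x. f x * indicator {0..1} x \<partial>lborel)"
  if "f \<in> borel_measurable borel" for f :: "real \<Rightarrow> ennreal"
  unfolding unif01_def using that by (subst nn_integral_uniform_measure) (auto simp: divide_ennreal_def)

lemma lame_kernel_measurable [measurable]: "(\<lambda>(x, s). lame_kernel x s) \<in> borel_measurable (borel \<Otimes>\<^sub>M borel)"
proof -
  show ?thesis unfolding lame_kernel_def by measurable
qed

text \<open>Here A < D, so with w = e1 - e3 one has 2 A x^2 < 2 w |s - e2| x^2 \<le> (s - e2)^2 +
  w^2 x^4, and the radicand is negative for every x in (0, 1).\<close>

lemma nn_integral_lame_kernel_outside: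
  assumes s: "\<not> (e3 \<le> s \<and> s \<le> e1)"
  shows "(\<integral>\<^sup>+x. lame_kernel x s \<partial>unif01) = 0"
proof -
  have "AE x in unif01. lame_kernel x s = 0"
    using AE_unif01
  proof eventually_elim
    case (elim x)
    define w where "w = e1 - e3"
    have v: "x\<^sup>2 > 0" using elim by simp
    have "dens_A e1 e2 e3 s \<noteq> dens_D e1 e2 e3 s"
    proof (cases "s \<ge> e2")
      case True
      then show ?thesis using dens_AD_right(1)[OF True, of e1 e3] e23 s by auto
    next
      case False
      then show ?thesis using dens_AD_left(1)[of s e2 e1 e3] e12 s by auto
    qed
    then have "dens_A e1 e2 e3 s < dens_D e1 e2 e3 s" using dens_A_gt_D_iff[of s] s by linarith
    then have "2 * dens_A e1 e2 e3 s * x\<^sup>2 < 2 * (w * \<bar>s - e2\<bar>) * x\<^sup>2"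
      using v by (simp add: dens_D_def w_def)
    also have "\<dots> = 2 * \<bar>s - e2\<bar> * (w * x\<^sup>2)" by simp
    also have "\<dots> \<le> \<bar>s - e2\<bar>\<^sup>2 + (w * x\<^sup>2)\<^sup>2" using sum_squares_bound[of "\<bar>s - e2\<bar>" "w * x\<^sup>2"] by simp
    finally show ?case using elim by (subst lame_kernel_eq) (auto simp: w_def power_mult_distrib)
  qed
  then have "(\<integral>\<^sup>+x. lame_kernel x s \<partial>unif01) = (\<integral>\<^sup>+x. 0 \<partial>unif01)" by (rule nn_integral_cong_AE)
  then show ?thesis by simp
qed

text \<open>The radicand factors as w^2 (p^2 - x^2)(x^2 - m^2), so the kernel lives on [m, p]. Since
  p \<le> 1, this interval is not cut off by the range of x and the elliptic integral is
  complete.\<close>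

lemma nn_integral_lame_kernel_inside:
  assumes s: "e3 < s" "s < e1" "s \<noteq> e2"
  shows "(\<integral>\<^sup>+x. lame_kernel x s \<partial>unif01) = ennreal (lame_density e1 e2 e3 s)"
proof -
  define w where "w = e1 - e3"
  define A D q where "A = dens_A e1 e2 e3 s" and "D = dens_D e1 e2 e3 s" and "q = dens_q e1 e2 e3 s"
  have sI: "s \<in> {e3..e1} - {e2}" using s by auto
  have w: "w > 0" using e12 e23 by (simp add: w_def)
  have DA: "0 < D" "D < A" using dens_D_pos[OF s(3)] dens_A_gt_D_iff[of s] s by (auto simp: A_def D_def)
  have qp: "q < A" "(A - q) * (A + q) = D\<^sup>2" using dens_q_props[OF sI] by (auto simp: A_def D_def q_def)
  have q0: "q > 0" unfolding q_def dens_q_def using DA by (simp add: A_def D_def power_strict_mono)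
  define p m where "p = sqrt (A + q) / w" and "m = sqrt (A - q) / w"
  have mp: "0 < m" "m < p" using q0 qp(1) w by (auto simp: p_def m_def divide_strict_right_mono)
  have p2: "w\<^sup>2 * p\<^sup>2 = A + q" and m2: "w\<^sup>2 * m\<^sup>2 = A - q"
    using w q0 qp(1) by (auto simp: p_def m_def power_divide)
  have D2: "D\<^sup>2 = w\<^sup>2 * (s - e2)\<^sup>2" by (simp add: D_def dens_D_def w_def power_mult_distrib)
  have N: "2 * A * v - (s - e2)\<^sup>2 - w\<^sup>2 * v\<^sup>2 = w\<^sup>2 * ((p\<^sup>2 - v) * (v - m\<^sup>2))" for v
  proof -
    have "w\<^sup>2 * (w\<^sup>2 * ((p\<^sup>2 - v) * (v - m\<^sup>2))) = (w\<^sup>2 * p\<^sup>2 - w\<^sup>2 * v) * (w\<^sup>2 * v - w\<^sup>2 * m\<^sup>2)"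
      by (simp add: algebra_simps)
    also have "\<dots> = w\<^sup>2 * (2 * A * v) - (A - q) * (A + q) - w\<^sup>2 * (w\<^sup>2 * v\<^sup>2)"
      unfolding p2 m2 by (simp add: algebra_simps power2_eq_square)
    also have "\<dots> = w\<^sup>2 * (2 * A * v - (s - e2)\<^sup>2 - w\<^sup>2 * v\<^sup>2)"
      unfolding qp(2) D2 by (simp add: algebra_simps)
    finally have "w\<^sup>2 * (w\<^sup>2 * ((p\<^sup>2 - v) * (v - m\<^sup>2))) = w\<^sup>2 * (2 * A * v - (s - e2)\<^sup>2 - w\<^sup>2 * v\<^sup>2)" .
    moreover have "w\<^sup>2 \<noteq> 0" using w by simp
    ultimately show ?thesis by (metis mult_left_cancel)
  qed
  \<comment> \<open>At v = 1 the radicand is minus a square, so 1 does not lie strictly between m^2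
    and p^2; the product p^2 m^2 = (s - e2)^2 / w^2 < 1 excludes that both are at least 1.\<close>
  have p1: "p \<le> 1"
  proof (rule ccontr)
    assume "\<not> p \<le> 1"
    then have "p\<^sup>2 > 1" by simp
    have "\<bar>s - e2\<bar> < w" using s e12 e23 by (auto simp: w_def)
    then have "(s - e2)\<^sup>2 < w\<^sup>2" by (metis abs_le_square_iff abs_of_pos not_le w)
    have "w\<^sup>2 * (p\<^sup>2 * (w\<^sup>2 * m\<^sup>2)) = w\<^sup>2 * (s - e2)\<^sup>2"
      using qp(2) D2 unfolding p2[symmetric] m2[symmetric] by (simp add: mult_ac)
    then have "p\<^sup>2 * (w\<^sup>2 * m\<^sup>2) = (s - e2)\<^sup>2" using w by simp
    then have "w\<^sup>2 * (p\<^sup>2 * m\<^sup>2) < w\<^sup>2 * 1" using \<open>(s - e2)\<^sup>2 < w\<^sup>2\<close> by (simp add: mult_ac)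
    then have "p\<^sup>2 * m\<^sup>2 < 1" using w by simp
    moreover have "1 * m\<^sup>2 \<le> p\<^sup>2 * m\<^sup>2" using \<open>p\<^sup>2 > 1\<close> by (intro mult_right_mono) auto
    ultimately have "m\<^sup>2 < 1" by simp
    then have "w\<^sup>2 * ((p\<^sup>2 - 1) * (1 - m\<^sup>2)) > 0" using w \<open>p\<^sup>2 > 1\<close> by simp
    moreover have "2 * A * 1 - (s - e2)\<^sup>2 - w\<^sup>2 * 1\<^sup>2 = - ((s - e2) - (e1 + e3 - 2 * e2))\<^sup>2"
      by (simp add: A_def dens_A_def w_def algebra_simps power2_eq_square)
    moreover have "- ((s - e2) - (e1 + e3 - 2 * e2))\<^sup>2 \<le> 0" by simp
    ultimately show False using N[of 1] by linarith
  qed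
  have "(\<integral>\<^sup>+x. lame_kernel x s \<partial>unif01) = (\<integral>\<^sup>+x. lame_kernel x s * indicator {0..1} x \<partial>lborel)"
    by (rule nn_integral_unif01) measurable
  also have "\<dots> = (\<integral>\<^sup>+x. ennreal (1 / (pi * w)) * (ennreal (1 / sqrt ((p\<^sup>2 - x\<^sup>2) * (x\<^sup>2 - m\<^sup>2))) * indicator {m..p} x) \<partial>lborel)"
  proof (rule nn_integral_cong_AE)
    show "AE x in lborel. lame_kernel x s * indicator {0..1} x = ennreal (1 / (pi * w)) * (ennreal (1 / sqrt ((p\<^sup>2 - x\<^sup>2) * (x\<^sup>2 - m\<^sup>2))) * indicator {m..p} x)"
      using AE_lborel_singleton[of "0::real"] AE_lborel_singleton[of "1::real"]
    proof eventually_elim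
      case (elim x)
      show ?case
      proof (cases "x \<in> {0..1}")
        case True
        then have x: "0 < x" "x < 1" using elim by auto
        have "0 \<le> w\<^sup>2 * ((p\<^sup>2 - x\<^sup>2) * (x\<^sup>2 - m\<^sup>2)) \<longleftrightarrow> x \<in> {m..p}"
        proof -
          have "0 \<le> w\<^sup>2 * ((p\<^sup>2 - x\<^sup>2) * (x\<^sup>2 - m\<^sup>2)) \<longleftrightarrow> (m\<^sup>2 \<le> x\<^sup>2 \<and> x\<^sup>2 \<le> p\<^sup>2) \<or> (p\<^sup>2 \<le> x\<^sup>2 \<and> x\<^sup>2 \<le> m\<^sup>2)"
            using w by (auto simp: zero_le_mult_iff)
          also have "\<dots> \<longleftrightarrow> m\<^sup>2 \<le> x\<^sup>2 \<and> x\<^sup>2 \<le> p\<^sup>2"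
            using mp power_strict_mono[of m p 2] by auto
          also have "\<dots> \<longleftrightarrow> x \<in> {m..p}" using x mp by (auto simp: abs_le_square_iff[symmetric])
          finally show ?thesis .
        qed
        moreover have "ennreal (1 / (pi * sqrt (w\<^sup>2 * ((p\<^sup>2 - x\<^sup>2) * (x\<^sup>2 - m\<^sup>2)))))
           = ennreal (1 / (pi * w)) * ennreal (1 / sqrt ((p\<^sup>2 - x\<^sup>2) * (x\<^sup>2 - m\<^sup>2)))"
          using w by (subst ennreal_mult'[symmetric]) (auto simp: real_sqrt_mult mult.assoc)
        ultimately show ?thesis
          using True lame_kernel_eq[OF x, of s] N[of "x\<^sup>2"] by (auto simp: A_def[symmetric] w_def[symmetric])
      next
        case False
        then show ?thesis using mp p1 by auto
      qed
    qed
  qed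
  also have "\<dots> = ennreal (1 / (pi * w)) * (\<integral>\<^sup>+x. ennreal (1 / sqrt ((p\<^sup>2 - x\<^sup>2) * (x\<^sup>2 - m\<^sup>2))) * indicator {m..p} x \<partial>lborel)"
    by (rule nn_integral_cmult) measurable
  also have "\<dots> = ennreal (1 / (pi * w) * ell_int m p)"
    unfolding ell_int_nn_integral[OF mp] using w by (intro ennreal_mult'[symmetric]) simp
  also have "1 / (pi * w) * ell_int m p = lame_density e1 e2 e3 s"
  proof -
    have "ell_int m p = ell_int (1 / w * sqrt (A - q)) (1 / w * sqrt (A + q))" by (simp add: m_def p_def)
    also have "\<dots> = ell_int (sqrt (A - q)) (sqrt (A + q)) / (1 / w)" using w by (intro ell_int_scale) simp
    finally show ?thesis using w sI by (simp add: lame_density_def A_def q_def)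
  qed
  finally show ?thesis .
qed

text \<open>Measurability is inherited from the integral of the kernel over x, which is measurable
  in s; the points e1, e2, e3 are treated separately.\<close>

lemma lame_density_measurable [measurable]: "lame_density e1 e2 e3 \<in> borel_measurable borel"
proof -
  interpret prob_space unif01 by (rule prob_space_unif)
  have eq: "lame_density e1 e2 e3 = (\<lambda>s. if s = e1 then lame_density e1 e2 e3 e1 else if s = e3 then lame_density e1 e2 e3 e3
      else if s = e2 then 0 else enn2real (\<integral>\<^sup>+x. lame_kernel x s \<partial>unif01))"
  proof
    fix s
    consider "s = e1" | "s = e3" | "s = e2" | "e3 < s" "s < e1" "s \<noteq> e2" | "\<not> (e3 \<le> s \<and> s \<le> e1)" by linarith
    then show "lame_density e1 e2 e3 s = (if s = e1 then lame_density e1 e2 e3 e1 else if s = e3 then lame_density e1 e2 e3 e3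
      else if s = e2 then 0 else enn2real (\<integral>\<^sup>+x. lame_kernel x s \<partial>unif01))"
    proof cases
      case 3
      then show ?thesis using e12 e23 by (simp add: lame_density_def)
    next
      case 4
      then show ?thesis using nn_integral_lame_kernel_inside[OF 4] lame_density_nonneg by simp
    next
      case 5
      then show ?thesis using nn_integral_lame_kernel_outside[OF 5] by (auto simp: lame_density_def)
    qed auto
  qed
  have [measurable]: "(\<lambda>s. \<integral>\<^sup>+x. lame_kernel x s \<partial>unif01) \<in> borel_measurable borel"
    by measurable
  show ?thesis by (subst eq) measurable
qed

text \<open>Conditioning on x gives the arcsine law, since its amplitude is positive for 0 < x < 1;
  Tonelli's theorem then moves the integral over x inside, where it has been evaluated.\<close>

theorem limit_law_eq_density: "limit_law e1 e2 e3 = density lborel (lame_density e1 e2 e3)"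
proof (rule measure_eqI)
  interpret X: prob_space unif01 by (rule prob_space_unif)
  interpret T: prob_space unifpi by (rule prob_space_unif)
  interpret pair_sigma_finite unif01 lborel ..
  show "sets (limit_law e1 e2 e3) = sets (density lborel (lame_density e1 e2 e3))"
    by (simp add: limit_law_def)
  fix S assume "S \<in> sets (limit_law e1 e2 e3)"
  then have S [measurable]: "S \<in> sets borel" by (simp add: limit_law_def)
  have "emeasure (limit_law e1 e2 e3) S = (\<integral>\<^sup>+z. indicator S (vv_Y e1 e2 e3 z) \<partial>(unif01 \<Otimes>\<^sub>M unifpi))"
    unfolding limit_law_def
    by (subst nn_integral_indicator[symmetric], simp, subst nn_integral_distr) auto
  also have "\<dots> = (\<integral>\<^sup>+x. \<integral>\<^sup>+\<theta>. indicator S (vv_Y e1 e2 e3 (x, \<theta>)) \<partial>unifpi \<partial>unif01)"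
    by (rule T.nn_integral_fst[symmetric]) measurable
  also have "\<dots> = (\<integral>\<^sup>+x. \<integral>\<^sup>+s. indicator S s * lame_kernel x s \<partial>lborel \<partial>unif01)"
  proof (rule nn_integral_cong_AE)
    show "AE x in unif01. (\<integral>\<^sup>+\<theta>. indicator S (vv_Y e1 e2 e3 (x, \<theta>)) \<partial>unifpi) = (\<integral>\<^sup>+s. indicator S s * lame_kernel x s \<partial>lborel)"
      using AE_unif01
    proof eventually_elim
      case (elim x)
      have "x\<^sup>2 < 1" using elim by (simp add: power_less_one_iff)
      then have a: "vv_A e1 e2 e3 x > 0" unfolding vv_A_def using elim e12 e23 by simp
      show ?case
        unfolding vv_Y_def prod.case
        by (subst nn_integral_arcsine[OF _ a]) (auto intro!: nn_integral_cong simp: lame_kernel_def indicator_def)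
    qed
  qed
  also have "\<dots> = (\<integral>\<^sup>+s. \<integral>\<^sup>+x. indicator S s * lame_kernel x s \<partial>unif01 \<partial>lborel)"
    by (rule Fubini'[symmetric]) measurable
  also have "\<dots> = (\<integral>\<^sup>+s. indicator S s * (\<integral>\<^sup>+x. lame_kernel x s \<partial>unif01) \<partial>lborel)"
    by (intro nn_integral_cong nn_integral_cmult) measurable
  also have "\<dots> = (\<integral>\<^sup>+s. ennreal (lame_density e1 e2 e3 s) * indicator S s \<partial>lborel)"
  proof (rule nn_integral_cong_AE)
    show "AE s in lborel. indicator S s * (\<integral>\<^sup>+x. lame_kernel x s \<partial>unif01) = ennreal (lame_density e1 e2 e3 s) * indicator S s"
      using AE_lborel_singleton[of e1] AE_lborel_singleton[of e2] AE_lborel_singleton[of e3]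
    proof eventually_elim
      case (elim s)
      show ?case
      proof (cases "e3 \<le> s \<and> s \<le> e1")
        case True
        then show ?thesis using nn_integral_lame_kernel_inside[of s] elim by (simp add: mult.commute)
      next
        case False
        then show ?thesis using nn_integral_lame_kernel_outside[OF False] by (auto simp: lame_density_def)
      qed
    qed
  qed
  also have "\<dots> = emeasure (density lborel (lame_density e1 e2 e3)) S"
    by (rule emeasure_density[symmetric]) measurable
  finally show "emeasure (limit_law e1 e2 e3) S = emeasure (density lborel (lame_density e1 e2 e3)) S" .
qed

text \<open>The mass is 1 because the measure is the image of a probability measure; the elliptic
  integral itself is never integrated over s.\<close>

lemma prob_space_lame_density: "prob_space (density lborel (lame_density e1 e2 e3))"
proof -
  interpret X: prob_space unif01 by (rule prob_space_unif)
  interpret T: prob_space unifpi by (rule prob_space_unif)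
  interpret pair_prob_space unif01 unifpi ..
  show ?thesis
    unfolding limit_law_eq_density[symmetric] limit_law_def by (rule prob_space_distr) measurable
qed

end

section \<open>Equivalence of the expressions for the density\<close>

lemma omega_eq:
  assumes "e1 > e2" "e2 > e3" "s \<in> {e3..e1}"
  shows "omega (e1 - e2) (e3 - e2) (s - e2) = dens_D e1 e2 e3 s / dens_A e1 e2 e3 s"
proof -
  have "(\<bar>e1 - e2\<bar> + \<bar>e3 - e2\<bar>) * \<bar>s - e2\<bar> = dens_D e1 e2 e3 s"
    using assms by (simp add: dens_D_def)
  \<comment> \<open>For s in [e3, e1] the two products are (A + D) / 2 and (A - D) / 2, in an order
    that depends on the side of e2.\<close>
  moreover have "\<bar>e1 - e2\<bar> * \<bar>e3 - e2 - (s - e2)\<bar> + \<bar>e3 - e2\<bar> * \<bar>e1 - e2 - (s - e2)\<bar> = dens_A e1 e2 e3 s"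
    using assms by (simp add: dens_A_def algebra_simps)
  ultimately show ?thesis unfolding omega_def by simp
qed

context
  fixes A D q :: real
  assumes AD: "0 < D" "D \<le> A" and q: "0 \<le> q" "q < A" "(A - q) * (A + q) = D\<^sup>2"
begin

lemma A_pos: "A > 0" using AD by simp

lemma sqrt_omega_eq: "sqrt (1 - (D / A)\<^sup>2) = q / A"
proof -
  have "1 - (D / A)\<^sup>2 = (A\<^sup>2 - D\<^sup>2) / A\<^sup>2" using A_pos by (simp add: field_simps)
  also have "\<dots> = (q / A)\<^sup>2" unfolding q(3)[symmetric] by (simp add: power_divide power2_eq_square algebra_simps)
  finally show ?thesis using A_pos q(1) by simp
qed

text \<open>Homogeneity extracts 1 / sqrt (A - q), which by (A - q)(A + q) = D^2 is the root in (i)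
  and (ii) with \<omega> = D / A and sqrt (1 - \<omega>^2) = q / A.\<close>

lemma ell_int_elliptic_K_form:
  "ell_int (sqrt (A - q)) (sqrt (A + q)) = sqrt ((1 + q / A) / (D * (D / A)))
     * ell_int 1 (sqrt (1 + 2 * (q / A) / (1 - q / A)))"
proof -
  have A: "A > 0" "A - q > 0" using A_pos q by auto
  have "(1 + q / A) / (D * (D / A)) = (A + q) / D\<^sup>2"
    using A AD by (simp add: field_simps power2_eq_square)
  also have "\<dots> = 1 / (A - q)" unfolding q(3)[symmetric] using A q(1) by simp
  finally have 1: "sqrt ((1 + q / A) / (D * (D / A))) = 1 / sqrt (A - q)" by (simp add: real_sqrt_divide)
  have "1 + 2 * (q / A) / (1 - q / A) = (A + q) / (A - q)" using A by (simp add: field_simps)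
  then have 2: "sqrt (A + q) = sqrt (A - q) * sqrt (1 + 2 * (q / A) / (1 - q / A))"
    using A by (simp add: real_sqrt_divide)
  have "ell_int (sqrt (A - q)) (sqrt (A + q)) = ell_int 1 (sqrt (1 + 2 * (q / A) / (1 - q / A))) / sqrt (A - q)"
    unfolding 2 using ell_int_scale[of "sqrt (A - q)" 1] A by simp
  then show ?thesis unfolding 1 by simp
qed

text \<open>One step of the arithmetic-geometric mean: the geometric mean of the two parameters is
  sqrt D, and the square of their arithmetic mean is (A + D) / 2. The root q is gone.\<close>

lemma ell_int_AD: "ell_int (sqrt (A - q)) (sqrt (A + q)) = ell_int (sqrt ((A + D) / 2)) (sqrt D)"
proof -
  have pos: "sqrt (A - q) > 0" "sqrt (A + q) > 0" using A_pos q by auto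
  have prod: "sqrt (A - q) * sqrt (A + q) = D"
    using AD by (simp add: real_sqrt_mult[symmetric] q(3))
  have "((sqrt (A - q) + sqrt (A + q)) / 2)\<^sup>2 = ((sqrt (A - q))\<^sup>2 + (sqrt (A + q))\<^sup>2 + 2 * (sqrt (A - q) * sqrt (A + q))) / 4"
    by (simp add: power2_eq_square algebra_simps)
  also have "\<dots> = (A + D) / 2" unfolding prod using AD q by simp
  finally have sum: "(sqrt (A - q) + sqrt (A + q)) / 2 = sqrt ((A + D) / 2)"
    using pos by (intro real_sqrt_unique[symmetric]) auto
  show ?thesis unfolding ell_int_gauss[OF pos] sum prod ..
qed

lemma ell_int_hyp2F1_form:
  "ell_int (sqrt (A - q)) (sqrt (A + q)) = 2 / sqrt (2 * (A + D)) * ell_int 1 (sqrt (1 - (A - D) / (A + D)))"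
proof -
  have P: "A + D > 0" using AD by simp
  define c where "c = sqrt ((A + D) / 2)"
  have c: "c > 0" using P by (simp add: c_def)
  have "1 - (A - D) / (A + D) = 2 * D / (A + D)" using P by (simp add: field_simps)
  then have "c * sqrt (1 - (A - D) / (A + D)) = sqrt ((A + D) / 2 * (2 * D / (A + D)))"
    by (simp only: c_def real_sqrt_mult)
  also have "(A + D) / 2 * (2 * D / (A + D)) = D" using P by simp
  finally have "ell_int c (sqrt D) = ell_int 1 (sqrt (1 - (A - D) / (A + D))) / c"
    using ell_int_scale[OF c, of 1 "sqrt (1 - (A - D) / (A + D))"] by simp
  moreover have "sqrt (2 * (A + D)) = 2 * c"
  proof -
    have "2 * (A + D) = 2\<^sup>2 * ((A + D) / 2)" by simp
    then have "sqrt (2 * (A + D)) = sqrt (2\<^sup>2) * c" unfolding c_def real_sqrt_mult[symmetric] by (simp only:)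
    then show ?thesis by simp
  qed
  ultimately show ?thesis unfolding ell_int_AD c_def[symmetric] using c by simp
qed

lemma omega_prefactor: "sqrt (D / A / (2 * D * (1 + D / A))) = 1 / sqrt (2 * (A + D))"
proof -
  have "2 * D * (1 + D / A) = 2 * (A + D) * (D / A)" using A_pos by (simp add: field_simps)
  then have "D / A / (2 * D * (1 + D / A)) = 1 / (2 * (A + D))" using AD by simp
  then show ?thesis by (simp add: real_sqrt_divide)
qed

lemma omega_argument: "(1 - D / A) / (1 + D / A) = (A - D) / (A + D)"
proof -
  have "1 - D / A = (A - D) / A" "1 + D / A = (A + D) / A" using A_pos by (simp_all add: field_simps)
  then show ?thesis using A_pos by simp
qed

end

lemma dens_ADq:
  assumes e: "e1 > e2" "e2 > e3" and s: "s \<in> {e3..e1} - {e2}"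
  shows "0 < dens_D e1 e2 e3 s" "dens_D e1 e2 e3 s \<le> dens_A e1 e2 e3 s"
    "0 \<le> dens_q e1 e2 e3 s" "dens_q e1 e2 e3 s < dens_A e1 e2 e3 s"
    "(dens_A e1 e2 e3 s - dens_q e1 e2 e3 s) * (dens_A e1 e2 e3 s + dens_q e1 e2 e3 s) = (dens_D e1 e2 e3 s)\<^sup>2"
  using dens_D_pos[OF e] dens_A_ge_D[OF e] dens_q_props[OF e s] s by auto

lemma lame_density_eq:
  assumes "e1 > e2" "e2 > e3" "s \<in> {e3..e1} - {e2}"
  shows "lame_density e1 e2 e3 s
    = ell_int (sqrt ((dens_A e1 e2 e3 s + dens_D e1 e2 e3 s) / 2)) (sqrt (dens_D e1 e2 e3 s)) / pi"
  unfolding ell_int_AD[OF dens_ADq[OF assms], symmetric] using assms by (simp add: lame_density_def)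

text \<open>Here the roots are ordered e1 > e2 > s > e3, and \<open>ell_int_four_roots\<close>
  produces (A + D) / 2 and D under the roots, which is the form after Gauss's step.\<close>

lemma lame_density_left:
  assumes "e3 < s" "s < e2" "e2 < e1"
  shows "lame_density e1 e2 e3 s = 1 / (2 * pi) * integral {e2..e1}
    (\<lambda>x. 1 / sqrt ((e1 - x) * (x - e2) * (x - e3) * (x - s)))"
proof -
  have e: "e1 > e2" "e2 > e3" "s \<in> {e3..e1} - {e2}" using assms by auto
  have "((\<lambda>x. 1 / sqrt ((e1 - x) * (x - e2) * (x - s) * (x - e3))) has_integral
     2 * ell_int (sqrt ((e1 - s) * (e2 - e3))) (sqrt ((e2 - s) * (e1 - e3)))) {e2..e1}"
    by (rule ell_int_four_roots) (use assms in auto)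
  moreover have 1: "(e1 - s) * (e2 - e3) = (dens_A e1 e2 e3 s + dens_D e1 e2 e3 s) / 2"
    using dens_AD_left(2)[of s e2 e1 e3] assms by simp
  moreover have 2: "(e2 - s) * (e1 - e3) = dens_D e1 e2 e3 s" using assms by (simp add: dens_D_def)
  moreover have "ell_int (sqrt ((e1 - s) * (e2 - e3))) (sqrt ((e2 - s) * (e1 - e3))) = pi * lame_density e1 e2 e3 s"
    unfolding lame_density_eq[OF e] 1 2 by simp
  ultimately have "((\<lambda>x. 1 / sqrt ((e1 - x) * (x - e2) * (x - s) * (x - e3))) has_integral
     2 * (pi * lame_density e1 e2 e3 s)) {e2..e1}"
    by (simp only:)
  then have "integral {e2..e1} (\<lambda>x. 1 / sqrt ((e1 - x) * (x - e2) * (x - e3) * (x - s))) = 2 * (pi * lame_density e1 e2 e3 s)"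
    by (intro integral_unique) (simp only: mult.assoc mult.commute[of "_ - e3"])
  then show ?thesis by simp
qed

text \<open>Reflection at 0 brings the roots into the order -e3 > -e2 > -s > -e1 expected by
  \<open>ell_int_four_roots\<close>.\<close>

lemma lame_density_right:
  assumes "e2 < s" "s < e1" "e3 < e2"
  shows "lame_density e1 e2 e3 s = 1 / (2 * pi) * integral {e3..e2}
    (\<lambda>x. 1 / sqrt ((e1 - x) * (e2 - x) * (x - e3) * (s - x)))"
proof -
  have e: "e1 > e2" "e2 > e3" "s \<in> {e3..e1} - {e2}" using assms by auto
  have "((\<lambda>x. 1 / sqrt ((- e3 - x) * (x - - e2) * (x - - s) * (x - - e1))) has_integral
     2 * ell_int (sqrt ((- e3 - - s) * (- e2 - - e1))) (sqrt ((- e2 - - s) * (- e3 - - e1)))) {- e2..- e3}"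
    by (rule ell_int_four_roots) (use assms in auto)
  then have "((\<lambda>x. 1 / sqrt ((- e3 - - x) * (- x - - e2) * (- x - - s) * (- x - - e1))) has_integral
     2 * ell_int (sqrt ((- e3 - - s) * (- e2 - - e1))) (sqrt ((- e2 - - s) * (- e3 - - e1)))) {e3..e2}"
    by (subst (asm) has_integral_reflect_real[symmetric]) simp
  moreover have 1: "(- e3 - - s) * (- e2 - - e1) = (dens_A e1 e2 e3 s + dens_D e1 e2 e3 s) / 2"
    using dens_AD_right(2)[of e2 s e1 e3] assms by (simp add: algebra_simps)
  moreover have 2: "(- e2 - - s) * (- e3 - - e1) = dens_D e1 e2 e3 s" using assms by (simp add: dens_D_def)
  moreover have "ell_int (sqrt ((- e3 - - s) * (- e2 - - e1))) (sqrt ((- e2 - - s) * (- e3 - - e1))) = pi * lame_density e1 e2 e3 s"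
    unfolding lame_density_eq[OF e] 1 2 by simp
  moreover have "(- e3 - - x) * (- x - - e2) * (- x - - s) * (- x - - e1) = (e1 - x) * (e2 - x) * (x - e3) * (s - x)" for x
    by (simp add: algebra_simps)
  ultimately have "((\<lambda>x. 1 / sqrt ((e1 - x) * (e2 - x) * (x - e3) * (s - x))) has_integral
     2 * (pi * lame_density e1 e2 e3 s)) {e3..e2}"
    by (simp only:)
  then have "integral {e3..e2} (\<lambda>x. 1 / sqrt ((e1 - x) * (e2 - x) * (x - e3) * (s - x))) = 2 * (pi * lame_density e1 e2 e3 s)"
    by (rule integral_unique)
  then show ?thesis by simp
qed

lemma lame_density_forms:
  assumes e12: "e1 > e2" and e23: "e2 > e3" and s: "s \<in> {e3..e1} - {e2}"
  shows "let \<omega> = omega (e1 - e2) (e3 - e2) (s - e2);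
           r = sqrt (1 - \<omega>\<^sup>2);
           D = (e1 - e3) * \<bar>s - e2\<bar>;
           A = (e1 + e3 - 2 * e2) * (s - e2) + 2 * (e1 - e2) * (e2 - e3)
       in complex_of_real (lame_density e1 e2 e3 s) =
            of_real (1 / pi * sqrt ((1 + r) / (D * \<omega>)))
            * elliptic_K (\<i> * of_real (sqrt (2 * r / (1 - r)))) \<and>
          complex_of_real (lame_density e1 e2 e3 s) =
            of_real (1 / 2 * sqrt ((1 + r) / (D * \<omega>)))
            * hyp2F1 (1 / 2) (1 / 2) 1 (of_real (- (2 * r / (1 - r)))) \<and>
          complex_of_real (lame_density e1 e2 e3 s) =
            of_real (sqrt (\<omega> / (2 * D * (1 + \<omega>))))
            * hyp2F1 (1 / 2) (1 / 2) 1 (of_real ((1 - \<omega>) / (1 + \<omega>))) \<and>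
          complex_of_real (lame_density e1 e2 e3 s) =
            of_real (1 / sqrt (2 * (A + D)))
            * hyp2F1 (1 / 2) (1 / 2) 1 (of_real ((A - D) / (A + D)))"
proof -
  note e = e12 e23 s
  define A D q where "A = dens_A e1 e2 e3 s" and "D = dens_D e1 e2 e3 s" and "q = dens_q e1 e2 e3 s"
  have A: "(e1 + e3 - 2 * e2) * (s - e2) + 2 * (e1 - e2) * (e2 - e3) = A" and D: "(e1 - e3) * \<bar>s - e2\<bar> = D"
    by (simp_all add: A_def D_def dens_A_def dens_D_def)
  note ADq = dens_ADq[OF e, folded A_def D_def q_def]
  have om: "omega (e1 - e2) (e3 - e2) (s - e2) = D / A" "sqrt (1 - (D / A)\<^sup>2) = q / A"
    using omega_eq[OF e12 e23, of s] s sqrt_omega_eq[OF ADq] by (simp_all add: A_def D_def)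
  have AD': "0 < D" "D \<le> A" "0 \<le> q" "q < A" using ADq by auto
  have dens: "lame_density e1 e2 e3 s = ell_int (sqrt (A - q)) (sqrt (A + q)) / pi"
    using s by (simp add: lame_density_def A_def q_def)
  define z where "z = 2 * (q / A) / (1 - q / A)"
  have z: "z \<ge> 0" using AD' by (simp add: z_def field_simps)
  have K: "elliptic_K (\<i> * of_real (sqrt z)) = of_real (ell_int 1 (sqrt (1 + z)))"
    using elliptic_K_imaginary[of "sqrt z"] z by simp
  have F2: "hyp2F1 (1 / 2) (1 / 2) 1 (of_real (- z)) = of_real (2 / pi * ell_int 1 (sqrt (1 + z)))"
    using hyp2F1_half_half_one[of "- z"] z by simp
  have F4: "hyp2F1 (1 / 2) (1 / 2) 1 (of_real ((A - D) / (A + D)))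
      = of_real (2 / pi * ell_int 1 (sqrt (1 - (A - D) / (A + D))))"
    by (rule hyp2F1_half_half_one) (use AD' in \<open>simp add: field_simps\<close>)
  have f1: "lame_density e1 e2 e3 s = 1 / pi * sqrt ((1 + q / A) / (D * (D / A))) * ell_int 1 (sqrt (1 + z))"
    unfolding dens ell_int_elliptic_K_form[OF ADq] z_def by simp
  have f4: "lame_density e1 e2 e3 s = 1 / sqrt (2 * (A + D)) * (2 / pi * ell_int 1 (sqrt (1 - (A - D) / (A + D))))"
    unfolding dens ell_int_hyp2F1_form[OF ADq] by simp
  note f3 = omega_prefactor[OF ADq] omega_argument[OF ADq]
  have f2: "lame_density e1 e2 e3 s = 1 / 2 * sqrt ((1 + q / A) / (D * (D / A))) * (2 / pi * ell_int 1 (sqrt (1 + z)))"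
    unfolding f1 by simp
  show ?thesis
    unfolding Let_def A D om f3 z_def[symmetric] K F2 F4
    using f1 f2 f4 by (simp only: of_real_mult[symmetric] simp_thms)
qed

section \<open>Convergence of the root-counting measures\<close>

text \<open>Polya's theorem. The tails are controlled at two points a and b; compactness covers
  [a, b] by finitely many intervals on which the continuous limit varies by less than e / 2, and
  monotonicity extends control from their ends to all points.\<close>

lemma weak_conv_m_imp_uniform_cdf:
  fixes M :: "nat \<Rightarrow> real measure" and M' :: "real measure"
  assumes M: "\<And>n. real_distribution (M n)" and M': "real_distribution M'"
    and conv: "weak_conv_m M M'" and cont: "\<And>x. measure M' {x} = 0"
  shows "uniform_limit UNIV (\<lambda>n. cdf (M n)) (cdf M') sequentially"
proof (rule uniform_limitI)
  fix e :: real assume e: "e > 0"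
  interpret M: real_distribution "M n" for n by (rule M)
  interpret M': real_distribution M' by (rule M')
  let ?F = "cdf M'"
  have isc: "isCont ?F x" for x using cont by (simp add: M'.isCont_cdf)
  have lim: "(\<lambda>n. cdf (M n) x) \<longlonglongrightarrow> ?F x" for x
    using conv isc by (simp add: weak_conv_m_def weak_conv_def)
  have near: "eventually (\<lambda>n. \<bar>cdf (M n) x - ?F x\<bar> < e / 2) sequentially" for x
    using tendstoD[OF lim, of "e / 2" x] e by (simp add: dist_real_def)
  have "eventually (\<lambda>x. ?F x < e / 2) at_bot"
    using order_tendstoD(2)[OF M'.cdf_lim_at_bot, of "e / 2"] e by simp
  then obtain a where a: "?F a < e / 2" using eventually_happens' trivial_limit_at_bot_linorder by blast
  have "eventually (\<lambda>x. ?F x > 1 - e / 2) at_top"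
    using order_tendstoD(1)[OF M'.cdf_lim_at_top_prob, of "1 - e / 2"] e by simp
  then obtain b where b: "?F b > 1 - e / 2" using eventually_happens' trivial_limit_at_top_linorder by blast
  have "\<exists>d>0. ?F (x + d) - ?F (x - d) < e / 2" for x
  proof -
    have "((\<lambda>d. ?F (x + d) - ?F (x - d)) \<longlongrightarrow> ?F (x + 0) - ?F (x - 0)) (at_right 0)"
      using isc[of x] by (intro tendsto_diff isCont_tendsto_compose[of _ ?F]) (auto intro!: tendsto_eq_intros)
    then have "eventually (\<lambda>d. ?F (x + d) - ?F (x - d) < e / 2) (at_right 0)"
      using e by (intro order_tendstoD(2)) auto
    then have "eventually (\<lambda>d. d > 0 \<and> ?F (x + d) - ?F (x - d) < e / 2) (at_right 0)"
      using eventually_at_right_less[of "0::real"] by eventually_elim simp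
    then show ?thesis using eventually_happens' trivial_limit_at_right_real by blast
  qed
  then obtain d where d: "\<And>x. d x > 0" "\<And>x. ?F (x + d x) - ?F (x - d x) < e / 2" by metis
  obtain X where X: "finite X" "{a..b} \<subseteq> (\<Union>x\<in>X. ball x (d x))"
  proof -
    have "{a..b} \<subseteq> (\<Union>x\<in>{a..b}. ball x (d x))" using d(1) by auto
    from compactE_image[OF compact_Icc _ this] show ?thesis using that by blast
  qed
  have "eventually (\<lambda>n. \<forall>y\<in>insert a (insert b ((\<lambda>x. x + d x) ` X \<union> (\<lambda>x. x - d x) ` X)).
      \<bar>cdf (M n) y - ?F y\<bar> < e / 2) sequentially"
    using X(1) near by (intro eventually_ball_finite) auto
  then show "eventually (\<lambda>n. \<forall>y\<in>UNIV. dist (cdf (M n) y) (?F y) < e) sequentially"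
  proof eventually_elim
    case (elim n)
    show ?case
    proof
      fix y
      have bounds: "0 \<le> ?F y" "?F y \<le> 1" "0 \<le> cdf (M n) y" "cdf (M n) y \<le> 1"
        by (simp_all add: M'.cdf_nonneg M'.cdf_bounded_prob M.cdf_nonneg M.cdf_bounded_prob)
      have mono: "cdf (M n) u \<le> cdf (M n) v" "?F u \<le> ?F v" if "u \<le> v" for u v
        using that by (auto intro: M.cdf_nondecreasing M'.cdf_nondecreasing)
      consider "y < a" | "y > b" | "y \<in> {a..b}" by force
      then have "\<bar>cdf (M n) y - ?F y\<bar> < e"
      proof cases
        case 1
        have "\<bar>cdf (M n) a - ?F a\<bar> < e / 2" using elim by simp
        moreover have "cdf (M n) y \<le> cdf (M n) a" "?F y \<le> ?F a" using mono[of y a] 1 by auto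
        ultimately show ?thesis using a bounds by linarith
      next
        case 2
        have "\<bar>cdf (M n) b - ?F b\<bar> < e / 2" using elim by simp
        moreover have "cdf (M n) b \<le> cdf (M n) y" "?F b \<le> ?F y" using mono[of b y] 2 by auto
        ultimately show ?thesis using b bounds by linarith
      next
        case 3
        then obtain x where x: "x \<in> X" "y \<in> ball x (d x)" using X(2) by blast
        then have y: "x - d x \<le> y" "y \<le> x + d x" by (auto simp: dist_real_def)
        have "\<bar>cdf (M n) (x + d x) - ?F (x + d x)\<bar> < e / 2" "\<bar>cdf (M n) (x - d x) - ?F (x - d x)\<bar> < e / 2"
          using elim x(1) by auto
        then show ?thesis using mono[OF y(1)] mono[OF y(2)] d(2)[of x] by linarith
      qed
      then show "dist (cdf (M n) y) (?F y) < e" by (simp add: dist_real_def)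
    qed
  qed
qed

text \<open>The measure is the law of a root with uniformly chosen index, so its integrals become
  finite sums over a probability mass function.\<close>

lemma root_counting_measure_eq_distr:
  "root_counting_measure e1 e2 e3 \<alpha>1 \<alpha>2 \<alpha>3 n
   = distr (measure_pmf (pmf_of_set {1..n + 1})) borel (van_vleck_root e1 e2 e3 \<alpha>1 \<alpha>2 \<alpha>3 n)"
proof (rule measure_eqI)
  fix A assume "A \<in> sets (root_counting_measure e1 e2 e3 \<alpha>1 \<alpha>2 \<alpha>3 n)"
  then have A: "A \<in> sets borel" by simp
  let ?r = "van_vleck_root e1 e2 e3 \<alpha>1 \<alpha>2 \<alpha>3 n"
  have "emeasure (distr (measure_pmf (pmf_of_set {1..n + 1})) borel ?r) A
      = (\<integral>\<^sup>+j. indicator A (?r j) \<partial>measure_pmf (pmf_of_set {1..n + 1}))"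
    using A by (subst nn_integral_indicator[symmetric], simp, subst nn_integral_distr) auto
  also have "\<dots> = (\<Sum>j=1..n + 1. indicator A (?r j)) / of_nat (n + 1)"
    by (subst nn_integral_pmf_of_set) auto
  also have "\<dots> = emeasure (root_counting_measure e1 e2 e3 \<alpha>1 \<alpha>2 \<alpha>3 n) A"
    using A by (simp add: emeasure_root_counting_measure)
  finally show "emeasure (root_counting_measure e1 e2 e3 \<alpha>1 \<alpha>2 \<alpha>3 n) A
    = emeasure (distr (measure_pmf (pmf_of_set {1..n + 1})) borel ?r) A" ..
qed simp

lemma real_distribution_root_counting_measure:
  "real_distribution (root_counting_measure e1 e2 e3 \<alpha>1 \<alpha>2 \<alpha>3 n)"
proof -
  have "prob_space (root_counting_measure e1 e2 e3 \<alpha>1 \<alpha>2 \<alpha>3 n)"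
    unfolding root_counting_measure_eq_distr
    by (rule prob_space.prob_space_distr) (auto simp: measure_pmf.prob_space_axioms)
  then show ?thesis by (simp add: real_distribution_def real_distribution_axioms_def)
qed

lemma char_root_counting_measure:
  assumes e: "e1 > e2" "e2 > e3" and \<alpha>: "\<alpha>1 > 0" "\<alpha>2 > 0" "\<alpha>3 > 0" and n: "n \<ge> 1"
  shows "char (root_counting_measure e1 e2 e3 \<alpha>1 \<alpha>2 \<alpha>3 n) t
    = (\<Sum>s | poly (jac_poly (vv_diag e1 e2 e3 \<alpha>1 \<alpha>2 \<alpha>3 n) (vv_off e1 e2 e3 \<alpha>1 \<alpha>2 \<alpha>3 n) (Suc n)) s = 0.
         exp (\<i> * of_real (t * s))) / of_nat (Suc n)"
proof -
  define T where "T = {s. poly (jac_poly (vv_diag e1 e2 e3 \<alpha>1 \<alpha>2 \<alpha>3 n) (vv_off e1 e2 e3 \<alpha>1 \<alpha>2 \<alpha>3 n) (Suc n)) s = 0}"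
  have cT: "card T = Suc n"
    unfolding T_def by (rule card_jac_poly_roots) (use vv_off_pos[OF e \<alpha> n] in auto)
  then have fT: "finite T" by (metis card.infinite nat.distinct(1))
  let ?r = "van_vleck_root e1 e2 e3 \<alpha>1 \<alpha>2 \<alpha>3 n"
  let ?f = "\<lambda>s. exp (\<i> * complex_of_real (t * s))"
  have r: "?r j = sorted_list_of_set T ! (j - 1)" for j
    unfolding van_vleck_root_def van_vleck_roots_eq[OF e \<alpha> n] T_def ..
  have "char (root_counting_measure e1 e2 e3 \<alpha>1 \<alpha>2 \<alpha>3 n) t = (\<integral>j. ?f (?r j) \<partial>measure_pmf (pmf_of_set {1..n + 1}))"
    unfolding char_def root_counting_measure_eq_distr by (subst integral_distr) auto
  also have "\<dots> = (\<Sum>j=1..n + 1. pmf (pmf_of_set {1..n + 1}) j *\<^sub>R ?f (?r j))"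
    by (rule integral_measure_pmf) auto
  also have "\<dots> = (\<Sum>j=1..n + 1. ?f (?r j)) / of_nat (Suc n)"
    unfolding sum_divide_distrib by (intro sum.cong refl) (simp add: scaleR_conv_of_real)
  \<comment> \<open>Indices run from 1 and list positions from 0. As T has n + 1 elements, the
    positions used are exactly those of the sorted list, and each root occurs once.\<close>
  also have "(\<Sum>j=1..n + 1. ?f (?r j)) = (\<Sum>j<Suc n. ?f (sorted_list_of_set T ! j))"
    unfolding r by (rule sum.reindex_bij_witness[of _ Suc "\<lambda>j. j - 1"]) auto
  also have "\<dots> = sum_list (map ?f (sorted_list_of_set T))"
    using cT fT by (simp add: sum_list_sum_nth atLeast0LessThan)
  also have "\<dots> = (\<Sum>s\<in>T. ?f s)"
    using fT by (simp add: sum_list_distinct_conv_sum_set)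
  finally show ?thesis unfolding T_def .
qed

lemma real_distribution_lame_density:
  assumes "e1 > e2" "e2 > e3"
  shows "real_distribution (density lborel (lame_density e1 e2 e3))"
  using prob_space_lame_density[OF assms] by (simp add: real_distribution_def real_distribution_axioms_def)

lemma root_counting_measure_weak_conv:
  assumes e: "e1 > e2" "e2 > e3" and \<alpha>: "\<alpha>1 > 0" "\<alpha>2 > 0" "\<alpha>3 > 0"
  shows "weak_conv_m (root_counting_measure e1 e2 e3 \<alpha>1 \<alpha>2 \<alpha>3) (density lborel (lame_density e1 e2 e3))"
proof (rule levy_continuity)
  fix t
  have "eventually (\<lambda>n. (\<Sum>s | poly (jac_poly (vv_diag e1 e2 e3 \<alpha>1 \<alpha>2 \<alpha>3 n) (vv_off e1 e2 e3 \<alpha>1 \<alpha>2 \<alpha>3 n) (Suc n)) s = 0.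
         exp (\<i> * of_real (t * s))) / of_nat (Suc n) = char (root_counting_measure e1 e2 e3 \<alpha>1 \<alpha>2 \<alpha>3 n) t) sequentially"
    using eventually_ge_at_top[of 1] by eventually_elim (simp only: char_root_counting_measure[OF e \<alpha>])
  then show "(\<lambda>n. char (root_counting_measure e1 e2 e3 \<alpha>1 \<alpha>2 \<alpha>3 n) t) \<longlonglongrightarrow> char (density lborel (lame_density e1 e2 e3)) t"
    unfolding limit_law_eq_density[OF e, symmetric]
    by (rule Lim_transform_eventually[OF root_char_tendsto[OF e \<alpha>]])
qed (simp_all add: real_distribution_root_counting_measure real_distribution_lame_density[OF e])

text \<open>One function is asserted to equal all the expressions, which expresses their
  equivalence. The forms with \<omega> are asserted off e2, where D = \<omega> = 0.\<close>

theorem theorem1: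
  fixes e1 e2 e3 \<alpha>1 \<alpha>2 \<alpha>3 :: real
  assumes "e1 > e2" and "e2 > e3"
    and "\<alpha>1 > 0" and "\<alpha>2 > 0" and "\<alpha>3 > 0"
  shows "\<exists>\<rho> :: real \<Rightarrow> real.
    \<rho> \<in> borel_measurable borel \<and> (\<forall>s. \<rho> s \<ge> 0) \<and> (\<forall>s. s \<notin> {e3..e1} \<longrightarrow> \<rho> s = 0) \<and>
    prob_space (density lborel \<rho>) \<and>
    weak_conv_m (root_counting_measure e1 e2 e3 \<alpha>1 \<alpha>2 \<alpha>3) (density lborel \<rho>) \<and>
    uniform_limit UNIV (\<lambda>n. cdf (root_counting_measure e1 e2 e3 \<alpha>1 \<alpha>2 \<alpha>3 n))
      (cdf (density lborel \<rho>)) sequentially \<and>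
    (\<forall>s \<in> {e3..e1} - {e2}.
       let \<omega> = omega (e1 - e2) (e3 - e2) (s - e2);
           r = sqrt (1 - \<omega>\<^sup>2);
           D = (e1 - e3) * \<bar>s - e2\<bar>;
           A = (e1 + e3 - 2 * e2) * (s - e2) + 2 * (e1 - e2) * (e2 - e3)
       in complex_of_real (\<rho> s) =
            of_real (1 / pi * sqrt ((1 + r) / (D * \<omega>)))
            * elliptic_K (\<i> * of_real (sqrt (2 * r / (1 - r)))) \<and>
          complex_of_real (\<rho> s) =
            of_real (1 / 2 * sqrt ((1 + r) / (D * \<omega>)))
            * hyp2F1 (1 / 2) (1 / 2) 1 (of_real (- (2 * r / (1 - r)))) \<and>
          complex_of_real (\<rho> s) =
            of_real (sqrt (\<omega> / (2 * D * (1 + \<omega>))))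
            * hyp2F1 (1 / 2) (1 / 2) 1 (of_real ((1 - \<omega>) / (1 + \<omega>))) \<and>
          complex_of_real (\<rho> s) =
            of_real (1 / sqrt (2 * (A + D)))
            * hyp2F1 (1 / 2) (1 / 2) 1 (of_real ((A - D) / (A + D)))) \<and>
    (\<forall>s. e3 < s \<and> s < e2 \<longrightarrow>
       \<rho> s = 1 / (2 * pi) * integral {e2..e1}
         (\<lambda>x. 1 / sqrt ((e1 - x) * (x - e2) * (x - e3) * (x - s)))) \<and>
    (\<forall>s. e2 < s \<and> s < e1 \<longrightarrow>
       \<rho> s = 1 / (2 * pi) * integral {e3..e2}
         (\<lambda>x. 1 / sqrt ((e1 - x) * (e2 - x) * (x - e3) * (s - x))))"
proof -
  note e = assms(1,2)
  have wc: "weak_conv_m (root_counting_measure e1 e2 e3 \<alpha>1 \<alpha>2 \<alpha>3) (density lborel (lame_density e1 e2 e3))"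
    by (rule root_counting_measure_weak_conv[OF assms])
  \<comment> \<open>Absolute continuity excludes atoms, the remaining condition for uniform
    convergence of the distribution functions.\<close>
  have "measure (density lborel (lame_density e1 e2 e3)) {x} = 0" for x
  proof -
    have "emeasure (density lborel (lame_density e1 e2 e3)) {x} = (\<integral>\<^sup>+s. ennreal (lame_density e1 e2 e3 s) * indicator {x} s \<partial>lborel)"
      using lame_density_measurable[OF e] by (intro emeasure_density) auto
    also have "\<dots> = 0"
      by (subst nn_integral_indicator_singleton) auto
    finally show ?thesis by (simp add: measure_def)
  qed
  then have ul: "uniform_limit UNIV (\<lambda>n. cdf (root_counting_measure e1 e2 e3 \<alpha>1 \<alpha>2 \<alpha>3 n))
      (cdf (density lborel (lame_density e1 e2 e3))) sequentially"
    by (intro weak_conv_m_imp_uniform_cdf real_distribution_root_counting_measure real_distribution_lame_density e wc)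
  have out: "\<forall>s. s \<notin> {e3..e1} \<longrightarrow> lame_density e1 e2 e3 s = 0"
    by (simp add: lame_density_def)
  show ?thesis
    by (intro exI[of _ "lame_density e1 e2 e3"] conjI ballI)
      (use lame_density_measurable[OF e] lame_density_nonneg[OF e] out prob_space_lame_density[OF e] wc ul
         lame_density_forms[OF e] lame_density_left[of e3 _ e2 e1] lame_density_right[of e2 _ e1 e3] e in blast)+
qed

end
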